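(* Let $(\mathcal{R},\mu)$ and $(\mathcal{S},\nu)$ be nonatomic $\sigma$-finite measure spaces. Let $1<p<q$ and $r=\frac{q}{q-p}$. Then, for every couple of rearrangement-invariant function spaces $X(\mathcal{R},\mu)$ and $Y(\mathcal{S},\nu)$ with $X(\mathcal{R},\mu)\subseteq(L^p+L^{q,\infty})(\mathcal{R},\mu)$, the following three statements are equivalent: (i) Every linear $(p,q)$-sawyerable operator $T$ is bounded from $X(\mathcal{R},\mu)$ to $Y^{\langle p\rangle}(\mathcal{S},\nu)$. (ii) Every quasi-linear $(p,q)$-sawyerable operator $T$ is bounded from $X(\mathcal{R},\mu)$ to $Y^{\langle p\rangle}(\mathcal{S},\nu)$. (iii) The operator $R_{p,q}$, defined by $$R_{p,q}g(t)=\Big(\frac1t\int_0^{t^{r}}g^*(s)^p\,ds\Big)^{\frac1p},\quad t\in(0,\infty),$$ is bounded from $\bar X(0,\mu(\mathcal{R}))$ to $\bar Y(0,\nu(\mathcal{S}))$, where $\bar X(0,\mu(\mathcal{R}))$ and $\bar Y(0,\nu(\mathcal{S}))$ are the representation spaces of $X(\mathcal{R},\mu)$ and $Y(\mathcal{S},\nu)$.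
   Context: $\mathfrak{M}(\mathcal{R},\mu)$ is the set of $\mu$-measurable functions, $\mathfrak{M}^+$ the nonnegative ones, $\mathfrak{M}_0$ those finite a.e. The nonincreasing rearrangement is $f^*_\mu(t)=\inf\{\lambda>0:\mu(\{|f|>\lambda\})\le t\}$ and $f^{**}_\mu(t)=\frac1t\int_0^tf^*_\mu(s)\,ds$, $t\in(0,\infty)$; on intervals with Lebesgue measure the subscript is omitted. Two functions (possibly on different measure spaces) are equimeasurable if their moduli have the same distribution function. A rearrangement-invariant (r.i.) function norm is a functional $\|\cdot\|_{X(\mathcal{R},\mu)}:\mathfrak{M}^+(\mathcal{R},\mu)\to[0,\infty]$ that is a norm (positively homogeneous, subadditive, zero only for $f=0$ a.e.), is monotone ($f\le g$ a.e. implies $\|f\|\le\|g\|$), has the Fatou property ($f_j\nearrow f$ a.e. implies $\|f_j\|\nearrow\|f\|$), satisfies $\|\chi_E\|<\infty$ and $\int_Ef\,d\mu\le C_E\|f\|$ whenever $\mu(E)<\infty$, and gives equal values to equimeasurable functions. It is extended by $\|f\|=\|\,|f|\,\|$; $X(\mathcal{R},\mu)=\{f:\|f\|_{X(\mathcal{R},\mu)}<\infty\}$ is an r.i. function space. Its representation space $\bar X(0,\mu(\mathcal{R}))$ is the unique r.i. function space over $(0,\mu(\mathcal{R}))$ with Lebesgue measure such that $\|f\|_{X(\mathcal{R},\mu)}=\|f^*_\mu\|_{\bar X(0,\mu(\mathcal{R}))}$ for all $f$. Functions on $(0,\mu(\mathcal R))$ are extended by $0$ to $(0,\infty)$ when $R_{p,q}$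 is applied, and $R_{p,q}g$ is restricted to $(0,\nu(\mathcal{S}))$. $\|f\|_{L^{q,\infty}}=\sup_{t>0}t^{1/q}f^*_\mu(t)$. For spaces $X,Y$, $(X+Y)$ has norm $\inf_{f=g+h}(\|g\|_X+\|h\|_Y)$. The inclusion $X\subseteq Z$ means $\|f\|_Z\le C\|f\|_X$ for all measurable $f$. $Y^{\langle p\rangle}(\mathcal{S},\nu)$ is the set of $f$ with $\|f\|_{Y^{\langle p\rangle}(\mathcal{S},\nu)}=\big\|\big((|f|^p)^{**}_\nu\big)^{1/p}\big\|_{\bar Y(0,\nu(\mathcal{S}))}<\infty$. An operator $T$ from a linear space of functions in $\mathfrak{M}_0(\mathcal{R},\mu)$ into $\mathfrak{M}_0(\mathcal{S},\nu)$ is quasi-linear if for some $k\ge1$, $|T(f+g)|\le k(|Tf|+|Tg|)$ and $|T(\alpha f)|=|\alpha||Tf|$ $\nu$-a.e. for all $f,g$ in the space and all scalars $\alpha$. For $1<p<q$, an operator $T$ defined on $(L^p+L^{q,\infty})(\mathcal{R},\mu)$ with values in $\mathfrak{M}_0(\mathcal{S},\nu)$ is $(p,q)$-sawyerable if it is quasi-linear and is bounded from $L^p(\mathcal{R},\mu)$ to $L^p(\mathcal{S},\nu)$ and from $L^{q,\infty}(\mathcal{R},\mu)$ to $L^\infty(\mathcal{S},\nu)$. An operator is bounded from $X$ to $Z$ if $\|Tf\|_Z\le C\|f\|_X$ for all $f\in X$ with some constant $C$. *)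

theory Defs
  imports "HOL-Analysis.Analysis" "HOL-Probability.Essential_Supremum"
begin

text \<open>Functions in \<open>\<MM>\<^sup>+\<close> are measurable functions into \<^typ>\<open>ennreal\<close>. Functions in \<open>\<MM>\<^sub>0\<close>
  (finite almost everywhere) are represented by measurable functions into the scalar field \<open>'k\<close>,
  where the sort \<open>{real_normed_field, euclidean_space}\<close> covers the real and the complex numbers.
  Spaces of functions are given by their function norms.\<close>

definition nonatomic :: "'a measure \<Rightarrow> bool" where
  "nonatomic M \<longleftrightarrow> (\<forall>A\<in>sets M. 0 < emeasure M A \<longrightarrow>
     (\<exists>B\<in>sets M. B \<subseteq> A \<and> 0 < emeasure M B \<and> emeasure M B < emeasure M A))"

text \<open>Powers of extended nonnegative numbers; only used for exponents \<open>a > 0\<close>.\<close>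

definition epowr :: "ennreal \<Rightarrow> real \<Rightarrow> ennreal" where
  "epowr x a = (if x = \<infinity> then \<infinity> else ennreal (enn2real x powr a))"

text \<open>Lebesgue measure on the interval \<open>(0, a)\<close>, where \<open>a\<close> may be infinite.\<close>

definition lborel_Ioo :: "ennreal \<Rightarrow> real measure" where
  "lborel_Ioo a = restrict_space lborel {t. 0 < t \<and> ennreal t < a}"

definition zero_extension :: "ennreal \<Rightarrow> (real \<Rightarrow> ennreal) \<Rightarrow> real \<Rightarrow> ennreal" where
  "zero_extension a g t = (if 0 < t \<and> ennreal t < a then g t else 0)"

definition distribution_fun :: "'a measure \<Rightarrow> ('a \<Rightarrow> ennreal) \<Rightarrow> real \<Rightarrow> ennreal" where
  "distribution_fun M f l = emeasure M {x \<in> space M. ennreal l < f x}"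

text \<open>\<open>f\<^sup>*\<close> and \<open>f\<^sup>*\<^sup>*\<close>; the values at \<open>t \<le> 0\<close> are irrelevant.\<close>

definition rearrangement :: "'a measure \<Rightarrow> ('a \<Rightarrow> ennreal) \<Rightarrow> real \<Rightarrow> ennreal" where
  "rearrangement M f t = Inf {ennreal l | l. 0 < l \<and> distribution_fun M f l \<le> ennreal t}"

definition maximal_rearrangement :: "'a measure \<Rightarrow> ('a \<Rightarrow> ennreal) \<Rightarrow> real \<Rightarrow> ennreal" where
  "maximal_rearrangement M f t = (\<integral>\<^sup>+s\<in>{0<..<t}. rearrangement M f s \<partial>lborel) / ennreal t"

locale ri_function_norm =
  fixes M :: "'a measure" and \<rho> :: "('a \<Rightarrow> ennreal) \<Rightarrow> ennreal"
  assumes homogeneous: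
      "f \<in> borel_measurable M \<Longrightarrow> 0 \<le> c \<Longrightarrow> \<rho> (\<lambda>x. ennreal c * f x) = ennreal c * \<rho> f"
    and subadditive:
      "f \<in> borel_measurable M \<Longrightarrow> g \<in> borel_measurable M \<Longrightarrow> \<rho> (\<lambda>x. f x + g x) \<le> \<rho> f + \<rho> g"
    and zero_iff:
      "f \<in> borel_measurable M \<Longrightarrow> \<rho> f = 0 \<longleftrightarrow> (AE x in M. f x = 0)"
    and monotone:
      "f \<in> borel_measurable M \<Longrightarrow> g \<in> borel_measurable M \<Longrightarrow> AE x in M. f x \<le> g x \<Longrightarrow> \<rho> f \<le> \<rho> g"
    and fatou:
      "(\<And>j::nat. F j \<in> borel_measurable M) \<Longrightarrow> f \<in> borel_measurable M \<Longrightarrow>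
       AE x in M. incseq (\<lambda>j. F j x) \<and> (\<lambda>j. F j x) \<longlonglongrightarrow> f x \<Longrightarrow>
       incseq (\<lambda>j. \<rho> (F j)) \<and> (\<lambda>j. \<rho> (F j)) \<longlonglongrightarrow> \<rho> f"
    and indicator_finite:
      "E \<in> sets M \<Longrightarrow> emeasure M E < \<infinity> \<Longrightarrow> \<rho> (indicator E) < \<infinity>"
    and locally_integrable:
      "E \<in> sets M \<Longrightarrow> emeasure M E < \<infinity> \<Longrightarrow>
       \<exists>C>0. \<forall>f\<in>borel_measurable M. (\<integral>\<^sup>+x\<in>E. f x \<partial>M) \<le> ennreal C * \<rho> f"
    and rearrangement_invariant:
      "f \<in> borel_measurable M \<Longrightarrow> g \<in> borel_measurable M \<Longrightarrow>
       (\<And>l. 0 \<le> l \<Longrightarrow> distribution_fun M f l = distribution_fun M g l) \<Longrightarrow> \<rho> f = \<rho> g"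

text \<open>\<open>\<rho>'\<close> is the norm of the representation space over \<open>(0, \<mu>(R))\<close> of the space with norm \<open>\<rho>\<close>.
  On measurable functions \<open>\<rho>'\<close> is uniquely determined by \<open>\<rho>\<close>.\<close>

definition representation_norm ::
    "'a measure \<Rightarrow> (('a \<Rightarrow> ennreal) \<Rightarrow> ennreal) \<Rightarrow> ((real \<Rightarrow> ennreal) \<Rightarrow> ennreal) \<Rightarrow> bool" where
  "representation_norm M \<rho> \<rho>' \<longleftrightarrow>
     ri_function_norm (lborel_Ioo (emeasure M (space M))) \<rho>' \<and>
     (\<forall>f\<in>borel_measurable M. \<rho> f = \<rho>' (rearrangement M f))"

definition Lp_norm :: "'a measure \<Rightarrow> real \<Rightarrow> ('a \<Rightarrow> ennreal) \<Rightarrow> ennreal" where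
  "Lp_norm M p f = epowr (\<integral>\<^sup>+x. epowr (f x) p \<partial>M) (1 / p)"

definition weak_Lq_norm :: "'a measure \<Rightarrow> real \<Rightarrow> ('a \<Rightarrow> ennreal) \<Rightarrow> ennreal" where
  "weak_Lq_norm M q f = (SUP t\<in>{0<..}. ennreal (t powr (1 / q)) * rearrangement M f t)"

text \<open>The norm of \<open>Y\<^sup>\<langle>\<^sup>p\<^sup>\<rangle>\<close>, where \<open>\<rho>'\<close> is the norm of the representation space of \<open>Y\<close>.\<close>

definition power_maximal_norm ::
    "'a measure \<Rightarrow> ((real \<Rightarrow> ennreal) \<Rightarrow> ennreal) \<Rightarrow> real \<Rightarrow> ('a \<Rightarrow> ennreal) \<Rightarrow> ennreal" where
  "power_maximal_norm M \<rho>' p f =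
     \<rho>' (\<lambda>t. epowr (maximal_rearrangement M (\<lambda>x. epowr (f x) p) t) (1 / p))"

definition on_modulus ::
    "(('a \<Rightarrow> ennreal) \<Rightarrow> ennreal) \<Rightarrow> ('a \<Rightarrow> 'k::real_normed_vector) \<Rightarrow> ennreal" where
  "on_modulus \<rho> f = \<rho> (\<lambda>x. ennreal (norm (f x)))"

definition sum_norm ::
    "'a measure \<Rightarrow> (('a \<Rightarrow> ennreal) \<Rightarrow> ennreal) \<Rightarrow> (('a \<Rightarrow> ennreal) \<Rightarrow> ennreal) \<Rightarrow>
     ('a \<Rightarrow> 'k::{real_normed_field, euclidean_space}) \<Rightarrow> ennreal" where
  "sum_norm M \<rho>1 \<rho>2 f =
     Inf {on_modulus \<rho>1 g + on_modulus \<rho>2 h | g h.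
            g \<in> borel_measurable M \<and> h \<in> borel_measurable M \<and> f = (\<lambda>x. g x + h x)}"

text \<open>In the following two notions \<open>D\<close> is the set of all measurable functions under consideration,
  and \<open>nX\<close>, \<open>nZ\<close> are the norms of the spaces \<open>X\<close>, \<open>Z\<close>; thus \<open>X = {f \<in> D. nX f < \<infinity>}\<close>.\<close>

definition included_in :: "'f set \<Rightarrow> ('f \<Rightarrow> ennreal) \<Rightarrow> ('f \<Rightarrow> ennreal) \<Rightarrow> bool" where
  "included_in D nX nZ \<longleftrightarrow> (\<exists>C>0. \<forall>f\<in>D. nZ f \<le> ennreal C * nX f)"

definition bounded_from_to ::
    "'f set \<Rightarrow> ('f \<Rightarrow> ennreal) \<Rightarrow> ('g \<Rightarrow> ennreal) \<Rightarrow> ('f \<Rightarrow> 'g) \<Rightarrow> bool" where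
  "bounded_from_to D nX nZ T \<longleftrightarrow>
     (\<exists>C>0. \<forall>f\<in>D. nX f < \<infinity> \<longrightarrow> nZ (T f) \<le> ennreal C * nX f)"

definition Lp_plus_weak_Lq ::
    "'a measure \<Rightarrow> real \<Rightarrow> real \<Rightarrow> ('a \<Rightarrow> 'k::{real_normed_field, euclidean_space}) set" where
  "Lp_plus_weak_Lq M p q =
     {f \<in> borel_measurable M. sum_norm M (Lp_norm M p) (weak_Lq_norm M q) f < \<infinity>}"

text \<open>The second conjunct says that \<open>T\<close> acts on functions modulo equality almost everywhere.\<close>

definition operator_on ::
    "'a measure \<Rightarrow> 'b measure \<Rightarrow> ('a \<Rightarrow> 'k) set \<Rightarrow>
     (('a \<Rightarrow> 'k::{real_normed_field, euclidean_space}) \<Rightarrow> 'b \<Rightarrow> 'k) \<Rightarrow> bool" where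
  "operator_on M N D T \<longleftrightarrow>
     (\<forall>f\<in>D. T f \<in> borel_measurable N) \<and>
     (\<forall>f\<in>D. \<forall>g\<in>D. (AE x in M. f x = g x) \<longrightarrow> (AE y in N. T f y = T g y))"

definition linear_operator_on ::
    "'b measure \<Rightarrow> ('a \<Rightarrow> 'k) set \<Rightarrow>
     (('a \<Rightarrow> 'k::{real_normed_field, euclidean_space}) \<Rightarrow> 'b \<Rightarrow> 'k) \<Rightarrow> bool" where
  "linear_operator_on N D T \<longleftrightarrow>
     (\<forall>f\<in>D. \<forall>g\<in>D. AE y in N. T (\<lambda>x. f x + g x) y = T f y + T g y) \<and>
     (\<forall>f\<in>D. \<forall>\<alpha>. AE y in N. T (\<lambda>x. \<alpha> * f x) y = \<alpha> * T f y)"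

definition quasi_linear_operator_on ::
    "'b measure \<Rightarrow> ('a \<Rightarrow> 'k) set \<Rightarrow>
     (('a \<Rightarrow> 'k::{real_normed_field, euclidean_space}) \<Rightarrow> 'b \<Rightarrow> 'k) \<Rightarrow> bool" where
  "quasi_linear_operator_on N D T \<longleftrightarrow>
     (\<exists>k\<ge>1. \<forall>f\<in>D. \<forall>g\<in>D. AE y in N.
        norm (T (\<lambda>x. f x + g x) y) \<le> k * (norm (T f y) + norm (T g y))) \<and>
     (\<forall>f\<in>D. \<forall>\<alpha>. AE y in N. norm (T (\<lambda>x. \<alpha> * f x) y) = norm \<alpha> * norm (T f y))"

definition sawyerable ::
    "'a measure \<Rightarrow> 'b measure \<Rightarrow> real \<Rightarrow> real \<Rightarrow>
     (('a \<Rightarrow> 'k::{real_normed_field, euclidean_space}) \<Rightarrow> 'b \<Rightarrow> 'k) \<Rightarrow> bool" where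
  "sawyerable M N p q T \<longleftrightarrow>
     operator_on M N (Lp_plus_weak_Lq M p q) T \<and>
     quasi_linear_operator_on N (Lp_plus_weak_Lq M p q) T \<and>
     bounded_from_to (borel_measurable M)
       (on_modulus (Lp_norm M p)) (on_modulus (Lp_norm N p)) T \<and>
     bounded_from_to (borel_measurable M)
       (on_modulus (weak_Lq_norm M q)) (on_modulus (esssup N)) T"

definition R_op :: "real \<Rightarrow> real \<Rightarrow> (real \<Rightarrow> ennreal) \<Rightarrow> real \<Rightarrow> ennreal" where
  "R_op p q g t =
     (let r = q / (q - p) in
      epowr ((\<integral>\<^sup>+s\<in>{0<..<t powr r}. epowr (rearrangement (lborel_Ioo \<infinity>) g s) p \<partial>lborel)
             / ennreal t) (1 / p))"

end

theory Submission
  imports Defs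
begin

text \<open>Put \<open>r = q / (q - p)\<close>, so that \<open>(r - 1) / p = r / q\<close>.

  If \<open>R\<^bsub>p,q\<^esub>\<close> is bounded and \<open>T\<close> is sawyerable, splitting \<open>f\<close> at the level \<open>f\<^sup>*(t\<^sup>r)\<close> gives
  \<open>((|Tf|\<^sup>p)\<^sup>*\<^sup>*(t))\<^bsup>1/p\<^esup> \<le> C (R f\<^sup>*(t) + sup {u\<^bsup>1/q\<^esup> f\<^sup>*(u) | u \<ge> t\<^sup>r})\<close>. With \<open>u = v\<^sup>r\<close>, the supremum over
  \<open>v < \<nu>(S)\<close> is controlled because a large value at \<open>v\<close> forces \<open>R f\<^sup>*\<close> to be large on \<open>(v/3, v]\<close>; the
  supremum over \<open>v \<ge> \<nu>(S)\<close> is a constant bounded by the norm of \<open>f\<close> in \<open>L\<^sup>p + L\<^bsup>q,\<infinity>\<^esup>\<close>, hence in \<open>X\<close>.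

  Conversely, let \<open>\<sigma>\<close> and \<open>\<tau>\<close> map the two measure spaces onto intervals, preserving measure. The linear operator
  \<open>T f = \<tau>\<^bsup>r/q\<^esup> (2 / s) \<integral>\<^bsub>s/2 \<le> \<sigma> < s\<^esub> f\<close> with \<open>s = \<tau>\<^sup>r\<close> is sawyerable, and for \<open>f = \<phi> \<circ> \<sigma>\<close> with \<open>\<phi>\<close>
  nonincreasing it dominates \<open>\<tau>\<^bsup>r/q\<^esup> \<phi>(\<tau>\<^sup>r)\<close>, whose \<open>p\<close>-th power has the integral
  \<open>(1/r) \<integral>\<^bsub>(0,t\<^sup>r)\<^esub> \<phi>\<^sup>p\<close> over \<open>{\<tau> < t}\<close>.\<close>

section \<open>Powers and rearrangements\<close>

text \<open>The exponent \<open>r\<close> is dictated by scaling. With \<open>s = \<tau>^r\<close>,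
  averages at scale \<open>s\<close> of functions in weak L^q grow at most like
  \<open>s^(-1/q) = \<tau>^(-r/q)\<close>, which the factor \<open>\<tau>^(r/q)\<close> cancels,
  while the \<open>p\<close>-th power of this factor is \<open>\<tau>^(r - 1)\<close>, up to the
  constant \<open>r\<close> the Jacobian of the map from \<open>\<tau>\<close> to
  \<open>\<tau>^r\<close>. The window \<open>[s/2, s)\<close> replaces \<open>(0, s)\<close> because
  each point then belongs only to windows of comparable scale: the bound on L^p follows from
  Jensen's inequality and Tonelli's theorem, where full averages would call for Hardy's inequality.

  Two obstacles shape the rest. The supremum looks at arguments beyond \<open>t^r\<close>, which
  \<open>R\<close> at \<open>t\<close> does not see, so it has no pointwise bound by
  \<open>R\<close> and is absorbed by comparing distribution functions. Operators act on
  finite-valued functions, whereas functions in the representation space of \<open>X\<close> may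
  take the value \<infinity>; hence the converse is proved for truncations of \<open>\<phi>\<close>
  and closed by the Fatou property.\<close>

lemma epowr_ennreal: "0 \<le> x \<Longrightarrow> epowr (ennreal x) a = ennreal (x powr a)"
  by (simp add: epowr_def)

lemma epowr_0 [simp]: "epowr 0 a = 0"
  by (simp add: epowr_def)

lemma epowr_top [simp]: "epowr top a = top"
  by (simp add: epowr_def)

lemma epowr_epowr: "epowr (epowr x a) b = epowr x (a * b)"
  by (cases x) (simp_all add: epowr_def powr_powr)

lemma epowr_one [simp]: "epowr x 1 = x"
  by (cases x) (simp_all add: epowr_def)

lemma epowr_inverse:
  assumes "0 < a"
  shows "epowr (epowr x a) (1 / a) = x" "epowr (epowr x (1 / a)) a = x"
  using assms by (simp_all add: epowr_epowr)

lemma epowr_mono: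
  assumes "0 < a" "x \<le> y" shows "epowr x a \<le> epowr y a"
proof (cases y)
  case (real s)
  then obtain r where "x = ennreal r" "0 \<le> r" "r \<le> s"
    using assms by (auto simp: le_ennreal_iff)
  then show ?thesis
    using real assms by (simp add: epowr_ennreal powr_mono2 ennreal_leI)
qed (simp add: epowr_def)

lemma epowr_le_iff:
  assumes "0 < a" shows "epowr x a \<le> epowr y a \<longleftrightarrow> x \<le> y"
  using epowr_mono[of a x y] epowr_mono[of "1 / a" "epowr x a" "epowr y a"] assms
  by (auto simp: epowr_inverse)

lemma epowr_less_iff:
  assumes "0 < a" shows "epowr x a < epowr y a \<longleftrightarrow> x < y"
  using epowr_le_iff[OF assms] by (meson not_le)

lemma epowr_le_iff_le_epowr:
  assumes "0 < a" shows "epowr x a \<le> y \<longleftrightarrow> x \<le> epowr y (1 / a)"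
  using epowr_le_iff[OF assms, of x "epowr y (1 / a)"] assms by (simp add: epowr_inverse)

lemma epowr_SUP:
  assumes "0 < a" shows "epowr (SUP i\<in>I. f i) a = (SUP i\<in>I. epowr (f i) a)"
proof (rule antisym)
  have "f i \<le> epowr (SUP i\<in>I. epowr (f i) a) (1 / a)" if "i \<in> I" for i
    using that by (subst epowr_le_iff_le_epowr[OF assms, symmetric]) (rule SUP_upper)
  then show "epowr (SUP i\<in>I. f i) a \<le> (SUP i\<in>I. epowr (f i) a)"
    by (simp add: epowr_le_iff_le_epowr[OF assms] SUP_least)
  show "(SUP i\<in>I. epowr (f i) a) \<le> epowr (SUP i\<in>I. f i) a"
    by (intro SUP_least epowr_mono assms SUP_upper)
qed

lemma epowr_mult:
  assumes "0 < a" shows "epowr (x * y) a = epowr x a * epowr y a"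
proof (cases x; cases y)
  fix r s assume "x = ennreal r" "0 \<le> r" "y = ennreal s" "0 \<le> s"
  then show ?thesis by (simp add: epowr_ennreal powr_mult flip: ennreal_mult)
next
  fix r assume "x = ennreal r" "0 \<le> r" "y = top"
  then show ?thesis using assms by (cases "r = 0") (simp_all add: epowr_ennreal ennreal_mult_top)
next
  fix r assume "y = ennreal r" "0 \<le> r" "x = top"
  then show ?thesis using assms by (cases "r = 0") (simp_all add: epowr_ennreal ennreal_top_mult)
qed simp

lemma epowr_max:
  assumes "0 < a" shows "epowr (max x y) a = max (epowr x a) (epowr y a)"
  using epowr_le_iff[OF assms] by (auto simp: max_def)

text \<open>Needed both for \<open>a = p\<close> and for \<open>a = 1 / p\<close>, on either side of
  1; the bound of a sum by twice the maximum covers the two cases with one constant.\<close>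

lemma epowr_add_le:
  assumes "0 < a" shows "epowr (x + y) a \<le> ennreal (2 powr a) * (epowr x a + epowr y a)"
proof -
  have "x + y \<le> 2 * max x y"
    by (simp add: mult_2 add_mono)
  then have "epowr (x + y) a \<le> epowr (2 * max x y) a"
    by (rule epowr_mono[OF assms])
  also have "\<dots> = ennreal (2 powr a) * max (epowr x a) (epowr y a)"
    using epowr_ennreal[of 2 a] by (simp add: epowr_mult epowr_max assms)
  also have "\<dots> \<le> ennreal (2 powr a) * (epowr x a + epowr y a)"
    by (intro mult_left_mono) (auto simp: max_def add_increasing add_increasing2)
  finally show ?thesis .
qed

lemma epowr_measurable [measurable]: "(\<lambda>x. epowr (f x) a) \<in> borel_measurable M"
  if [measurable]: "f \<in> borel_measurable M"
  unfolding epowr_def by measurable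

text \<open>Functions take extended values but levels are real. Inequalities are therefore tested at
  the real levels below, which is the form in which \<open>less_rearrangement_iff\<close>
  speaks.\<close>

lemma ennreal_le_if_reals_below:
  assumes "\<And>l. 0 \<le> l \<Longrightarrow> ennreal l < x \<Longrightarrow> ennreal l \<le> y"
  shows "x \<le> (y::ennreal)"
proof (rule dense_le)
  fix z assume "z < x"
  then show "z \<le> y" using assms by (cases z) auto
qed

lemma ennreal_eq_if_reals_below:
  assumes "\<And>l. 0 \<le> l \<Longrightarrow> ennreal l < x \<longleftrightarrow> ennreal l < y"
  shows "x = (y::ennreal)"
proof (rule antisym)
  show "x \<le> y" by (rule ennreal_le_if_reals_below) (simp add: assms less_imp_le)
  show "y \<le> x" by (rule ennreal_le_if_reals_below) (simp add: less_imp_le flip: assms)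
qed

lemma borel_measurable_antimono:
  fixes f :: "real \<Rightarrow> ennreal"
  assumes "antimono f" shows "f \<in> borel_measurable borel"
proof (rule borel_measurableI_greater)
  fix y
  have "is_interval {x. y < f x}"
    using assms by (auto simp: is_interval_1 antimono_def intro: less_le_trans)
  moreover have "A \<in> sets borel" if "is_interval A" for A :: "real set"
    using is_real_interval[OF that] by (elim disjE exE) simp_all
  ultimately show "{x \<in> space borel. y < f x} \<in> sets borel" by simp
qed

lemma borel_measurable_mono_ennreal:
  fixes f :: "real \<Rightarrow> ennreal"
  assumes "mono f" shows "f \<in> borel_measurable borel"
proof -
  have "(\<lambda>x. f (- x)) \<in> borel_measurable borel"
    using assms by (intro borel_measurable_antimono) (auto simp: mono_def antimono_def)
  then have "(\<lambda>x. f (- (- x))) \<in> borel_measurable borel" by measurable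
  then show ?thesis by simp
qed

section \<open>Distribution functions and nonincreasing rearrangements\<close>

lemma distribution_fun_antimono:
  assumes "f \<in> borel_measurable M" "l \<le> l'"
  shows "distribution_fun M f l' \<le> distribution_fun M f l"
  unfolding distribution_fun_def using assms
  by (intro emeasure_mono) (auto intro: le_less_trans ennreal_leI)

lemma distribution_fun_mono:
  assumes "f \<in> borel_measurable M" "g \<in> borel_measurable M" "AE x in M. f x \<le> g x"
  shows "distribution_fun M f l \<le> distribution_fun M g l"
  unfolding distribution_fun_def using assms
  by (intro emeasure_mono_AE) (auto elim!: eventually_mono)

lemma distribution_fun_le_space: "distribution_fun M f l \<le> emeasure M (space M)"
  unfolding distribution_fun_def by (rule emeasure_space)

text \<open>The right continuity of the distribution function makes this an equivalence.\<close>

lemma less_rearrangement_iff: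
  assumes [measurable]: "f \<in> borel_measurable M" and "0 \<le> l"
  shows "ennreal l < rearrangement M f t \<longleftrightarrow> ennreal t < distribution_fun M f l"
proof
  assume "ennreal l < rearrangement M f t"
  show "ennreal t < distribution_fun M f l"
  proof (rule ccontr)
    assume "\<not> ?thesis"
    then have le: "distribution_fun M f l \<le> ennreal t" by simp
    have "rearrangement M f t \<le> ennreal l"
    \<comment> \<open>The infimum in \<open>rearrangement\<close> runs over positive levels only,
      and \<open>l\<close> may be 0; hence the shift to \<open>l + e\<close>.\<close>
    proof (rule ennreal_le_epsilon)
      fix e :: real assume "0 < e"
      have "rearrangement M f t \<le> ennreal (l + e)"
        unfolding rearrangement_def
        using \<open>0 < e\<close> \<open>0 \<le> l\<close> order_trans[OF distribution_fun_antimono le, of "l + e"]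
        by (intro Inf_lower) (auto simp del: ennreal_plus)
      then show "rearrangement M f t \<le> ennreal l + ennreal e"
        using \<open>0 < e\<close> \<open>0 \<le> l\<close> by simp
    qed
    then show False using \<open>ennreal l < rearrangement M f t\<close> by simp
  qed
next
  assume less: "ennreal t < distribution_fun M f l"
  have "(\<lambda>n. distribution_fun M f (l + 1 / Suc n)) \<longlonglongrightarrow> distribution_fun M f l"
  proof -
    have "(\<Union>n. {x \<in> space M. ennreal (l + 1 / Suc n) < f x}) = {x \<in> space M. ennreal l < f x}"
    proof (intro equalityI subsetI)
      fix x assume x: "x \<in> {x \<in> space M. ennreal l < f x}"
      then obtain z where z: "ennreal l < z" "z < f x" using dense by auto
      then obtain r where r: "z = ennreal r" "l < r"
        using \<open>0 \<le> l\<close> by (cases z) (auto simp: ennreal_less_iff)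
      obtain n where "inverse (real (Suc n)) < r - l"
        using reals_Archimedean[of "r - l"] r by auto
      then have "ennreal (l + 1 / Suc n) \<le> z"
        using r by (auto intro!: ennreal_leI simp: inverse_eq_divide)
      then show "x \<in> (\<Union>n. {x \<in> space M. ennreal (l + 1 / Suc n) < f x})"
        using z x by (auto intro: le_less_trans)
    next
      fix x assume "x \<in> (\<Union>n. {x \<in> space M. ennreal (l + 1 / Suc n) < f x})"
      then obtain n where "x \<in> space M" "ennreal (l + 1 / Suc n) < f x" by auto
      moreover have "ennreal l \<le> ennreal (l + 1 / Suc n)" by (intro ennreal_leI) simp
      ultimately show "x \<in> {x \<in> space M. ennreal l < f x}" by (auto intro: le_less_trans)
    qed
    moreover have "incseq (\<lambda>n. {x \<in> space M. ennreal (l + 1 / Suc n) < f x})"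
    proof (intro monoI Collect_mono)
      fix m n :: nat and x assume "m \<le> n"
      then have "ennreal (l + 1 / Suc n) \<le> ennreal (l + 1 / Suc m)"
        by (intro ennreal_leI add_left_mono divide_left_mono) auto
      then show "x \<in> space M \<and> ennreal (l + 1 / Suc m) < f x \<longrightarrow>
          x \<in> space M \<and> ennreal (l + 1 / Suc n) < f x"
        by (auto intro: le_less_trans)
    qed
    ultimately show ?thesis
      using Lim_emeasure_incseq[of "\<lambda>n. {x \<in> space M. ennreal (l + 1 / Suc n) < f x}" M]
      unfolding distribution_fun_def by (auto simp: image_subset_iff)
  qed
  from order_tendstoD(1)[OF this less]
  obtain n where n: "ennreal t < distribution_fun M f (l + 1 / Suc n)"
    by (auto simp: eventually_sequentially)
  have "ennreal (l + 1 / Suc n) \<le> rearrangement M f t"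
    unfolding rearrangement_def
  proof (rule Inf_greatest)
    fix z assume "z \<in> {ennreal l |l. 0 < l \<and> distribution_fun M f l \<le> ennreal t}"
    then obtain k where k: "z = ennreal k" "distribution_fun M f k \<le> ennreal t" by blast
    then have "l + 1 / Suc n \<le> k"
      using distribution_fun_antimono[of f M k "l + 1 / Suc n"] n by (intro leI notI) simp
    then show "ennreal (l + 1 / Suc n) \<le> z" unfolding k by (rule ennreal_leI)
  qed
  moreover have "ennreal l < ennreal (l + 1 / Suc n)"
    using \<open>0 \<le> l\<close> by (simp add: ennreal_less_iff)
  ultimately show "ennreal l < rearrangement M f t" by order
qed

lemma rearrangement_antimono: "antimono (rearrangement M f)"
  unfolding antimono_def rearrangement_def
proof (intro allI impI Inf_superset_mono Collect_mono)
  fix s t :: real and z :: ennreal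
  assume "s \<le> t"
  then have "ennreal s \<le> ennreal t" by (rule ennreal_leI)
  moreover assume "\<exists>l. z = ennreal l \<and> 0 < l \<and> distribution_fun M f l \<le> ennreal s"
  ultimately show "\<exists>l. z = ennreal l \<and> 0 < l \<and> distribution_fun M f l \<le> ennreal t"
    by (blast intro: order_trans)
qed

lemma rearrangement_measurable [measurable]: "rearrangement M f \<in> borel_measurable borel"
  by (rule borel_measurable_antimono[OF rearrangement_antimono])

lemma rearrangement_mono:
  assumes "f \<in> borel_measurable M" "g \<in> borel_measurable N"
    "\<And>l. 0 \<le> l \<Longrightarrow> distribution_fun M f l \<le> distribution_fun N g l"
  shows "rearrangement M f t \<le> rearrangement N g t"
proof (rule ennreal_le_if_reals_below)
  fix l assume "0 \<le> l" "ennreal l < rearrangement M f t"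
  then have "ennreal l < rearrangement N g t"
    using assms by (simp add: less_rearrangement_iff) (blast intro: less_le_trans)
  then show "ennreal l \<le> rearrangement N g t" by (rule less_imp_le)
qed

lemma rearrangement_cong:
  assumes "\<And>l. 0 < l \<Longrightarrow> distribution_fun M f l = distribution_fun N g l"
  shows "rearrangement M f = rearrangement N g"
  unfolding rearrangement_def using assms by (auto intro!: ext arg_cong[where f = Inf])

lemma rearrangement_epowr:
  assumes [measurable]: "f \<in> borel_measurable M" and "0 < p"
  shows "rearrangement M (\<lambda>x. epowr (f x) p) t = epowr (rearrangement M f t) p"
proof (rule ennreal_eq_if_reals_below)
  fix l :: real assume "0 \<le> l"
  have eq: "ennreal l = epowr (ennreal (l powr (1 / p))) p"
    using \<open>0 \<le> l\<close> \<open>0 < p\<close> by (simp add: epowr_ennreal powr_powr)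
  have "distribution_fun M (\<lambda>x. epowr (f x) p) l = distribution_fun M f (l powr (1 / p))"
    unfolding distribution_fun_def eq epowr_less_iff[OF \<open>0 < p\<close>] ..
  then show "ennreal l < rearrangement M (\<lambda>x. epowr (f x) p) t \<longleftrightarrow>
      ennreal l < epowr (rearrangement M f t) p"
    using \<open>0 \<le> l\<close>
    by (subst (2) eq) (simp add: epowr_less_iff[OF \<open>0 < p\<close>] less_rearrangement_iff)
qed

text \<open>The map \<open>c * (x + b)\<close> is increasing in \<open>x\<close>, so the level
  \<open>l\<close> of \<open>u\<close> corresponds to the level \<open>l / c - b\<close> of
  \<open>v\<close>. In this form a pointwise bound of \<open>T f\<close> by an L^p part and a
  constant passes to the maximal rearrangement without an appeal to its subadditivity.\<close>

lemma rearrangement_affine_le: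
  assumes [measurable]: "u \<in> borel_measurable M" "v \<in> borel_measurable M"
    and "0 < c" "0 \<le> b" and le: "AE x in M. u x \<le> ennreal c * (v x + ennreal b)"
  shows "rearrangement M u t \<le> ennreal c * (rearrangement M v t + ennreal b)"
proof (cases "rearrangement M v t")
  case (real z)
  have "rearrangement M u t \<le> ennreal (c * (z + b))"
  proof (rule ennreal_le_if_reals_below, rule ccontr)
    fix l assume "0 \<le> l" and l: "ennreal l < rearrangement M u t"
      and "\<not> ennreal l \<le> ennreal (c * (z + b))"
    then have zl: "z < l / c - b"
      using \<open>0 < c\<close> \<open>0 \<le> b\<close> real
      by (auto simp: not_le ennreal_less_iff field_simps simp del: ennreal_plus)
    have "ennreal t < distribution_fun M u l"
      using l \<open>0 \<le> l\<close> by (simp add: less_rearrangement_iff)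
    also have "\<dots> \<le> distribution_fun M v (l / c - b)"
      unfolding distribution_fun_def
    proof (rule emeasure_mono_AE)
      show "AE x in M. x \<in> {x \<in> space M. ennreal l < u x} \<longrightarrow>
          x \<in> {x \<in> space M. ennreal (l / c - b) < v x}"
        using le
      proof eventually_elim
        case (elim x)
        show ?case
        proof (intro impI, clarsimp)
          assume "ennreal l < u x"
          with elim have *: "ennreal l < ennreal c * (v x + ennreal b)" by simp
          show "ennreal (l / c - b) < v x"
          proof (cases "v x")
            case (real w)
            then have "ennreal l < ennreal (c * (w + b))"
              using * \<open>0 < c\<close> \<open>0 \<le> b\<close> by (simp add: ennreal_mult)
            then have "l / c - b < w"
              using \<open>0 \<le> l\<close> \<open>0 < c\<close> by (simp add: ennreal_less_iff field_simps)
            then show ?thesis using real zl \<open>0 \<le> z\<close> by (simp add: ennreal_less_iff)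
          qed simp
        qed
      qed
    qed measurable
    finally have "ennreal (l / c - b) < rearrangement M v t"
      using zl \<open>0 \<le> z\<close> by (simp add: less_rearrangement_iff)
    then show False using real zl by (simp add: ennreal_less_iff)
  qed
  then show ?thesis
    using real \<open>0 < c\<close> \<open>0 \<le> b\<close> by (simp add: ennreal_mult)
qed (use \<open>0 < c\<close> in \<open>simp add: ennreal_mult_top\<close>)

lemma rearrangement_AE_mono:
  assumes "u \<in> borel_measurable M" "v \<in> borel_measurable M" "AE x in M. u x \<le> v x"
  shows "rearrangement M u t \<le> rearrangement M v t"
  using assms by (intro rearrangement_mono distribution_fun_mono)

section \<open>Layer cake representation and the Hardy--Littlewood inequality\<close>

lemma Ioo_sets [measurable]: "{t::real. 0 < t \<and> ennreal t < a} \<in> sets borel"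
  by measurable

lemma emeasure_lborel_Ioo_ennreal: "emeasure lborel {t. 0 < t \<and> ennreal t < a} = a"
proof (cases a)
  case (real r)
  then have "{t. 0 < t \<and> ennreal t < a} = {0<..<r}"
    by (auto simp: ennreal_less_iff)
  then show ?thesis using real by simp
next
  case top
  then have "{t. 0 < t \<and> ennreal t < a} = {0<..}" by auto
  moreover have "top \<le> emeasure lborel {0::real<..}"
  proof (rule ennreal_le_if_reals_below)
    fix l :: real assume "0 \<le> l"
    then have "ennreal l = emeasure lborel {0<..<l}" by simp
    also have "\<dots> \<le> emeasure lborel {0::real<..}" by (intro emeasure_mono) auto
    finally show "ennreal l \<le> emeasure lborel {0::real<..}" .
  qed
  ultimately show ?thesis using top by (simp add: top_unique)
qed

lemma space_lborel_Ioo [simp]: "space (lborel_Ioo a) = {t. 0 < t \<and> ennreal t < a}"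
  by (simp add: lborel_Ioo_def)

lemma measurable_lborel_Ioo:
  assumes "f \<in> borel_measurable borel" shows "f \<in> borel_measurable (lborel_Ioo a)"
  using assms unfolding lborel_Ioo_def by (intro measurable_restrict_space1) simp

lemma emeasure_lborel_Ioo:
  assumes "A \<subseteq> {t. 0 < t \<and> ennreal t < a}"
  shows "emeasure (lborel_Ioo a) A = emeasure lborel A"
  unfolding lborel_Ioo_def using assms by (intro emeasure_restrict_space) auto

lemma AE_lborel_IooI:
  assumes "\<And>t. 0 < t \<Longrightarrow> ennreal t < a \<Longrightarrow> P t" shows "AE t in lborel_Ioo a. P t"
  using assms by (intro AE_I2) simp

text \<open>Tonelli's theorem for the region under the graph. It reduces the comparison of integrals
  of functions and of rearrangements to one of distribution functions.\<close>

lemma layer_cake: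
  assumes "sigma_finite_measure M" and [measurable]: "f \<in> borel_measurable M"
  shows "(\<integral>\<^sup>+x. f x \<partial>M) = (\<integral>\<^sup>+l\<in>{0<..}. distribution_fun M f l \<partial>lborel)"
proof -
  interpret sigma_finite_measure M by fact
  interpret pair_sigma_finite M lborel ..
  have "(\<integral>\<^sup>+x. f x \<partial>M) = (\<integral>\<^sup>+x. \<integral>\<^sup>+l. indicator {t. 0 < t \<and> ennreal t < f x} l \<partial>lborel \<partial>M)"
    by (simp add: emeasure_lborel_Ioo_ennreal)
  also have "\<dots> = (\<integral>\<^sup>+x. \<integral>\<^sup>+l. indicator {z. 0 < snd z \<and> ennreal (snd z) < f (fst z)} (x, l) \<partial>lborel \<partial>M)"
    by (intro nn_integral_cong) (simp split: split_indicator)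
  also have "\<dots> = (\<integral>\<^sup>+l. \<integral>\<^sup>+x. indicator {z. 0 < snd z \<and> ennreal (snd z) < f (fst z)} (x, l) \<partial>M \<partial>lborel)"
    by (rule Fubini'[symmetric]) measurable
  also have "\<dots> = (\<integral>\<^sup>+l\<in>{0<..}. distribution_fun M f l \<partial>lborel)"
    unfolding distribution_fun_def
  proof (rule nn_integral_cong)
    fix l :: real
    have "(\<integral>\<^sup>+x. indicator {z. 0 < snd z \<and> ennreal (snd z) < f (fst z)} (x, l) \<partial>M)
        = (\<integral>\<^sup>+x. indicator {x \<in> space M. ennreal l < f x} x * indicator {0<..} l \<partial>M)"
      by (intro nn_integral_cong) (simp split: split_indicator)
    then show "(\<integral>\<^sup>+x. indicator {z. 0 < snd z \<and> ennreal (snd z) < f (fst z)} (x, l) \<partial>M)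
        = emeasure M {x \<in> space M. ennreal l < f x} * indicator {0<..} l"
      by (simp add: nn_integral_multc)
  qed
  finally show ?thesis .
qed

lemma distribution_fun_restrict:
  assumes "0 \<le> l"
  shows "distribution_fun M (\<lambda>x. f x * indicator E x) l = emeasure M {x \<in> space M. x \<in> E \<and> ennreal l < f x}"
  unfolding distribution_fun_def by (intro arg_cong[where f = "emeasure M"]) (auto split: split_indicator)

text \<open>By \<open>less_rearrangement_iff\<close> the level set of the rearrangement in the
  positive half-line is the interval from 0 to the value of the distribution function of
  \<open>f\<close>; the minimum comes from cutting it at \<open>s\<close>.\<close>

lemma distribution_rearrangement_restrict:
  assumes "f \<in> borel_measurable M" "0 \<le> l" "0 \<le> s"
  shows "distribution_fun lborel (\<lambda>t. rearrangement M f t * indicator {0<..<s} t) l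
    = min (ennreal s) (distribution_fun M f l)"
proof -
  have "{t. 0 < t \<and> t < s \<and> ennreal l < rearrangement M f t}
      = {t. 0 < t \<and> ennreal t < min (ennreal s) (distribution_fun M f l)}"
    using assms by (auto simp: less_rearrangement_iff ennreal_less_iff)
  then show ?thesis
    using emeasure_lborel_Ioo_ennreal[of "min (ennreal s) (distribution_fun M f l)"]
    by (simp add: distribution_fun_restrict assms)
qed

text \<open>Hardy--Littlewood for an indicator: a level set of \<open>f\<close> on \<open>E\<close>
  is no larger than \<open>E\<close> and no larger than the level set of \<open>f\<close>, and the
  minimum of the two bounds is what \<open>distribution_rearrangement_restrict\<close>
  computes.\<close>

lemma set_nn_integral_le_rearrangement:
  assumes "sigma_finite_measure M" and [measurable]: "f \<in> borel_measurable M" "E \<in> sets M"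
    and "0 \<le> s" "emeasure M E \<le> ennreal s"
  shows "(\<integral>\<^sup>+x\<in>E. f x \<partial>M) \<le> (\<integral>\<^sup>+t\<in>{0<..<s}. rearrangement M f t \<partial>lborel)"
proof -
  have "distribution_fun M (\<lambda>x. f x * indicator E x) l \<le> min (ennreal s) (distribution_fun M f l)"
    if "0 \<le> l" for l
  proof -
    have "distribution_fun M (\<lambda>x. f x * indicator E x) l \<le> emeasure M E"
      unfolding distribution_fun_restrict[OF that] by (rule emeasure_mono) auto
    moreover have "distribution_fun M (\<lambda>x. f x * indicator E x) l \<le> distribution_fun M f l"
      by (rule distribution_fun_mono) (auto split: split_indicator)
    ultimately show ?thesis using assms by auto
  qed
  then show ?thesis
    unfolding layer_cake[OF sigma_finite_lborel, of "\<lambda>t. rearrangement M f t * indicator {0<..<s} t", simplified]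
      layer_cake[OF assms(1), of "\<lambda>x. f x * indicator E x", simplified]
    by (intro nn_integral_mono)
      (auto simp: distribution_rearrangement_restrict assms split: split_indicator)
qed

lemma set_nn_integral_rearrangement_le:
  assumes "sigma_finite_measure M" and [measurable]: "f \<in> borel_measurable M"
    and "0 \<le> s"
  shows "(\<integral>\<^sup>+t\<in>{0<..<s}. rearrangement M f t \<partial>lborel) \<le> (\<integral>\<^sup>+x. f x \<partial>M)"
  unfolding layer_cake[OF sigma_finite_lborel, of "\<lambda>t. rearrangement M f t * indicator {0<..<s} t", simplified]
      layer_cake[OF assms(1), of f, simplified]
  by (intro nn_integral_mono)
      (auto simp: distribution_rearrangement_restrict assms split: split_indicator)

lemma distribution_rearrangement:
  assumes [measurable]: "f \<in> borel_measurable M" and "0 \<le> l"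
  shows "distribution_fun (lborel_Ioo (emeasure M (space M))) (rearrangement M f) l = distribution_fun M f l"
proof -
  have "{t. (0 < t \<and> ennreal t < emeasure M (space M)) \<and> ennreal l < rearrangement M f t}
      = {t. 0 < t \<and> ennreal t < distribution_fun M f l}"
    using assms distribution_fun_le_space[of M f l]
    by (auto simp: less_rearrangement_iff intro: less_le_trans)
  then show ?thesis
    unfolding distribution_fun_def[of "lborel_Ioo _"]
    by (subst emeasure_lborel_Ioo) (auto simp: emeasure_lborel_Ioo_ennreal)
qed

lemma distribution_zero_extension:
  assumes "0 \<le> l"
  shows "distribution_fun (lborel_Ioo \<infinity>) (zero_extension a g) l = distribution_fun (lborel_Ioo a) g l"
proof -
  have "{t \<in> {t. 0 < t \<and> ennreal t < \<infinity>}. ennreal l < zero_extension a g t}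
      = {t \<in> {t. 0 < t \<and> ennreal t < a}. ennreal l < g t}"
    by (auto simp: zero_extension_def)
  then show ?thesis
    unfolding distribution_fun_def space_lborel_Ioo
    by (simp only:) (subst (1 2) emeasure_lborel_Ioo; auto)
qed

lemma rearrangement_zero_extension:
  "rearrangement (lborel_Ioo \<infinity>) (zero_extension a g) = rearrangement (lborel_Ioo a) g"
  by (intro rearrangement_cong distribution_zero_extension) simp

lemma rearrangement_idem:
  assumes "f \<in> borel_measurable M"
  shows "rearrangement (lborel_Ioo (emeasure M (space M))) (rearrangement M f) = rearrangement M f"
  using assms by (intro rearrangement_cong distribution_rearrangement) simp_all

section \<open>Uniformization of nonatomic measure spaces\<close>

text \<open>Strict growth of the measure makes a member determined by its measure, so inclusions can
  be read off from measures. Finite measure gives continuity from above.\<close>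

definition measure_chain :: "'a measure \<Rightarrow> 'a set set \<Rightarrow> bool" where
  "measure_chain M \<C> \<longleftrightarrow> \<C> \<subseteq> sets M \<and> (\<forall>A\<in>\<C>. emeasure M A < \<infinity>) \<and>
     (\<forall>A\<in>\<C>. \<forall>B\<in>\<C>. A = B \<or> A \<subseteq> B \<and> emeasure M A < emeasure M B
                       \<or> B \<subseteq> A \<and> emeasure M B < emeasure M A)"

lemma measure_chain_subset: "measure_chain M \<C> \<Longrightarrow> \<D> \<subseteq> \<C> \<Longrightarrow> measure_chain M \<D>"
  unfolding measure_chain_def by (simp add: subset_iff)

lemma measure_chain_le_imp_subset:
  "measure_chain M \<C> \<Longrightarrow> A \<in> \<C> \<Longrightarrow> B \<in> \<C> \<Longrightarrow> emeasure M A \<le> emeasure M B \<Longrightarrow> A \<subseteq> B"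
  unfolding measure_chain_def by (blast dest: leD)

text \<open>The union may be uncountable. If some member has maximal measure, it is the union;
  otherwise a sequence of members whose measures approach the supremum is cofinal in the
  chain.\<close>

lemma measure_chain_Union:
  assumes ch: "measure_chain M \<C>" and le: "\<And>A. A \<in> \<C> \<Longrightarrow> emeasure M A \<le> t"
  shows "\<Union>\<C> \<in> sets M \<and> emeasure M (\<Union>\<C>) \<le> t"
proof (cases "\<exists>A\<in>\<C>. \<forall>B\<in>\<C>. emeasure M B \<le> emeasure M A")
  case True
  then obtain A where A: "A \<in> \<C>" "\<And>B. B \<in> \<C> \<Longrightarrow> emeasure M B \<le> emeasure M A" by blast
  then have "\<Union>\<C> = A" using measure_chain_le_imp_subset[OF ch] by blast
  then show ?thesis using A le ch by (auto simp: measure_chain_def)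
next
  case False
  show ?thesis
  proof (cases "\<C> = {}")
    case ne: False
    then obtain f :: "nat \<Rightarrow> ennreal"
      where f: "range f \<subseteq> emeasure M ` \<C>" "Sup (emeasure M ` \<C>) = Sup (range f)"
      using ennreal_SUP_countable_SUP[of \<C> "emeasure M"] by auto
    from f(1) have "\<forall>n. \<exists>A. A \<in> \<C> \<and> f n = emeasure M A" by blast
    then obtain A where A: "\<And>n. A n \<in> \<C>" "\<And>n. f n = emeasure M (A n)" by metis
    \<comment> \<open>A finite union of chain members is the largest of them, so \<open>B\<close> is
      an increasing sequence inside the chain.\<close>
    define B where "B n = (\<Union>i\<le>n. A i)" for n :: nat
    have B: "B n \<in> \<C>" for n
    proof (induction n)
      case (Suc n)
      have "B (Suc n) = B n \<union> A (Suc n)" by (auto simp: B_def le_Suc_eq)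
      moreover have "B n \<subseteq> A (Suc n) \<or> A (Suc n) \<subseteq> B n"
        using ch Suc A unfolding measure_chain_def by blast
      ultimately show ?case using Suc A by (auto simp: sup.absorb1 sup.absorb2)
    qed (simp add: B_def A)
    have "\<Union>\<C> \<subseteq> (\<Union>n. B n)"
    proof (intro Union_least)
      fix C assume "C \<in> \<C>"
      with False obtain D where "D \<in> \<C>" "emeasure M C < emeasure M D" by (auto simp: not_le)
      then have "emeasure M C < Sup (range f)"
        using f(2) by (metis SUP_upper less_le_trans)
      then obtain n where "emeasure M C < emeasure M (A n)"
        using A by (auto simp: less_Sup_iff)
      then have "C \<subseteq> A n" using measure_chain_le_imp_subset[OF ch \<open>C \<in> \<C>\<close> A(1)] by simp
      then show "C \<subseteq> (\<Union>n. B n)" by (auto simp: B_def)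
    qed
    with B have eq: "\<Union>\<C> = (\<Union>n. B n)" by blast
    have sets: "range B \<subseteq> sets M" using B ch by (auto simp: measure_chain_def)
    have "incseq B" by (auto simp: B_def incseq_def intro: order_trans)
    then have "emeasure M (\<Union>n. B n) = (SUP n. emeasure M (B n))"
      using sets by (simp add: SUP_emeasure_incseq)
    also have "\<dots> \<le> t" using le B by (intro SUP_least) auto
    finally show ?thesis using sets unfolding eq by auto
  qed simp
qed

text \<open>Dual to \<open>measure_chain_Union\<close>; continuity from above rests on the finite
  measure of the members.\<close>

lemma measure_chain_Inter:
  assumes ch: "measure_chain M \<C>" and ne: "\<C> \<noteq> {}"
    and le: "\<And>A. A \<in> \<C> \<Longrightarrow> t \<le> emeasure M A"
  shows "\<Inter>\<C> \<in> sets M \<and> t \<le> emeasure M (\<Inter>\<C>)"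
proof (cases "\<exists>A\<in>\<C>. \<forall>B\<in>\<C>. emeasure M A \<le> emeasure M B")
  case True
  then obtain A where A: "A \<in> \<C>" "\<And>B. B \<in> \<C> \<Longrightarrow> emeasure M A \<le> emeasure M B" by blast
  then have "\<Inter>\<C> = A" using measure_chain_le_imp_subset[OF ch] by blast
  then show ?thesis using A le ch by (auto simp: measure_chain_def)
next
  case False
  obtain f :: "nat \<Rightarrow> ennreal"
    where f: "range f \<subseteq> emeasure M ` \<C>" "Inf (emeasure M ` \<C>) = Inf (range f)"
    using ennreal_Inf_countable_INF[of "emeasure M ` \<C>"] ne by auto
  from f(1) have "\<forall>n. \<exists>A. A \<in> \<C> \<and> f n = emeasure M A" by blast
  then obtain A where A: "\<And>n. A n \<in> \<C>" "\<And>n. f n = emeasure M (A n)" by metis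
  define B where "B n = (\<Inter>i\<le>n. A i)" for n :: nat
  have B: "B n \<in> \<C>" for n
  proof (induction n)
    case (Suc n)
    have "B (Suc n) = B n \<inter> A (Suc n)" by (auto simp: B_def le_Suc_eq)
    moreover have "B n \<subseteq> A (Suc n) \<or> A (Suc n) \<subseteq> B n"
      using ch Suc A unfolding measure_chain_def by blast
    ultimately show ?case using Suc A by (auto simp: inf.absorb1 inf.absorb2)
  qed (simp add: B_def A)
  have "(\<Inter>n. B n) \<subseteq> \<Inter>\<C>"
  proof (intro Inter_greatest)
    fix C assume "C \<in> \<C>"
    with False obtain D where "D \<in> \<C>" "emeasure M D < emeasure M C" by (auto simp: not_le)
    then have "Inf (range f) < emeasure M C"
      using f(2) by (metis INF_lower le_less_trans)
    then obtain n where "emeasure M (A n) < emeasure M C"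
      using A by (auto simp: Inf_less_iff)
    then have "A n \<subseteq> C" using measure_chain_le_imp_subset[OF ch A(1) \<open>C \<in> \<C>\<close>] by simp
    then show "(\<Inter>n. B n) \<subseteq> C" by (auto simp: B_def)
  qed
  with B have eq: "\<Inter>\<C> = (\<Inter>n. B n)" by blast
  have sets: "range B \<subseteq> sets M" using B ch by (auto simp: measure_chain_def)
  have fin: "emeasure M (B n) \<noteq> \<infinity>" for n using B[of n] ch by (auto simp: measure_chain_def)
  have "decseq B" by (auto simp: B_def decseq_def)
  then have "emeasure M (\<Inter>n. B n) = (INF n. emeasure M (B n))"
    using sets fin by (simp add: INF_emeasure_decseq)
  moreover have "t \<le> (INF n. emeasure M (B n))" using le B by (intro INF_greatest) auto
  ultimately show ?thesis using sets unfolding eq by auto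
qed

text \<open>In a maximal chain no value \<open>t\<close> is skipped: otherwise the union \<open>U\<close> of the members of measure
  below \<open>t\<close> and the intersection \<open>V\<close> of those above differ by a set of positive measure, and a proper part
  of it can be added to \<open>U\<close> to extend the chain.\<close>

lemma nonatomic_measure_chain:
  assumes "nonatomic M"
  obtains \<C> where "measure_chain M \<C>"
    "\<And>t. ennreal t < emeasure M (space M) \<Longrightarrow> \<exists>A\<in>\<C>. emeasure M A = ennreal t"
proof -
  define S where "S = {A \<in> sets M. emeasure M A < \<infinity>}"
  define P where "P A B \<longleftrightarrow> A \<subseteq> B \<and> emeasure M A < emeasure M B" for A B
  obtain \<C> where max: "pred_on.maxchain S P \<C>" using pred_on.Hausdorff by blast
  have chain_iff: "pred_on.chain S P \<D> \<longleftrightarrow> measure_chain M \<D>" for \<D>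
  proof -
    have "\<D> \<subseteq> S \<longleftrightarrow> \<D> \<subseteq> sets M \<and> (\<forall>A\<in>\<D>. emeasure M A < \<infinity>)"
      unfolding S_def by blast
    moreover have "(P\<^sup>=\<^sup>= x y \<or> P\<^sup>=\<^sup>= y x) \<longleftrightarrow> x = y \<or> P x y \<or> P y x" for x y
      by blast
    ultimately show ?thesis
      unfolding pred_on.chain_def measure_chain_def P_def[symmetric] by (simp only: conj_assoc)
  qed
  have ch: "measure_chain M \<C>"
    using max unfolding pred_on.maxchain_def chain_iff by blast
  have extend: "D \<in> \<C>" if "D \<in> sets M" "emeasure M D < \<infinity>"
    "\<And>A. A \<in> \<C> \<Longrightarrow> A = D \<or> P A D \<or> P D A" for D
  proof -
    have "measure_chain M (insert D \<C>)"
      unfolding measure_chain_def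
    proof (intro conjI)
      show "insert D \<C> \<subseteq> sets M" "\<forall>A\<in>insert D \<C>. emeasure M A < \<infinity>"
        using that(1,2) ch by (auto simp: measure_chain_def)
      show "\<forall>A\<in>insert D \<C>. \<forall>B\<in>insert D \<C>. A = B \<or> A \<subseteq> B \<and> emeasure M A < emeasure M B
          \<or> B \<subseteq> A \<and> emeasure M B < emeasure M A"
        unfolding P_def[symmetric] ball_simps
        using that(3) ch unfolding measure_chain_def P_def[symmetric] by blast
    qed
    then show ?thesis
      using max unfolding pred_on.maxchain_def chain_iff by blast
  qed
  have "\<exists>A\<in>\<C>. emeasure M A = ennreal t" if t: "ennreal t < emeasure M (space M)" for t
  proof (rule ccontr)
    assume "\<not> ?thesis"
    then have not_t: "emeasure M A \<noteq> ennreal t" if "A \<in> \<C>" for A using that by blast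
    define L where "L = {A \<in> \<C>. emeasure M A < ennreal t}"
    define H where "H = {A \<in> \<C>. ennreal t < emeasure M A}"
    define U where "U = \<Union>L"
    \<comment> \<open>If no member lies above \<open>t\<close>, the whole space, possibly of
      infinite measure, takes the place of the intersection.\<close>
    define V where "V = (if H = {} then space M else \<Inter>H)"
    have LH: "A \<in> L \<or> A \<in> H" if "A \<in> \<C>" for A
      using that not_t[OF that] unfolding L_def H_def by auto
    have U: "U \<in> sets M" "emeasure M U \<le> ennreal t"
    proof -
      have "measure_chain M L" by (rule measure_chain_subset[OF ch]) (auto simp: L_def)
      then have "\<Union>L \<in> sets M \<and> emeasure M (\<Union>L) \<le> ennreal t"
        by (rule measure_chain_Union) (auto simp: L_def)
      then show "U \<in> sets M" "emeasure M U \<le> ennreal t" by (auto simp: U_def)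
    qed
    have V: "V \<in> sets M" "ennreal t \<le> emeasure M V"
    proof -
      have "\<Inter>H \<in> sets M \<and> ennreal t \<le> emeasure M (\<Inter>H)" if "H \<noteq> {}"
      proof -
        have "measure_chain M H" by (rule measure_chain_subset[OF ch]) (auto simp: H_def)
        then show ?thesis using that by (rule measure_chain_Inter) (auto simp: H_def)
      qed
      then show "V \<in> sets M" "ennreal t \<le> emeasure M V"
        using t by (auto simp: V_def)
    qed
    have VH: "V \<subseteq> A" if "A \<in> H" for A using that by (auto simp: V_def)
    have LU: "A \<subseteq> U" if "A \<in> L" for A using that by (auto simp: U_def)
    have LH_subset: "A \<subseteq> B" if "A \<in> L" "B \<in> H" for A B
    proof (rule measure_chain_le_imp_subset[OF ch])
      show "emeasure M A \<le> emeasure M B" using that by (auto simp: L_def H_def)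
    qed (use that in \<open>auto simp: L_def H_def\<close>)
    have UV: "U \<subseteq> V"
      using sets.sets_into_space[OF U(1)] LH_subset unfolding U_def V_def by auto
    have Ulow: "emeasure M A \<le> emeasure M U" if "A \<in> L" for A
      using that U LU by (intro emeasure_mono) auto
    have Vup: "emeasure M V \<le> emeasure M A" if "A \<in> H" for A
      using that VH ch by (intro emeasure_mono) (auto simp: H_def measure_chain_def)
    \<comment> \<open>With measure exactly \<open>t\<close>, the set \<open>U\<close> would be
      comparable with every member, so maximality would put it into the chain, where the value
      \<open>t\<close> does not occur. The same applies to \<open>V\<close> below.\<close>
    have "emeasure M U \<noteq> ennreal t"
    proof
      assume eq: "emeasure M U = ennreal t"
      have "U \<in> \<C>"
      proof (rule extend)
        fix A assume "A \<in> \<C>"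
        then show "A = U \<or> P A U \<or> P U A"
          using LH[of A] LU[of A] VH[of A] UV eq by (auto simp: P_def L_def H_def)
      qed (use U eq in auto)
      then show False using not_t eq by blast
    qed
    with U have Ult: "emeasure M U < ennreal t" by simp
    have "emeasure M V \<noteq> ennreal t"
    proof
      assume eq: "emeasure M V = ennreal t"
      have "V \<in> \<C>"
      proof (rule extend)
        fix A assume "A \<in> \<C>"
        then show "A = V \<or> P A V \<or> P V A"
          using LH[of A] LU[of A] VH[of A] UV eq by (auto simp: P_def L_def H_def)
      qed (use V eq in auto)
      then show False using not_t eq by blast
    qed
    have Vsplit: "emeasure M V = emeasure M U + emeasure M (V - U)"
      using U V UV plus_emeasure[of U M "V - U"] by (simp add: Un_absorb1)
    have "0 < emeasure M (V - U)"
      using Vsplit Ult V by (cases "emeasure M (V - U) = 0") (auto simp: zero_less_iff_neq_zero)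
    then obtain B where B: "B \<in> sets M" "B \<subseteq> V - U" "0 < emeasure M B" "emeasure M B < emeasure M (V - U)"
      using assms U V unfolding nonatomic_def by (meson sets.Diff)
    define D where "D = U \<union> B"
    have D: "D \<in> sets M" "emeasure M D = emeasure M U + emeasure M B" "U \<subseteq> D" "D \<subseteq> V"
      using B U UV by (auto simp: D_def intro!: plus_emeasure[symmetric])
    have Ufin: "emeasure M U < \<infinity>" using U(2) by (auto intro: le_less_trans)
    have Bfin: "emeasure M B < \<infinity>" using B(4) by (auto intro: less_le_trans)
    have UD: "emeasure M U < emeasure M D"
      using D(2) B(3) Ufin by (cases "emeasure M U"; cases "emeasure M B") (auto simp: ennreal_less_iff simp flip: ennreal_plus)
    have DV: "emeasure M D < emeasure M V"
      using D(2) Vsplit B(4) Ufin Bfin ennreal_add_left_cancel_less[of "emeasure M U" "emeasure M B"] by auto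
    have "D \<in> \<C>"
    proof (rule extend)
      fix A assume "A \<in> \<C>"
      then consider "A \<in> L" | "A \<in> H" using LH by blast
      then show "A = D \<or> P A D \<or> P D A"
      proof cases
        case 1
        then have "P A D"
          using LU[of A] D(3) le_less_trans[OF Ulow[of A] UD] unfolding P_def by blast
        then show ?thesis by simp
      next
        case 2
        then have "P D A"
          using VH[of A] D(4) less_le_trans[OF DV Vup[of A]] unfolding P_def by blast
        then show ?thesis by simp
      qed
    qed (use D Ufin Bfin in auto)
    \<comment> \<open>Members in \<open>L\<close> have at most the measure of \<open>U\<close> and
      members in \<open>H\<close> at least that of \<open>V\<close>; \<open>D\<close> lies strictly
      between the two.\<close>
    then show False
      using LH[of D] Ulow[of D] Vup[of D] UD DV by auto
  qed
  with ch that show ?thesis by blast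
qed

text \<open>Only positive values of \<open>\<sigma>\<close> count. Points with \<open>\<sigma> x \<le> 0\<close> may have positive (even infinite)
  measure if the whole space has infinite measure, because the chain need not exhaust the space.\<close>

definition uniformizes :: "'a measure \<Rightarrow> ('a \<Rightarrow> real) \<Rightarrow> bool" where
  "uniformizes M \<sigma> \<longleftrightarrow> \<sigma> \<in> borel_measurable M \<and>
     (\<forall>s. emeasure M {x \<in> space M. 0 < \<sigma> x \<and> \<sigma> x < s} = min (ennreal s) (emeasure M (space M)))"

text \<open>\<open>\<sigma> x\<close> is the infimum of the measures of the chain members
  \<open>E q\<close> that contain \<open>x\<close>. Restricting \<open>q\<close> to rationals makes
  \<open>{\<sigma> < s}\<close> a countable union of such members, up to the points in none of them,
  and density of the rationals recovers its measure.\<close>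

lemma nonatomic_uniformization:
  assumes "nonatomic M"
  obtains \<sigma> where "uniformizes M \<sigma>"
proof -
  define a where "a = emeasure M (space M)"
  obtain \<C> where ch: "measure_chain M \<C>"
    and ex: "\<And>t. ennreal t < a \<Longrightarrow> \<exists>A\<in>\<C>. emeasure M A = ennreal t"
    using nonatomic_measure_chain[OF assms] unfolding a_def by metis
  then obtain E where E: "\<And>t. ennreal t < a \<Longrightarrow> E t \<in> \<C> \<and> emeasure M (E t) = ennreal t"
    by metis
  have E_sets [measurable]: "E t \<in> sets M" if "ennreal t < a" for t
    using E[OF that] ch by (auto simp: measure_chain_def)
  have E_mono: "E s \<subseteq> E t" if "s \<le> t" "ennreal t < a" for s t
    using measure_chain_le_imp_subset[OF ch, of "E s" "E t"] E that
    by (metis ennreal_leI le_less_trans)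
  define Q where "Q = {q \<in> \<rat>. 0 < q \<and> ennreal q < a}"
  have "countable Q" unfolding Q_def by (rule countable_subset[OF _ countable_rat]) auto
  define \<sigma> where "\<sigma> x = (if \<exists>q\<in>Q. x \<in> E q then Inf {q\<in>Q. x \<in> E q} else 0)" for x
  define F where "F s = (\<Union>q\<in>{q\<in>Q. q < s}. E q)" for s
  have F_sets [measurable]: "F s \<in> sets M" for s
    unfolding F_def
  proof (rule sets.countable_UN')
    show "countable {q \<in> Q. q < s}" by (rule countable_subset[OF _ \<open>countable Q\<close>]) blast
  qed (auto simp: Q_def)
  have nonneg: "0 \<le> \<sigma> x" for x
    unfolding \<sigma>_def by (auto intro!: cInf_greatest simp: Q_def less_imp_le)
  have less_iff: "\<sigma> x < s \<longleftrightarrow> x \<in> F s" if "\<exists>q\<in>Q. x \<in> E q" for x s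
  proof -
    have "bdd_below {q\<in>Q. x \<in> E q}" by (rule bdd_belowI[of _ 0]) (auto simp: Q_def)
    moreover have "{q\<in>Q. x \<in> E q} \<noteq> {}" using that by blast
    ultimately show ?thesis
      using that cInf_less_iff[of "{q\<in>Q. x \<in> E q}" s] by (auto simp: \<sigma>_def F_def)
  qed
  define G where "G = (\<Union>q\<in>Q. E q)"
  have G_sets [measurable]: "G \<in> sets M"
    unfolding G_def using \<open>countable Q\<close> by (intro sets.countable_UN') (auto simp: Q_def)
  have meas [measurable]: "\<sigma> \<in> borel_measurable M"
  proof (rule borel_measurableI_less)
    fix s
    have "{x \<in> space M. \<sigma> x < s} = (if s \<le> 0 then {} else F s \<union> (space M - G))"
    proof (cases "s \<le> 0")
      case True
      then show ?thesis using nonneg by (auto simp: not_less intro: order_trans)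
    next
      case False
      have "\<sigma> x < s \<longleftrightarrow> x \<in> F s" if "x \<in> G" for x using that less_iff by (auto simp: G_def)
      moreover have "\<sigma> x = 0" if "x \<notin> G" for x using that by (auto simp: G_def \<sigma>_def)
      moreover have "F s \<subseteq> G" by (auto simp: F_def G_def)
      moreover have "F s \<subseteq> space M" using F_sets by (rule sets.sets_into_space)
      ultimately show ?thesis using False by auto
    qed
    then show "{x \<in> space M. \<sigma> x < s} \<in> sets M" by simp
  qed
  have "emeasure M {x \<in> space M. 0 < \<sigma> x \<and> \<sigma> x < s} = min (ennreal s) a" for s
  proof (cases "s \<le> 0 \<or> a = 0")
    case True
    moreover have "emeasure M {x \<in> space M. 0 < \<sigma> x \<and> \<sigma> x < s} \<le> a"
      unfolding a_def by (intro emeasure_mono) auto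
    moreover have "emeasure M {x \<in> space M. 0 < \<sigma> x \<and> \<sigma> x < s} = 0" if "s \<le> 0"
    proof -
      have "{x \<in> space M. 0 < \<sigma> x \<and> \<sigma> x < s} = {}" using that by auto
      then show ?thesis by (simp only: emeasure_empty)
    qed
    ultimately show ?thesis by (auto simp: ennreal_neg)
  next
    case False
    \<comment> \<open>Besides the points outside all \<open>E q\<close>, which get the value 0 by
      convention, \<open>\<sigma>\<close> vanishes where \<open>q\<close> can be arbitrarily small.
      The latter points lie in every \<open>E q\<close>, hence form a null set.\<close>
    define N where "N = {x \<in> space M. x \<in> G \<and> \<sigma> x \<le> 0}"
    have "emeasure M N \<le> ennreal q" if "q \<in> Q" for q
    proof -
      have "N \<subseteq> E q"
      proof
        fix x assume x: "x \<in> N"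
        then have "x \<in> F q" using less_iff[of x q] that by (auto simp: N_def G_def Q_def)
        then show "x \<in> E q"
        proof -
          obtain q' where "x \<in> E q'" "q' < q" using \<open>x \<in> F q\<close> by (auto simp: F_def)
          then show ?thesis using E_mono[of q' q] that by (auto simp: Q_def)
        qed
      qed
      then have "emeasure M N \<le> emeasure M (E q)"
        using that by (intro emeasure_mono) (auto simp: Q_def)
      then show ?thesis using E that by (auto simp: Q_def)
    qed note Nle = this
    have dense: "\<exists>q\<in>Q. z < ennreal q \<and> q < s" if zlt: "z < min (ennreal s) a" for z
    proof -
      obtain q where q: "z < ennreal (real_of_rat q)" "ennreal (real_of_rat q) < min (ennreal s) a"
        using ennreal_rat_dense[OF zlt] by blast
      then have "0 < real_of_rat q" by (cases "0 < real_of_rat q") (auto simp: ennreal_neg)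
      then show ?thesis using q False
        by (intro bexI[of _ "real_of_rat q"]) (auto simp: Q_def ennreal_less_iff)
    qed
    have "emeasure M N = 0"
    proof (rule ccontr)
      assume "emeasure M N \<noteq> 0"
      then have "0 < min (emeasure M N) (min (ennreal s) a)" using False
        by (auto simp: zero_less_iff_neq_zero ennreal_eq_0_iff)
      then obtain z where z: "0 < z" "z < min (emeasure M N) (min (ennreal s) a)"
        using Orderings.dense by blast
      then obtain q where "0 < ennreal (real_of_rat q)" "ennreal (real_of_rat q) < z"
        using ennreal_rat_dense[OF z(1)] by blast
      then have "real_of_rat q \<in> Q" using z by (auto simp: Q_def) 
      then have "emeasure M N \<le> ennreal (real_of_rat q)" by (rule Nle)
      then show False using z \<open>ennreal (real_of_rat q) < z\<close> by auto
    qed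
    then have null: "N \<in> null_sets M" by (auto simp: N_def null_sets_def)
    have "{x \<in> space M. 0 < \<sigma> x \<and> \<sigma> x < s} = F s - N"
    proof -
      have "x \<in> G" if "0 < \<sigma> x" for x using that by (auto simp: \<sigma>_def G_def split: if_splits)
      moreover have "F s \<subseteq> G" by (auto simp: F_def G_def)
      moreover have "F s \<subseteq> space M" using F_sets by (rule sets.sets_into_space)
      ultimately show ?thesis using less_iff[of _ s] by (auto simp: N_def G_def not_le)
    qed
    then have "emeasure M {x \<in> space M. 0 < \<sigma> x \<and> \<sigma> x < s} = emeasure M (F s)"
      using null by (simp add: emeasure_Diff_null_set)
    also have "\<dots> = min (ennreal s) a"
    proof (rule antisym)
      show "emeasure M (F s) \<le> min (ennreal s) a"
      proof (cases "ennreal s < a")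
        case True
        then have "emeasure M (F s) \<le> emeasure M (E s)"
          using E_mono by (intro emeasure_mono) (auto simp: F_def intro: less_imp_le subsetD)
        then show ?thesis using E[OF True] True by (auto simp: min_def)
      next
        case False
        then show ?thesis using emeasure_space[of M "F s"] by (simp add: a_def min_def)
      qed
      show "min (ennreal s) a \<le> emeasure M (F s)"
      proof (rule dense_le)
        fix z assume "z < min (ennreal s) a"
        then obtain q where q: "q \<in> Q" "z < ennreal q" "q < s" using dense by blast
        then have "ennreal q = emeasure M (E q)" using E by (auto simp: Q_def)
        also have "\<dots> \<le> emeasure M (F s)"
          using q by (intro emeasure_mono F_sets) (auto simp: F_def)
        finally show "z \<le> emeasure M (F s)" using q by simp
      qed
    qed
    finally show ?thesis .
  qed
  with meas that show ?thesis unfolding a_def uniformizes_def by blast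
qed

section \<open>Dilations in rearrangement-invariant spaces\<close>

text \<open>The union of the dyadic intervals \<open>[2^k, 2^(k+1))\<close> over the even integers
  \<open>k\<close>, or over the odd ones if \<open>e\<close> is \<open>False\<close>.\<close>

definition log_even :: "bool \<Rightarrow> real set" where
  "log_even e = {t. 0 < t \<and> even \<lfloor>log 2 t\<rfloor> = e}"

lemma log_even_sets [measurable]: "log_even e \<in> sets borel"
proof -
  have "(\<lambda>t::real. \<lfloor>log 2 t\<rfloor>) \<in> borel \<rightarrow>\<^sub>M count_space UNIV" by measurable
  from measurable_sets[OF this, of "{i. even i = e}"]
  have "{t. even \<lfloor>log 2 (t::real)\<rfloor> = e} \<in> sets borel" by (simp add: vimage_def)
  then have "{0<..} \<inter> {t. even \<lfloor>log 2 (t::real)\<rfloor> = e} \<in> sets borel" by simp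
  then show ?thesis by (simp add: log_even_def Int_def)
qed

text \<open>Scaling by two interchanges \<open>log_even True\<close> and \<open>log_even False\<close>, so the measures \<open>m\<close>, \<open>m'\<close> of
  their parts in \<open>(0, v]\<close> satisfy \<open>m v = 2 * m' (v / 2) = v - 2 * m (v / 2) \<le> v - 2 * (m v - v / 2)\<close>.\<close>

lemma emeasure_log_even_le:
  assumes "0 \<le> v" shows "emeasure lborel (log_even e \<inter> {0<..v}) \<le> ennreal (2 / 3 * v)"
proof (cases "v = 0")
  case False
  with assms have "0 < v" by simp
  define m where "m e u = measure lborel (log_even e \<inter> {0<..u})" for e u
  have em: "emeasure lborel (log_even e \<inter> {0<..u}) = ennreal (m e u)" for e u
  proof -
    have "emeasure lborel (log_even e \<inter> {0<..u}) \<le> emeasure lborel {0<..u}"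
      by (intro emeasure_mono) auto
    also have "\<dots> < \<infinity>" by (cases "0 \<le> u") auto
    finally show ?thesis unfolding m_def by (simp add: emeasure_eq_ennreal_measure)
  qed
  have shift: "2 * x \<in> log_even e \<longleftrightarrow> x \<in> log_even (\<not> e)" for x e
    by (cases "0 < x") (auto simp: log_even_def log_mult)
  have scale: "m e v = 2 * m (\<not> e) (v / 2)"
  proof -
    have "ennreal (m e v) = (\<integral>\<^sup>+x. indicator (log_even e \<inter> {0<..v}) x \<partial>lborel)"
      by (simp add: em)
    also have "\<dots> = 2 * (\<integral>\<^sup>+x. indicator (log_even e \<inter> {0<..v}) (2 * x) \<partial>lborel)"
      using nn_integral_real_affine[of "indicator (log_even e \<inter> {0<..v})" 2 0] by simp
    also have "(\<integral>\<^sup>+x. indicator (log_even e \<inter> {0<..v}) (2 * x) \<partial>lborel)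
        = (\<integral>\<^sup>+x. indicator (log_even (\<not> e) \<inter> {0<..v/2}) x \<partial>lborel)"
      by (intro nn_integral_cong) (auto simp: shift split: split_indicator)
    also have "\<dots> = ennreal (m (\<not> e) (v / 2))" by (simp add: em)
    finally have "ennreal (m e v) = ennreal (2 * m (\<not> e) (v / 2))"
      by (simp add: ennreal_mult m_def)
    then show ?thesis by (simp add: m_def)
  qed
  have total: "m e (v / 2) + m (\<not> e) (v / 2) = v / 2"
  proof -
    have "emeasure lborel (log_even e \<inter> {0<..v/2}) + emeasure lborel (log_even (\<not> e) \<inter> {0<..v/2})
        = emeasure lborel ((log_even e \<inter> {0<..v/2}) \<union> (log_even (\<not> e) \<inter> {0<..v/2}))"
      by (intro plus_emeasure) (auto simp: log_even_def)
    also have "(log_even e \<inter> {0<..v/2}) \<union> (log_even (\<not> e) \<inter> {0<..v/2}) = {0<..v/2}"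
      by (auto simp: log_even_def)
    finally have "ennreal (m e (v / 2) + m (\<not> e) (v / 2)) = ennreal (v / 2)"
      using \<open>0 < v\<close> by (simp add: em m_def)
    then show ?thesis using \<open>0 < v\<close> by (simp add: m_def del: ennreal_plus)
  qed
  have "emeasure lborel (log_even e \<inter> {0<..v})
      \<le> emeasure lborel (log_even e \<inter> {0<..v/2} \<union> {v/2<..v})"
    by (intro emeasure_mono) auto
  also have "\<dots> \<le> emeasure lborel (log_even e \<inter> {0<..v/2}) + emeasure lborel {v/2<..v}"
    by (intro emeasure_subadditive) auto
  finally have "ennreal (m e v) \<le> ennreal (m e (v / 2) + v / 2)"
    using \<open>0 < v\<close> by (simp add: em m_def)
  then have "m e v \<le> m e (v / 2) + v / 2" using \<open>0 < v\<close> by (simp add: m_def del: ennreal_plus)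
  then show ?thesis using scale total by (simp add: em ennreal_leI)
qed simp

lemma emeasure_space_lborel_Ioo [simp]: "emeasure (lborel_Ioo b) {t. 0 < t \<and> ennreal t < b} = b"
  by (simp add: emeasure_lborel_Ioo emeasure_lborel_Ioo_ennreal)

lemma ri_norm_rearrangement:
  assumes "ri_function_norm (lborel_Ioo b) \<rho>" and "f \<in> borel_measurable (lborel_Ioo b)"
  shows "\<rho> (rearrangement (lborel_Ioo b) f) = \<rho> f"
proof -
  interpret ri_function_norm "lborel_Ioo b" \<rho> by fact
  show ?thesis
    using assms distribution_rearrangement[of f "lborel_Ioo b"]
    by (intro rearrangement_invariant measurable_lborel_Ioo[OF rearrangement_measurable]) auto
qed

text \<open>Replacing both functions by their rearrangements keeps the norms and turns the
  comparison of distribution functions into a pointwise one.\<close>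

lemma ri_norm_distribution_mono:
  assumes ri: "ri_function_norm (lborel_Ioo b) \<rho>"
    and f: "f \<in> borel_measurable (lborel_Ioo b)" and g: "g \<in> borel_measurable (lborel_Ioo b)"
    and le: "\<And>l. 0 \<le> l \<Longrightarrow> distribution_fun (lborel_Ioo b) f l \<le> distribution_fun (lborel_Ioo b) g l"
  shows "\<rho> f \<le> \<rho> g"
proof -
  interpret ri_function_norm "lborel_Ioo b" \<rho> by fact
  have "\<rho> (rearrangement (lborel_Ioo b) f) \<le> \<rho> (rearrangement (lborel_Ioo b) g)"
    using f g le
    by (intro monotone measurable_lborel_Ioo[OF rearrangement_measurable] AE_I2 rearrangement_mono)
  then show ?thesis by (simp add: ri_norm_rearrangement[OF ri] f g)
qed

text \<open>The set \<open>{W > l}\<close> lies in \<open>(0, 3 d / 2]\<close>, where \<open>d\<close> is the value of the distribution function of \<open>A\<close>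
  at \<open>l\<close>, and \<open>log_even True\<close> and \<open>log_even False\<close> each fill at most 2/3 of this interval. This replaces the
  boundedness of dilations.\<close>

lemma ri_norm_le_twice:
  assumes ri: "ri_function_norm (lborel_Ioo b) \<rho>"
    and W: "W \<in> borel_measurable borel" and A: "A \<in> borel_measurable (lborel_Ioo b)"
    and le: "\<And>l t. 0 \<le> l \<Longrightarrow> 0 < t \<Longrightarrow> ennreal t < b \<Longrightarrow> ennreal l < W t \<Longrightarrow>
      ennreal (2 / 3 * t) \<le> distribution_fun (lborel_Ioo b) A l"
  shows "\<rho> W \<le> 2 * \<rho> A"
proof -
  interpret ri_function_norm "lborel_Ioo b" \<rho> by fact
  define V where "V e t = W t * indicator (log_even e) t" for e t
  have V [measurable]: "V e \<in> borel_measurable borel" for e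
    using W unfolding V_def[abs_def] by measurable
  have "\<rho> (V e) \<le> \<rho> A" for e
  proof (rule ri_norm_distribution_mono[OF ri _ A])
    fix l :: real assume "0 \<le> l"
    show "distribution_fun (lborel_Ioo b) (V e) l \<le> distribution_fun (lborel_Ioo b) A l"
    proof (cases "distribution_fun (lborel_Ioo b) A l")
      case (real d)
      have sub: "{t. (0 < t \<and> ennreal t < b) \<and> ennreal l < V e t} \<subseteq> log_even e \<inter> {0<..3 / 2 * d}"
      proof
        fix t assume t: "t \<in> {t. (0 < t \<and> ennreal t < b) \<and> ennreal l < V e t}"
        then have "t \<in> log_even e" "ennreal l < W t"
          by (auto simp: V_def split: split_indicator_asm)
        with t le[OF \<open>0 \<le> l\<close>, of t] real show "t \<in> log_even e \<inter> {0<..3 / 2 * d}" by auto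
      qed
      have "distribution_fun (lborel_Ioo b) (V e) l
          \<le> emeasure lborel (log_even e \<inter> {0<..3 / 2 * d})"
        unfolding distribution_fun_def space_lborel_Ioo
        using sub by (subst emeasure_lborel_Ioo) (auto intro!: emeasure_mono)
      also have "\<dots> \<le> ennreal (2 / 3 * (3 / 2 * d))"
        using real by (intro emeasure_log_even_le) simp
      finally show ?thesis using real by simp
    qed simp
  qed (rule measurable_lborel_Ioo[OF V])
  moreover have "\<rho> W \<le> \<rho> (\<lambda>t. V True t + V False t)"
    by (intro monotone measurable_lborel_Ioo AE_lborel_IooI)
      (use W in \<open>auto simp: V_def log_even_def split: split_indicator\<close>)
  moreover have "\<dots> \<le> \<rho> (V True) + \<rho> (V False)"
    by (intro subadditive measurable_lborel_Ioo V)
  ultimately show ?thesis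
    by (metis add_mono mult_2 order_trans)
qed

section \<open>Averages and weak-type tails\<close>

definition hardy_mean :: "real \<Rightarrow> real \<Rightarrow> (real \<Rightarrow> ennreal) \<Rightarrow> real \<Rightarrow> ennreal" where
  "hardy_mean p r \<phi> t =
     epowr ((\<integral>\<^sup>+s\<in>{0<..<t powr r}. epowr (\<phi> s) p \<partial>lborel) / ennreal t) (1 / p)"

text \<open>For \<open>\<phi>\<close> the rearrangement of \<open>f\<close>, this bounds the weak
  L^q norm of the part of \<open>f\<close> whose modulus is at most \<open>\<phi> s\<close>; see
  \<open>weak_Lq_norm_truncation_le\<close>.\<close>

definition weak_tail :: "real \<Rightarrow> (real \<Rightarrow> ennreal) \<Rightarrow> real \<Rightarrow> ennreal" where
  "weak_tail q \<phi> s = (SUP u\<in>{s..}. ennreal (u powr (1 / q)) * \<phi> u)"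

lemma R_op_eq_hardy_mean:
  "R_op p q g = hardy_mean p (q / (q - p)) (rearrangement (lborel_Ioo \<infinity>) g)"
  by (simp add: R_op_def hardy_mean_def Let_def fun_eq_iff)

lemma set_nn_integral_Ioo_measurable [measurable]:
  "(\<lambda>t::real. \<integral>\<^sup>+s\<in>{0<..<t}. f s \<partial>lborel) \<in> borel_measurable borel"
  by (intro borel_measurable_mono_ennreal monoI nn_integral_mono) (auto split: split_indicator)

lemma hardy_mean_measurable [measurable]: "hardy_mean p r \<phi> \<in> borel_measurable borel"
proof -
  have "(\<lambda>t. \<integral>\<^sup>+s\<in>{0<..<t powr r}. epowr (\<phi> s) p \<partial>lborel) \<in> borel_measurable borel"
    by (rule measurable_compose[OF _ set_nn_integral_Ioo_measurable]) simp
  then show ?thesis unfolding hardy_mean_def[abs_def] by measurable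
qed

lemma maximal_rearrangement_measurable [measurable]:
  "maximal_rearrangement M f \<in> borel_measurable borel"
  unfolding maximal_rearrangement_def[abs_def] by measurable

text \<open>On the interval of integration \<open>\<phi>\<close> is at least
  \<open>\<phi> (t powr r)\<close>. If \<open>(r - 1) / p = r / q\<close>, the left side is the term
  of \<open>weak_tail\<close> at \<open>u = t powr r\<close>.\<close>

lemma hardy_mean_ge:
  assumes "antimono \<phi>" "0 < p" "0 < t"
  shows "ennreal (t powr ((r - 1) / p)) * \<phi> (t powr r) \<le> hardy_mean p r \<phi> t"
proof -
  have "ennreal (t powr r) * epowr (\<phi> (t powr r)) p
      = (\<integral>\<^sup>+s\<in>{0<..<t powr r}. epowr (\<phi> (t powr r)) p \<partial>lborel)"
    by (simp add: nn_integral_cmult_indicator mult.commute)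
  also have "\<dots> \<le> (\<integral>\<^sup>+s\<in>{0<..<t powr r}. epowr (\<phi> s) p \<partial>lborel)"
    using assms by (intro nn_integral_mono)
      (auto split: split_indicator simp: epowr_le_iff intro: antimonoD)
  finally have "ennreal (t powr r) * epowr (\<phi> (t powr r)) p / ennreal t
      \<le> (\<integral>\<^sup>+s\<in>{0<..<t powr r}. epowr (\<phi> s) p \<partial>lborel) / ennreal t"
    by (rule divide_right_mono_ennreal)
  moreover have "ennreal (t powr r) * epowr (\<phi> (t powr r)) p / ennreal t
      = ennreal (t powr (r - 1)) * epowr (\<phi> (t powr r)) p"
    using \<open>0 < t\<close> by (simp add: ennreal_times_divide mult.commute[of _ "epowr _ _"] divide_ennreal powr_diff
        flip: ennreal_times_divide)
  ultimately have "epowr (ennreal (t powr (r - 1)) * epowr (\<phi> (t powr r)) p) (1 / p) \<le> hardy_mean p r \<phi> t"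
    unfolding hardy_mean_def using \<open>0 < p\<close> by (intro epowr_mono) auto
  then show ?thesis
    using \<open>0 < p\<close> by (simp add: epowr_mult epowr_ennreal epowr_inverse powr_powr)
qed

section \<open>Rearrangement estimates for sums of L^p and weak L^q functions\<close>

lemma rearrangement_le_const:
  assumes "f \<in> borel_measurable M" "\<And>x. x \<in> space M \<Longrightarrow> f x \<le> c"
  shows "rearrangement M f t \<le> c"
proof (rule ennreal_le_if_reals_below)
  fix l assume "0 \<le> l" "ennreal l < rearrangement M f t"
  then have "distribution_fun M f l \<noteq> 0"
    using assms by (auto simp: less_rearrangement_iff)
  then have "{x \<in> space M. ennreal l < f x} \<noteq> {}"
    unfolding distribution_fun_def by (metis emeasure_empty)
  then show "ennreal l \<le> c"
    using assms(2) by (auto dest: less_imp_le intro: order_trans)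
qed

lemma rearrangement_zero [simp]: "rearrangement M (\<lambda>x. 0) t = 0"
  using rearrangement_le_const[of "\<lambda>x. 0" M 0 t] by simp

lemma distribution_fun_rearrangement_le:
  assumes "f \<in> borel_measurable M" "rearrangement M f t = ennreal l" "0 \<le> l"
  shows "distribution_fun M f l \<le> ennreal t"
  using less_rearrangement_iff[of f M l t] assms by (auto simp: not_less[symmetric])

text \<open>Where \<open>f\<close> exceeds its rearrangement at \<open>s\<close>, or
  \<open>g\<close> its own at \<open>t\<close>, is a set of measure at most \<open>s + t\<close>;
  off this set the sum is bounded by the right side.\<close>

lemma rearrangement_add_le:
  assumes [measurable]: "f \<in> borel_measurable M" "g \<in> borel_measurable M" and "0 \<le> s" "0 \<le> t"
  shows "rearrangement M (\<lambda>x. f x + g x) (s + t) \<le> rearrangement M f s + rearrangement M g t"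
proof (cases "rearrangement M f s"; cases "rearrangement M g t")
  fix k l assume k: "rearrangement M f s = ennreal k" "0 \<le> k"
    and l: "rearrangement M g t = ennreal l" "0 \<le> l"
  have "distribution_fun M (\<lambda>x. f x + g x) (k + l)
      \<le> emeasure M ({x \<in> space M. ennreal k < f x} \<union> {x \<in> space M. ennreal l < g x})"
    unfolding distribution_fun_def
  proof (rule emeasure_mono)
    have "ennreal k < f x \<or> ennreal l < g x" if "ennreal (k + l) < f x + g x" for x
    proof (rule ccontr)
      assume "\<not> ?thesis"
      then have "f x + g x \<le> ennreal k + ennreal l" by (intro add_mono) auto
      then show False using that k l by simp
    qed
    then show "{x \<in> space M. ennreal (k + l) < f x + g x}
        \<subseteq> {x \<in> space M. ennreal k < f x} \<union> {x \<in> space M. ennreal l < g x}" by auto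
  qed measurable
  also have "\<dots> \<le> distribution_fun M f k + distribution_fun M g l"
    unfolding distribution_fun_def by (intro emeasure_subadditive) measurable
  also have "\<dots> \<le> ennreal s + ennreal t"
    using k l by (intro add_mono distribution_fun_rearrangement_le) auto
  finally have "\<not> ennreal (k + l) < rearrangement M (\<lambda>x. f x + g x) (s + t)"
    using assms(3,4) k l by (subst less_rearrangement_iff) auto
  then show ?thesis using k l by simp
qed auto

lemma epowr_Lp_norm: "0 < p \<Longrightarrow> epowr (Lp_norm M p f) p = (\<integral>\<^sup>+x. epowr (f x) p \<partial>M)"
  by (simp add: Lp_norm_def epowr_inverse)

text \<open>Chebyshev's inequality, in the form of the embedding of L^p into weak L^p.\<close>

lemma rearrangement_Lp_le:
  assumes "sigma_finite_measure M" and [measurable]: "f \<in> borel_measurable M" and "0 < p" "0 \<le> v"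
  shows "ennreal (v powr (1 / p)) * rearrangement M f v \<le> Lp_norm M p f"
proof -
  have "ennreal v * epowr (rearrangement M f v) p
      = (\<integral>\<^sup>+s\<in>{0<..<v}. rearrangement M (\<lambda>x. epowr (f x) p) v \<partial>lborel)"
    using assms by (simp add: rearrangement_epowr nn_integral_cmult_indicator)
      (simp add: mult.commute)
  also have "\<dots> \<le> (\<integral>\<^sup>+s\<in>{0<..<v}. rearrangement M (\<lambda>x. epowr (f x) p) s \<partial>lborel)"
    by (intro nn_integral_mono)
      (auto split: split_indicator intro: antimonoD[OF rearrangement_antimono])
  also have "\<dots> \<le> (\<integral>\<^sup>+x. epowr (f x) p \<partial>M)"
    using assms by (intro set_nn_integral_rearrangement_le) auto
  finally have "epowr (ennreal v * epowr (rearrangement M f v) p) (1 / p) \<le> Lp_norm M p f"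
    unfolding Lp_norm_def using \<open>0 < p\<close> by (intro epowr_mono) auto
  then show ?thesis
    using assms by (simp add: epowr_mult epowr_ennreal epowr_inverse)
qed

text \<open>Away from 0 the sum space embeds into weak L^q: as \<open>p < q\<close>, the excess
  factor \<open>u powr (1 / q - 1 / p)\<close> of the L^p part decreases in \<open>u\<close> and is
  largest at \<open>u = s\<close>. The constant obtained blows up as \<open>s\<close> tends to 0, so
  the bound is applied at one fixed \<open>s\<close> only.\<close>

lemma weak_tail_le_sum_norm:
  assumes "sigma_finite_measure M" "0 < p" "p < q" "0 < s"
  obtains C where "0 < C"
    "\<And>f :: 'a \<Rightarrow> 'k::{real_normed_field, euclidean_space}. f \<in> borel_measurable M \<Longrightarrow>
    weak_tail q (rearrangement M (\<lambda>x. ennreal (norm (f x)))) s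
      \<le> ennreal C * sum_norm M (Lp_norm M p) (weak_Lq_norm M q) f"
proof
  \<comment> \<open>The powers of 2 come from evaluating the rearrangements of both summands at
    \<open>u / 2\<close>.\<close>
  define C where "C = 2 powr (1 / p) * s powr (1 / q - 1 / p) + 2 powr (1 / q)"
  show "0 < C" unfolding C_def by (intro add_nonneg_pos) auto
  fix f :: "'a \<Rightarrow> 'k" assume f: "f \<in> borel_measurable M"
  have "weak_tail q (rearrangement M (\<lambda>x. ennreal (norm (f x)))) s / ennreal C
      \<le> sum_norm M (Lp_norm M p) (weak_Lq_norm M q) f"
    unfolding sum_norm_def
  proof (rule Inf_greatest, clarify)
    fix g h :: "'a \<Rightarrow> 'k"
    assume [measurable]: "g \<in> borel_measurable M" "h \<in> borel_measurable M"
      and feq: "f = (\<lambda>x. g x + h x)"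
    define G where "G x = ennreal (norm (g x))" for x
    define H where "H x = ennreal (norm (h x))" for x
    have [measurable]: "G \<in> borel_measurable M" "H \<in> borel_measurable M"
      unfolding G_def[abs_def] H_def[abs_def] by measurable
    have "weak_tail q (rearrangement M (\<lambda>x. ennreal (norm (g x + h x)))) s
        \<le> ennreal C * (Lp_norm M p G + weak_Lq_norm M q H)"
      unfolding weak_tail_def
    proof (rule SUP_least)
      fix u assume "u \<in> {s..}"
      then have u: "0 < u" "s \<le> u" using \<open>0 < s\<close> by auto
      have "rearrangement M (\<lambda>x. ennreal (norm (g x + h x))) u \<le> rearrangement M (\<lambda>x. G x + H x) (u / 2 + u / 2)"
        by (simp, rule rearrangement_AE_mono)
          (auto simp: G_def H_def ennreal_leI norm_triangle_ineq simp flip: ennreal_plus)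
      also have "\<dots> \<le> rearrangement M G (u / 2) + rearrangement M H (u / 2)"
        using u by (intro rearrangement_add_le) auto
      finally have "ennreal (u powr (1 / q)) * rearrangement M (\<lambda>x. ennreal (norm (g x + h x))) u
          \<le> ennreal (u powr (1 / q)) * (rearrangement M G (u / 2) + rearrangement M H (u / 2))"
        by (rule mult_left_mono) simp
      also have "\<dots> = ennreal (2 powr (1 / p) * u powr (1 / q - 1 / p)) *
            (ennreal ((u / 2) powr (1 / p)) * rearrangement M G (u / 2)) +
          ennreal (2 powr (1 / q)) * (ennreal ((u / 2) powr (1 / q)) * rearrangement M H (u / 2))"
        using u by (simp add: distrib_left powr_divide powr_diff flip: mult.assoc ennreal_mult)
      also have "\<dots> \<le> ennreal C * Lp_norm M p G + ennreal C * weak_Lq_norm M q H"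
      proof (intro add_mono mult_mono)
        have "u powr (1 / q - 1 / p) \<le> s powr (1 / q - 1 / p)"
          using assms u by (intro powr_mono2') (auto simp: frac_le)
        then show "ennreal (2 powr (1 / p) * u powr (1 / q - 1 / p)) \<le> ennreal C"
          unfolding C_def by (intro ennreal_leI add_increasing2 mult_left_mono) auto
        show "ennreal (2 powr (1 / q)) \<le> ennreal C"
          unfolding C_def by (intro ennreal_leI add_increasing) auto
        show "ennreal ((u / 2) powr (1 / p)) * rearrangement M G (u / 2) \<le> Lp_norm M p G"
          using assms u by (intro rearrangement_Lp_le) auto
        show "ennreal ((u / 2) powr (1 / q)) * rearrangement M H (u / 2) \<le> weak_Lq_norm M q H"
          unfolding weak_Lq_norm_def using u by (intro SUP_upper) auto
      qed auto
      finally show "ennreal (u powr (1 / q)) * rearrangement M (\<lambda>x. ennreal (norm (g x + h x))) u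
          \<le> ennreal C * (Lp_norm M p G + weak_Lq_norm M q H)"
        by (simp add: distrib_left)
    qed
    then show "weak_tail q (rearrangement M (\<lambda>x. ennreal (norm (g x + h x)))) s / ennreal C
        \<le> on_modulus (Lp_norm M p) g + on_modulus (weak_Lq_norm M q) h"
      unfolding on_modulus_def G_def[symmetric] H_def[symmetric] using \<open>0 < C\<close>
      by (intro divide_le_posI_ennreal) (auto simp: mult.commute)
  qed
  then have "ennreal C * (weak_tail q (rearrangement M (\<lambda>x. ennreal (norm (f x)))) s / ennreal C)
      \<le> ennreal C * sum_norm M (Lp_norm M p) (weak_Lq_norm M q) f"
    by (rule mult_left_mono) simp
  then show "weak_tail q (rearrangement M (\<lambda>x. ennreal (norm (f x)))) s
      \<le> ennreal C * sum_norm M (Lp_norm M p) (weak_Lq_norm M q) f"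
    using \<open>0 < C\<close> by (simp add: ennreal_times_divide mult_divide_eq_ennreal mult.commute[of "ennreal C"])
qed

lemma Lp_norm_finite_imp_in_sum:
  assumes "g \<in> borel_measurable M" "on_modulus (Lp_norm M p) g < \<infinity>"
  shows "g \<in> Lp_plus_weak_Lq M p q"
proof -
  have "sum_norm M (Lp_norm M p) (weak_Lq_norm M q) g
      \<le> on_modulus (Lp_norm M p) g + on_modulus (weak_Lq_norm M q) (\<lambda>x. 0 :: 'b)"
    unfolding sum_norm_def by (intro Inf_lower CollectI exI[of _ g] exI[of _ "\<lambda>x. 0"]) (use assms in auto)
  also have "\<dots> = on_modulus (Lp_norm M p) g"
    by (simp add: on_modulus_def weak_Lq_norm_def)
  finally show ?thesis using assms unfolding Lp_plus_weak_Lq_def by (auto intro: le_less_trans)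
qed

lemma weak_Lq_norm_finite_imp_in_sum:
  assumes "h \<in> borel_measurable M" "on_modulus (weak_Lq_norm M q) h < \<infinity>"
  shows "h \<in> Lp_plus_weak_Lq M p q"
proof -
  have "sum_norm M (Lp_norm M p) (weak_Lq_norm M q) h
      \<le> on_modulus (Lp_norm M p) (\<lambda>x. 0 :: 'b) + on_modulus (weak_Lq_norm M q) h"
    unfolding sum_norm_def by (intro Inf_lower CollectI exI[of _ "\<lambda>x. 0"] exI[of _ h]) (use assms in auto)
  also have "\<dots> = on_modulus (weak_Lq_norm M q) h"
    by (simp add: on_modulus_def Lp_norm_def)
  finally show ?thesis using assms unfolding Lp_plus_weak_Lq_def by (auto intro: le_less_trans)
qed

text \<open>The average over \<open>(0, t)\<close> sees the constant part as it is and
  \<open>v\<close> through its full integral. Later \<open>v\<close> is the \<open>p\<close>-th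
  power of the modulus of \<open>T g\<close>, whose integral the L^p bound controls.\<close>

lemma maximal_rearrangement_affine_le:
  assumes "sigma_finite_measure M" and [measurable]: "u \<in> borel_measurable M" "v \<in> borel_measurable M"
    and "0 < c" "0 \<le> b" "0 < t" and le: "AE x in M. u x \<le> ennreal c * (v x + ennreal b)"
  shows "maximal_rearrangement M u t \<le> ennreal c * ((\<integral>\<^sup>+x. v x \<partial>M) / ennreal t + ennreal b)"
proof -
  have "(\<integral>\<^sup>+s\<in>{0<..<t}. rearrangement M u s \<partial>lborel)
      \<le> (\<integral>\<^sup>+s. ennreal c * (rearrangement M v s * indicator {0<..<t} s + ennreal b * indicator {0<..<t} s) \<partial>lborel)"
    using rearrangement_affine_le[OF assms(2,3,4,5) le]
    by (intro nn_integral_mono) (auto split: split_indicator)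
  also have "\<dots> = ennreal c * ((\<integral>\<^sup>+s\<in>{0<..<t}. rearrangement M v s \<partial>lborel) + ennreal b * ennreal t)"
    using \<open>0 < t\<close> by (simp add: nn_integral_cmult nn_integral_add nn_integral_cmult_indicator)
  also have "\<dots> \<le> ennreal c * ((\<integral>\<^sup>+x. v x \<partial>M) + ennreal b * ennreal t)"
    using assms by (intro mult_left_mono add_right_mono set_nn_integral_rearrangement_le) auto
  finally have "maximal_rearrangement M u t \<le> ennreal c * ((\<integral>\<^sup>+x. v x \<partial>M) + ennreal b * ennreal t) / ennreal t"
    unfolding maximal_rearrangement_def by (rule divide_right_mono_ennreal)
  also have "\<dots> = ennreal c * ((\<integral>\<^sup>+x. v x \<partial>M) / ennreal t + ennreal b)"
    using \<open>0 < t\<close> by (simp add: add_divide_distrib_ennreal mult_divide_eq_ennreal flip: ennreal_times_divide)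
  finally show ?thesis .
qed

section \<open>From the boundedness of \<open>R\<close> to quasi-linear operators\<close>

text \<open>The splitting \<open>f = f 1\<^bsub>|f| > f\<^sup>*(t\<^sup>r)\<^esub> + f 1\<^bsub>|f| \<le> f\<^sup>*(t\<^sup>r)\<^esub>\<close> is nearly optimal for the \<open>K\<close>-functional of
  \<open>L\<^sup>p\<close> and \<open>L\<^bsup>q,\<infinity>\<^esup>\<close>.\<close>

lemma weak_Lq_norm_truncation_le:
  assumes [measurable]: "F \<in> borel_measurable M" and "0 < s" "0 < q"
  shows "weak_Lq_norm M q (\<lambda>x. if rearrangement M F s < F x then 0 else F x)
    \<le> weak_tail q (rearrangement M F) s"
  unfolding weak_Lq_norm_def
proof (rule SUP_least)
  let ?H = "\<lambda>x. if rearrangement M F s < F x then 0 else F x"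
  fix u :: real assume "u \<in> {0<..}"
  show "ennreal (u powr (1 / q)) * rearrangement M ?H u \<le> weak_tail q (rearrangement M F) s"
  proof (cases "s \<le> u")
    case True
    have "rearrangement M ?H u \<le> rearrangement M F u"
      by (rule rearrangement_AE_mono) auto
    then have "ennreal (u powr (1 / q)) * rearrangement M ?H u \<le> ennreal (u powr (1 / q)) * rearrangement M F u"
      by (rule mult_left_mono) simp
    also have "\<dots> \<le> weak_tail q (rearrangement M F) s"
      unfolding weak_tail_def using True by (intro SUP_upper) auto
    finally show ?thesis .
  next
    case False
    have "rearrangement M ?H u \<le> rearrangement M F s"
      by (rule rearrangement_le_const) (auto simp: not_less)
    then have "ennreal (u powr (1 / q)) * rearrangement M ?H u \<le> ennreal (s powr (1 / q)) * rearrangement M F s"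
      using False \<open>u \<in> _\<close> \<open>0 < q\<close> by (intro mult_mono ennreal_leI powr_mono2) auto
    also have "\<dots> \<le> weak_tail q (rearrangement M F) s"
      unfolding weak_tail_def by (intro SUP_upper) auto
    finally show ?thesis .
  qed
qed

text \<open>The set where \<open>F\<close> exceeds its rearrangement at \<open>s\<close> has measure
  at most \<open>s\<close> (it is empty if that value is infinite), so Hardy--Littlewood applies to
  it.\<close>

lemma nn_integral_epowr_peak_le:
  assumes "sigma_finite_measure M" and [measurable]: "F \<in> borel_measurable M" and "0 < s" "0 < p"
  shows "(\<integral>\<^sup>+x. epowr (if rearrangement M F s < F x then F x else 0) p \<partial>M)
    \<le> (\<integral>\<^sup>+u\<in>{0<..<s}. epowr (rearrangement M F u) p \<partial>lborel)"
proof -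
  define A where "A = {x \<in> space M. rearrangement M F s < F x}"
  have [measurable]: "A \<in> sets M" unfolding A_def by measurable
  have "emeasure M A \<le> ennreal s"
  proof (cases "rearrangement M F s")
    case (real l)
    then have "emeasure M A = distribution_fun M F l" by (simp add: A_def distribution_fun_def)
    then show ?thesis using distribution_fun_rearrangement_le[of F M s l] real by simp
  qed (simp add: A_def)
  then have "(\<integral>\<^sup>+x\<in>A. epowr (F x) p \<partial>M) \<le> (\<integral>\<^sup>+u\<in>{0<..<s}. epowr (rearrangement M F u) p \<partial>lborel)"
    using set_nn_integral_le_rearrangement[of M "\<lambda>x. epowr (F x) p" A s] assms
    by (simp add: rearrangement_epowr)
  also have "(\<integral>\<^sup>+x\<in>A. epowr (F x) p \<partial>M) = (\<integral>\<^sup>+x. epowr (if rearrangement M F s < F x then F x else 0) p \<partial>M)"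
    by (intro nn_integral_cong) (auto simp: A_def split: split_indicator)
  finally show ?thesis .
qed

text \<open>The peak \<open>g\<close> of \<open>f\<close> lies in L^p and its remainder
  \<open>h\<close> in weak L^q. \<open>T g\<close> enters through its L^p norm and
  \<open>T h\<close> as a constant, so the maximal rearrangement of their combination is bounded by
  one average plus one \<open>p\<close>-th power.\<close>

lemma sawyerable_maximal_estimate:
  fixes T :: "('a \<Rightarrow> 'k::{real_normed_field, euclidean_space}) \<Rightarrow> 'b \<Rightarrow> 'k"
  assumes M: "sigma_finite_measure M" and N: "sigma_finite_measure N"
    and p: "0 < p" and q: "0 < q" and T: "sawyerable M N p q T"
  obtains K where "0 < K"
    "\<And>f t. f \<in> Lp_plus_weak_Lq M p q \<Longrightarrow> 0 < t \<Longrightarrow>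
      maximal_rearrangement N (\<lambda>y. epowr (ennreal (norm (T f y))) p) t
        \<le> ennreal K * ((\<integral>\<^sup>+s\<in>{0<..<t powr r}. epowr (rearrangement M (\<lambda>x. ennreal (norm (f x))) s) p \<partial>lborel) / ennreal t
          + epowr (weak_tail q (rearrangement M (\<lambda>x. ennreal (norm (f x)))) (t powr r)) p)"
proof -
  let ?D = "Lp_plus_weak_Lq M p q :: ('a \<Rightarrow> 'k) set"
  have T_meas: "T f \<in> borel_measurable N" if "f \<in> ?D" for f
    using T that by (simp add: sawyerable_def operator_on_def)
  obtain k where k: "1 \<le> k" "\<And>f g. f \<in> ?D \<Longrightarrow> g \<in> ?D \<Longrightarrow>
      AE y in N. norm (T (\<lambda>x. f x + g x) y) \<le> k * (norm (T f y) + norm (T g y))"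
    using T unfolding sawyerable_def quasi_linear_operator_on_def by blast
  obtain c where c: "0 < c" "\<And>g. g \<in> borel_measurable M \<Longrightarrow> on_modulus (Lp_norm M p) g < \<infinity> \<Longrightarrow>
      on_modulus (Lp_norm N p) (T g) \<le> ennreal c * on_modulus (Lp_norm M p) g"
    using T unfolding sawyerable_def bounded_from_to_def by blast
  obtain d where d: "0 < d" "\<And>h. h \<in> borel_measurable M \<Longrightarrow> on_modulus (weak_Lq_norm M q) h < \<infinity> \<Longrightarrow>
      on_modulus (esssup N) (T h) \<le> ennreal d * on_modulus (weak_Lq_norm M q) h"
    using T unfolding sawyerable_def bounded_from_to_def by blast
  \<comment> \<open>\<open>k powr p\<close> comes from quasi-linearity, \<open>2 powr p\<close> from
    \<open>epowr_add_le\<close>.\<close>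
  define K0 where "K0 = k powr p * 2 powr p"
  define K where "K = K0 * (c powr p + d powr p)"
  have "0 < K0" "0 < K" using k(1) c d by (auto simp: K0_def K_def intro!: mult_pos_pos add_pos_pos)
  have "maximal_rearrangement N (\<lambda>y. epowr (ennreal (norm (T f y))) p) t
        \<le> ennreal K * ((\<integral>\<^sup>+s\<in>{0<..<t powr r}. epowr (rearrangement M (\<lambda>x. ennreal (norm (f x))) s) p \<partial>lborel) / ennreal t
          + epowr (weak_tail q (rearrangement M (\<lambda>x. ennreal (norm (f x)))) (t powr r)) p)"
    if f: "f \<in> ?D" and t: "0 < t" for f t
  proof -
    define F where "F x = ennreal (norm (f x))" for x
    define s where "s = t powr r"
    define I where "I = (\<integral>\<^sup>+u\<in>{0<..<s}. epowr (rearrangement M F u) p \<partial>lborel)"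
    define W where "W = weak_tail q (rearrangement M F) s"
    have "0 < s" using t by (simp add: s_def)
    have [measurable]: "f \<in> borel_measurable M" using f by (simp add: Lp_plus_weak_Lq_def)
    have F [measurable]: "F \<in> borel_measurable M" unfolding F_def[abs_def] by measurable
    have "maximal_rearrangement N (\<lambda>y. epowr (ennreal (norm (T f y))) p) t
      \<le> ennreal K * (I / ennreal t + epowr W p)"
    proof (cases "I < \<infinity> \<and> W < \<infinity>")
      \<comment> \<open>If one of the two quantities is infinite, so is the right side. Otherwise
        \<open>g\<close> and \<open>h\<close> have finite norms, which the boundedness of
        \<open>T\<close> presupposes.\<close>
      case False
      then have "I / ennreal t + epowr W p = top"
        using t by (auto simp: not_less top_unique ennreal_top_divide)
      with \<open>0 < K\<close> show ?thesis by (simp only: ennreal_mult_top ennreal_eq_0_iff) simp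
    next
      case True
      then obtain w where w: "W = ennreal w" "0 \<le> w" by (cases W) auto
      define g where "g x = (if rearrangement M F s < F x then f x else 0)" for x
      define h where "h x = (if rearrangement M F s < F x then 0 else f x)" for x
      have [measurable]: "g \<in> borel_measurable M" "h \<in> borel_measurable M"
        unfolding g_def[abs_def] h_def[abs_def] by measurable
      have norm_g: "(\<integral>\<^sup>+x. epowr (ennreal (norm (g x))) p \<partial>M) \<le> I"
      proof -
        have "ennreal (norm (g x)) = (if rearrangement M F s < F x then F x else 0)" for x
          by (simp add: g_def F_def)
        then show ?thesis
          unfolding I_def using nn_integral_epowr_peak_le[OF M F \<open>0 < s\<close> p] by simp
      qed
      have norm_h: "on_modulus (weak_Lq_norm M q) h \<le> W"
      proof -
        have "ennreal (norm (h x)) = (if rearrangement M F s < F x then 0 else F x)" for x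
          by (simp add: h_def F_def)
        then show ?thesis
          unfolding W_def on_modulus_def using weak_Lq_norm_truncation_le[OF F \<open>0 < s\<close> q] by simp
      qed
      have fin_g: "on_modulus (Lp_norm M p) g < \<infinity>"
      proof -
        have "epowr (on_modulus (Lp_norm M p) g) p < \<infinity>"
          using le_less_trans[OF norm_g] True by (simp add: on_modulus_def epowr_Lp_norm p)
        then show ?thesis by (cases "on_modulus (Lp_norm M p) g = top") (auto simp: top.not_eq_extremum)
      qed
      have fin_h: "on_modulus (weak_Lq_norm M q) h < \<infinity>" using norm_h True by auto
      have gD: "g \<in> ?D" using fin_g by (intro Lp_norm_finite_imp_in_sum) auto
      have hD: "h \<in> ?D" using fin_h by (intro weak_Lq_norm_finite_imp_in_sum) auto
      have [measurable]: "T f \<in> borel_measurable N" "T g \<in> borel_measurable N" "T h \<in> borel_measurable N"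
        using T_meas f gD hD by auto
      have "on_modulus (esssup N) (T h) \<le> ennreal d * W"
        using fin_h by (intro order_trans[OF d(2) mult_left_mono[OF norm_h]]) auto
      then have Th: "AE y in N. norm (T h y) \<le> d * w"
        using esssup_AE[of "\<lambda>y. ennreal (norm (T h y))" N] d(1) w unfolding on_modulus_def
        by (auto elim!: eventually_mono dest: order_trans simp flip: ennreal_mult)
      have "f = (\<lambda>x. g x + h x)" by (auto simp: g_def h_def)
      with k(2)[OF gD hD] have Tf: "AE y in N. norm (T f y) \<le> k * (norm (T g y) + norm (T h y))"
        by simp
      have "AE y in N. epowr (ennreal (norm (T f y))) p
          \<le> ennreal K0 * (epowr (ennreal (norm (T g y))) p + ennreal ((d * w) powr p))"
        using Tf Th
      proof eventually_elim
        case (elim y)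
        have "norm (T f y) \<le> k * (norm (T g y) + d * w)"
          using k(1) by (intro order_trans[OF elim(1)] mult_left_mono add_left_mono elim(2)) auto
        then have "ennreal (norm (T f y)) \<le> ennreal k * (ennreal (norm (T g y)) + ennreal (d * w))"
          using k(1) w d(1) by (simp add: ennreal_leI flip: ennreal_plus ennreal_mult)
        then have "epowr (ennreal (norm (T f y))) p
            \<le> epowr (ennreal k * (ennreal (norm (T g y)) + ennreal (d * w))) p"
          by (rule epowr_mono[OF p])
        also have "\<dots> \<le> ennreal (k powr p) * (ennreal (2 powr p) *
            (epowr (ennreal (norm (T g y))) p + epowr (ennreal (d * w)) p))"
          using k(1) p by (simp add: epowr_mult epowr_ennreal[of k] mult_left_mono epowr_add_le del: ennreal_plus)
        also have "\<dots> = ennreal K0 * (epowr (ennreal (norm (T g y))) p + ennreal ((d * w) powr p))"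
          using w d(1) epowr_ennreal[of "d * w" p]
          by (simp add: K0_def ennreal_mult'' mult.assoc)
        finally show ?case .
      qed
      then have "maximal_rearrangement N (\<lambda>y. epowr (ennreal (norm (T f y))) p) t
          \<le> ennreal K0 * ((\<integral>\<^sup>+y. epowr (ennreal (norm (T g y))) p \<partial>N) / ennreal t + ennreal ((d * w) powr p))"
        using \<open>0 < K0\<close> t by (intro maximal_rearrangement_affine_le N) auto
      also have "\<dots> \<le> ennreal K0 * (ennreal (c powr p + d powr p) * (I / ennreal t)
          + ennreal (c powr p + d powr p) * epowr W p)"
      proof (intro mult_left_mono add_mono)
        have "(\<integral>\<^sup>+y. epowr (ennreal (norm (T g y))) p \<partial>N) = epowr (on_modulus (Lp_norm N p) (T g)) p"
          by (simp add: on_modulus_def epowr_Lp_norm p)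
        also have "\<dots> \<le> epowr (ennreal c * on_modulus (Lp_norm M p) g) p"
          using fin_g by (intro epowr_mono p c(2)) auto
        also have "\<dots> = ennreal (c powr p) * (\<integral>\<^sup>+x. epowr (ennreal (norm (g x))) p \<partial>M)"
          using c(1) by (simp add: on_modulus_def epowr_mult epowr_Lp_norm p epowr_ennreal)
        also have "\<dots> \<le> ennreal (c powr p + d powr p) * I"
          using norm_g by (intro mult_mono ennreal_leI) auto
        finally show "(\<integral>\<^sup>+y. epowr (ennreal (norm (T g y))) p \<partial>N) / ennreal t
            \<le> ennreal (c powr p + d powr p) * (I / ennreal t)"
          by (simp add: ennreal_times_divide divide_right_mono_ennreal)
        show "ennreal ((d * w) powr p) \<le> ennreal (c powr p + d powr p) * epowr W p"
          using w d(1) by (simp add: epowr_ennreal powr_mult ennreal_leI mult_right_mono flip: ennreal_mult ennreal_plus)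
      qed auto
      also have "\<dots> = ennreal K * (I / ennreal t + epowr W p)"
      proof -
        have "ennreal K = ennreal K0 * ennreal (c powr p + d powr p)"
          unfolding K_def using \<open>0 < K0\<close> by (intro ennreal_mult) auto
        then show ?thesis by (simp only: mult.assoc distrib_left)
      qed
      finally show ?thesis .
    qed
    then show ?thesis unfolding I_def W_def s_def F_def .
  qed
  with \<open>0 < K\<close> that show ?thesis by blast
qed

text \<open>The supremum of \<open>weak_tail\<close> at \<open>t powr r\<close>, written with
  \<open>u = v powr r\<close> and restricted to \<open>v < b\<close>. Only these \<open>v\<close>
  lie in the interval on which the norm of the representation space of \<open>Y\<close>
  lives.\<close>

definition inner_tail :: "ennreal \<Rightarrow> real \<Rightarrow> real \<Rightarrow> (real \<Rightarrow> ennreal) \<Rightarrow> real \<Rightarrow> ennreal" where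
  "inner_tail b r q \<phi> t =
     (SUP v\<in>{v. t \<le> v \<and> ennreal v < b}. ennreal (v powr (r / q)) * \<phi> (v powr r))"

text \<open>The rest of the supremum, over \<open>v\<close> from \<open>b\<close> on; it does not
  depend on \<open>t\<close> and is empty for infinite \<open>b\<close>, hence the value 0.\<close>

definition outer_tail :: "ennreal \<Rightarrow> real \<Rightarrow> real \<Rightarrow> (real \<Rightarrow> ennreal) \<Rightarrow> ennreal" where
  "outer_tail b r q \<phi> = (if b = \<infinity> then 0 else weak_tail q \<phi> (enn2real b powr r))"

lemma inner_tail_measurable [measurable]: "inner_tail b r q \<phi> \<in> borel_measurable borel"
  by (intro borel_measurable_antimono antimonoI)
    (auto simp: inner_tail_def intro!: SUP_subset_mono)

lemma weak_tail_le_inner_outer: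
  assumes "0 < r" "0 < t"
  shows "weak_tail q \<phi> (t powr r) \<le> inner_tail b r q \<phi> t + outer_tail b r q \<phi>"
  unfolding weak_tail_def
proof (rule SUP_least)
  fix u assume "u \<in> {t powr r..}"
  then have u: "t powr r \<le> u" by simp
  moreover have "0 < t powr r" using assms by simp
  ultimately have "0 < u" by linarith
  define v where "v = u powr (1 / r)"
  have v: "u = v powr r" "0 < v" using \<open>0 < u\<close> \<open>0 < r\<close> by (simp_all add: v_def powr_powr)
  have "(t powr r) powr (1 / r) \<le> v" unfolding v_def using u assms by (intro powr_mono2) auto
  then have "t \<le> v" using assms by (simp add: powr_powr)
  show "ennreal (u powr (1 / q)) * \<phi> u \<le> inner_tail b r q \<phi> t + outer_tail b r q \<phi>"
  proof (cases "ennreal v < b")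
    case True
    have "ennreal (u powr (1 / q)) * \<phi> u = ennreal (v powr (r / q)) * \<phi> (v powr r)"
      using v by (simp add: powr_powr)
    also have "\<dots> \<le> inner_tail b r q \<phi> t"
      unfolding inner_tail_def using True \<open>t \<le> v\<close> by (intro SUP_upper) auto
    finally show ?thesis by (rule order_trans) simp
  next
    case False
    then obtain z where z: "b = ennreal z" "0 \<le> z" "z \<le> v"
      using \<open>0 < v\<close> by (cases b) (auto simp: not_less)
    then have "z powr r \<le> u" unfolding v(1) using \<open>0 < r\<close> by (intro powr_mono2) auto
    then have "ennreal (u powr (1 / q)) * \<phi> u \<le> outer_tail b r q \<phi>"
      unfolding outer_tail_def weak_tail_def using z by (auto intro!: SUP_upper)
    then show ?thesis by (rule order_trans) simp
  qed
qed

text \<open>If the supremum at \<open>t\<close> exceeds \<open>l\<close> through some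
  \<open>v\<close>, then \<open>A\<close> exceeds \<open>l\<close> on all of
  \<open>(v/3, v]\<close>: there \<open>\<phi>\<close> is evaluated further to the left and the
  power of \<open>v\<close> loses at most \<open>3 powr (r / q)\<close>. The length
  \<open>2 / 3 * v\<close> is at least the \<open>2 / 3 * t\<close> that
  \<open>ri_norm_le_twice\<close> asks for.\<close>

lemma ri_norm_inner_tail_le:
  assumes ri: "ri_function_norm (lborel_Ioo b) \<rho>" and \<phi>: "antimono \<phi>"
    and "0 < p" "0 < q" "0 < r" and r: "(r - 1) / p = r / q"
  shows "\<rho> (inner_tail b r q \<phi>) \<le> 2 * (ennreal (3 powr (r / q)) * \<rho> (hardy_mean p r \<phi>))"
proof -
  interpret ri_function_norm "lborel_Ioo b" \<rho> by fact
  define A where "A t = ennreal (3 powr (r / q)) * hardy_mean p r \<phi> t" for t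
  have [measurable]: "A \<in> borel_measurable borel" unfolding A_def[abs_def] by measurable
  have "\<rho> (inner_tail b r q \<phi>) \<le> 2 * \<rho> A"
  proof (rule ri_norm_le_twice[OF ri inner_tail_measurable])
    show "A \<in> borel_measurable (lborel_Ioo b)" by (rule measurable_lborel_Ioo) measurable
    fix l t :: real assume t: "0 \<le> l" "0 < t" "ennreal t < b" "ennreal l < inner_tail b r q \<phi> t"
    then obtain v where v: "t \<le> v" "ennreal v < b" "ennreal l < ennreal (v powr (r / q)) * \<phi> (v powr r)"
      unfolding inner_tail_def by (auto simp: less_SUP_iff)
    have "{v/3<..v} \<subseteq> {x \<in> {t. 0 < t \<and> ennreal t < b}. ennreal l < A x}"
    proof
      fix x assume "x \<in> {v/3<..v}"
      then have x: "v / 3 < x" "x \<le> v" "0 < x" using v t by auto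
      have "ennreal l < ennreal (v powr (r / q)) * \<phi> (v powr r)" by fact
      also have "\<dots> \<le> ennreal (3 powr (r / q) * x powr (r / q)) * \<phi> (x powr r)"
      proof (intro mult_mono ennreal_leI antimonoD[OF \<phi>])
        have "v powr (r / q) \<le> (3 * x) powr (r / q)"
          using x v t assms by (intro powr_mono2) auto
        then show "v powr (r / q) \<le> 3 powr (r / q) * x powr (r / q)"
          using x by (simp add: powr_mult)
        show "x powr r \<le> v powr r" using x assms by (intro powr_mono2) auto
      qed auto
      also have "\<dots> = ennreal (3 powr (r / q)) * (ennreal (x powr ((r - 1) / p)) * \<phi> (x powr r))"
        by (simp add: r ennreal_mult mult.assoc)
      also have "\<dots> \<le> A x"
        unfolding A_def using x assms by (intro mult_left_mono hardy_mean_ge) auto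
      finally show "x \<in> {x \<in> {t. 0 < t \<and> ennreal t < b}. ennreal l < A x}"
        using x v(2) by (auto intro: le_less_trans ennreal_leI)
    qed
    then have "emeasure lborel {v/3<..v} \<le> distribution_fun (lborel_Ioo b) A l"
      unfolding distribution_fun_def space_lborel_Ioo
      by (subst emeasure_lborel_Ioo) (auto intro!: emeasure_mono)
    moreover have "emeasure lborel {v/3<..v} = ennreal (2 / 3 * v)" using v t by simp
    moreover have "ennreal (2 / 3 * t) \<le> ennreal (2 / 3 * v)" using v by (intro ennreal_leI) simp
    ultimately show "ennreal (2 / 3 * t) \<le> distribution_fun (lborel_Ioo b) A l" by simp
  qed
  also have "\<rho> A = ennreal (3 powr (r / q)) * \<rho> (hardy_mean p r \<phi>)"
    unfolding A_def[abs_def] by (intro homogeneous measurable_lborel_Ioo) auto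
  finally show ?thesis .
qed

lemma ri_norm_const_le:
  assumes ri: "ri_function_norm (lborel_Ioo b) \<rho>" and "b < \<infinity>"
  obtains e where "0 < e" "\<And>z. z < \<infinity> \<Longrightarrow> \<rho> (\<lambda>t. z) \<le> ennreal e * z"
proof -
  interpret ri_function_norm "lborel_Ioo b" \<rho> by fact
  have "\<rho> (indicator (space (lborel_Ioo b))) < \<infinity>"
    using \<open>b < \<infinity>\<close> by (intro indicator_finite sets.top) simp
  then obtain e where e: "\<rho> (indicator (space (lborel_Ioo b))) = ennreal e" "0 \<le> e"
    by (cases "\<rho> (indicator (space (lborel_Ioo b)))") auto
  \<comment> \<open>Adding 1 keeps the constant positive when the norm of the indicator is 0, as for
    \<open>b = 0\<close>.\<close>
  have "\<rho> (\<lambda>t. z) \<le> ennreal (e + 1) * z" if fin: "z < \<infinity>" for z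
  proof -
    obtain w where w: "z = ennreal w" "0 \<le> w" using fin by (cases z) auto
    have "\<rho> (\<lambda>t. z) \<le> \<rho> (\<lambda>t. ennreal w * indicator (space (lborel_Ioo b)) t)"
      by (intro monotone AE_I2) (auto simp: w simp del: space_lborel_Ioo)
    also have "\<dots> = ennreal w * ennreal e"
      using w e by (simp add: homogeneous del: space_lborel_Ioo)
    also have "\<dots> \<le> ennreal (e + 1) * z"
      using w e by (simp add: mult.commute[of "ennreal w"] mult_right_mono)
    finally show ?thesis .
  qed
  with e that[of "e + 1"] show ?thesis by auto
qed

text \<open>For finite \<open>b\<close> the outer tail is a constant on an interval of finite
  length, and the norm of that interval's indicator is finite. The inclusion of \<open>X\<close>
  bounds the constant, via \<open>weak_tail_le_sum_norm\<close> at the fixed argument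
  \<open>b powr r\<close>.\<close>

lemma ri_norm_outer_tail_le:
  fixes X :: "('a \<Rightarrow> ennreal) \<Rightarrow> ennreal"
  assumes M: "sigma_finite_measure M" and ri: "ri_function_norm (lborel_Ioo b) \<rho>"
    and "0 < b" "0 < p" "p < q" "0 < r"
    and incl: "included_in (borel_measurable M :: ('a \<Rightarrow> 'k::{real_normed_field, euclidean_space}) set)
           (on_modulus X) (sum_norm M (Lp_norm M p) (weak_Lq_norm M q))"
  obtains C where "0 < C" "\<And>f :: 'a \<Rightarrow> 'k. f \<in> borel_measurable M \<Longrightarrow> on_modulus X f < \<infinity> \<Longrightarrow>
      \<rho> (\<lambda>t. outer_tail b r q (rearrangement M (\<lambda>x. ennreal (norm (f x))))) \<le> ennreal C * on_modulus X f"
proof (cases "b = \<infinity>")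
  case True
  interpret ri_function_norm "lborel_Ioo b" \<rho> by fact
  have "\<rho> (\<lambda>t. 0) = 0" by (subst zero_iff) auto
  then show ?thesis using that[of 1] True by (simp add: outer_tail_def)
next
  case False
  obtain e where e: "0 < e" "\<And>z. z < \<infinity> \<Longrightarrow> \<rho> (\<lambda>t. z) \<le> ennreal e * z"
    using ri_norm_const_le[OF ri] False by (auto simp: top.not_eq_extremum)
  have "0 < enn2real b powr r"
    using False \<open>0 < b\<close> by (simp add: enn2real_eq_0_iff zero_less_iff_neq_zero)
  then obtain C where C: "0 < C" "\<And>f :: 'a \<Rightarrow> 'k. f \<in> borel_measurable M \<Longrightarrow>
    weak_tail q (rearrangement M (\<lambda>x. ennreal (norm (f x)))) (enn2real b powr r)
      \<le> ennreal C * sum_norm M (Lp_norm M p) (weak_Lq_norm M q) f"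
    using weak_tail_le_sum_norm[OF M \<open>0 < p\<close> \<open>p < q\<close>, where 'k = 'k] by blast
  obtain D where D: "0 < D" "\<And>f :: 'a \<Rightarrow> 'k. f \<in> borel_measurable M \<Longrightarrow>
    sum_norm M (Lp_norm M p) (weak_Lq_norm M q) f \<le> ennreal D * on_modulus X f"
    using incl unfolding included_in_def by blast
  show ?thesis
  proof (rule that[of "e * (C * D)"])
    show "0 < e * (C * D)" using e C D by simp
    fix f :: "'a \<Rightarrow> 'k" assume f: "f \<in> borel_measurable M" "on_modulus X f < \<infinity>"
    let ?z = "outer_tail b r q (rearrangement M (\<lambda>x. ennreal (norm (f x))))"
    have "?z \<le> ennreal C * (ennreal D * on_modulus X f)"
      using order_trans[OF C(2)[OF f(1)] mult_left_mono[OF D(2)[OF f(1)]]] False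
      by (simp add: outer_tail_def)
    moreover have "ennreal C * (ennreal D * on_modulus X f) < \<infinity>"
      using f(2) by (simp add: ennreal_mult_less_top)
    ultimately have "\<rho> (\<lambda>t. ?z) \<le> ennreal e * (ennreal C * (ennreal D * on_modulus X f))"
      by (intro order_trans[OF e(2) mult_left_mono]) auto
    then show "\<rho> (\<lambda>t. ?z) \<le> ennreal (e * (C * D)) * on_modulus X f"
      using e C D by (simp add: ennreal_mult mult.assoc)
  qed
qed

lemma bounded_if_R_op_bounded:
  fixes T :: "('a \<Rightarrow> 'k::{real_normed_field, euclidean_space}) \<Rightarrow> 'b \<Rightarrow> 'k"
  assumes M: "sigma_finite_measure M" and N: "sigma_finite_measure N"
    and p: "1 < p" and pq: "p < q"
    and X: "representation_norm M X X_rep" and Y: "representation_norm N Y Y_rep"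
    and incl: "included_in (borel_measurable M :: ('a \<Rightarrow> 'k) set)
           (on_modulus X) (sum_norm M (Lp_norm M p) (weak_Lq_norm M q))"
    and R: "bounded_from_to (borel_measurable (lborel_Ioo (emeasure M (space M)))) X_rep Y_rep
      (\<lambda>g. R_op p q (zero_extension (emeasure M (space M)) g))"
    and T: "sawyerable M N p q T"
  shows "bounded_from_to (borel_measurable M)
        (on_modulus X) (on_modulus (power_maximal_norm N Y_rep p)) T"
proof -
  define a where "a = emeasure M (space M)"
  define b where "b = emeasure N (space N)"
  define r where "r = q / (q - p)"
  have q: "0 < q" "0 < p" and r: "0 < r" "(r - 1) / p = r / q"
    using p pq by (auto simp: r_def field_simps)
  have riY: "ri_function_norm (lborel_Ioo b) Y_rep"
    using Y by (simp add: representation_norm_def b_def)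
  interpret Y: ri_function_norm "lborel_Ioo b" Y_rep by fact
  have X_rep: "X_rep (rearrangement M F) = X F" if "F \<in> borel_measurable M" for F
    using X that by (simp add: representation_norm_def)
  obtain K where K: "0 < K" "\<And>f t. f \<in> Lp_plus_weak_Lq M p q \<Longrightarrow> 0 < t \<Longrightarrow>
      maximal_rearrangement N (\<lambda>y. epowr (ennreal (norm (T f y))) p) t
        \<le> ennreal K * ((\<integral>\<^sup>+s\<in>{0<..<t powr r}. epowr (rearrangement M (\<lambda>x. ennreal (norm (f x))) s) p \<partial>lborel) / ennreal t
          + epowr (weak_tail q (rearrangement M (\<lambda>x. ennreal (norm (f x)))) (t powr r)) p)"
    using sawyerable_maximal_estimate[OF M N q(2,1) T] by blast
  obtain C1 where C1: "0 < C1" "\<And>g. g \<in> borel_measurable (lborel_Ioo a) \<Longrightarrow> X_rep g < \<infinity> \<Longrightarrow>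
      Y_rep (R_op p q (zero_extension a g)) \<le> ennreal C1 * X_rep g"
    using R unfolding bounded_from_to_def a_def by blast
  obtain D where D: "0 < D" "\<And>f :: 'a \<Rightarrow> 'k. f \<in> borel_measurable M \<Longrightarrow>
    sum_norm M (Lp_norm M p) (weak_Lq_norm M q) f \<le> ennreal D * on_modulus X f"
    using incl unfolding included_in_def by blast
  show ?thesis
  proof (cases "b = 0")
    \<comment> \<open>Treated apart because \<open>ri_norm_outer_tail_le\<close> evaluates the tail
      at a positive argument; on the empty interval every norm is 0.\<close>
    case True
    have "Y_rep (\<lambda>t. epowr (maximal_rearrangement N u t) (1 / p)) = 0" for u
      using True by (subst Y.zero_iff) (auto intro!: measurable_lborel_Ioo AE_lborel_IooI)
    then show ?thesis
      unfolding bounded_from_to_def on_modulus_def power_maximal_norm_def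
      by (intro exI[of _ 1]) auto
  next
    case False
    then have "0 < b" by (simp add: zero_less_iff_neq_zero)
    obtain C2 where C2: "0 < C2" "\<And>f :: 'a \<Rightarrow> 'k. f \<in> borel_measurable M \<Longrightarrow> on_modulus X f < \<infinity> \<Longrightarrow>
        Y_rep (\<lambda>t. outer_tail b r q (rearrangement M (\<lambda>x. ennreal (norm (f x))))) \<le> ennreal C2 * on_modulus X f"
      using ri_norm_outer_tail_le[OF M riY \<open>0 < b\<close> q(2) pq r(1) incl] by blast
    \<comment> \<open>The two factors of \<open>epowr_add_le\<close> and of the constant
      \<open>K\<close>, both under the power \<open>1 / p\<close>.\<close>
    define L where "L = K powr (1 / p) * 2 powr (1 / p)"
    define C3 where "C3 = 2 * (3 powr (r / q) * C1)"
    have "0 < L" "0 < C3" using K C1 by (simp_all add: L_def C3_def)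
    show ?thesis
      unfolding bounded_from_to_def
    proof (intro exI[of _ "L * (C1 + (C3 + C2))"] conjI ballI impI)
      show "0 < L * (C1 + (C3 + C2))" using \<open>0 < L\<close> \<open>0 < C3\<close> C1 C2 by (intro mult_pos_pos) auto
      fix f :: "'a \<Rightarrow> 'k" assume f [measurable]: "f \<in> borel_measurable M" and fin: "on_modulus X f < \<infinity>"
      define \<phi> where "\<phi> = rearrangement M (\<lambda>x. ennreal (norm (f x)))"
      have \<phi>: "antimono \<phi>" unfolding \<phi>_def by (rule rearrangement_antimono)
      have X\<phi>: "X_rep \<phi> = on_modulus X f"
        unfolding \<phi>_def on_modulus_def by (rule X_rep) measurable
      \<comment> \<open>The inclusion puts \<open>f\<close> into the domain of
        \<open>T\<close>.\<close>
      have "sum_norm M (Lp_norm M p) (weak_Lq_norm M q) f < \<infinity>"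
        using D(2)[OF f] fin by (auto intro: le_less_trans simp: ennreal_mult_less_top)
      then have fD: "f \<in> Lp_plus_weak_Lq M p q" by (simp add: Lp_plus_weak_Lq_def)
      \<comment> \<open>\<open>\<phi>\<close> is a rearrangement already: cutting it to
        \<open>(0, a)\<close>, extending by 0 and rearranging gives it back.\<close>
      have \<phi>_eq: "rearrangement (lborel_Ioo \<infinity>) (zero_extension a \<phi>) = \<phi>"
        unfolding rearrangement_zero_extension unfolding \<phi>_def a_def by (rule rearrangement_idem) measurable
      have H: "Y_rep (hardy_mean p r \<phi>) \<le> ennreal C1 * on_modulus X f"
      proof -
        have "R_op p q (zero_extension a \<phi>) = hardy_mean p r \<phi>"
          unfolding R_op_eq_hardy_mean \<phi>_eq r_def ..
        moreover have "\<phi> \<in> borel_measurable (lborel_Ioo a)"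
          unfolding \<phi>_def by (intro measurable_lborel_Ioo rearrangement_measurable)
        ultimately show ?thesis using C1(2)[of \<phi>] fin X\<phi> by simp
      qed
      have W: "Y_rep (inner_tail b r q \<phi>) \<le> ennreal C3 * on_modulus X f"
      proof -
        have "Y_rep (inner_tail b r q \<phi>) \<le> 2 * (ennreal (3 powr (r / q)) * Y_rep (hardy_mean p r \<phi>))"
          by (rule ri_norm_inner_tail_le[OF riY \<phi>]) (use q r in auto)
        also have "\<dots> \<le> 2 * (ennreal (3 powr (r / q)) * (ennreal C1 * on_modulus X f))"
          by (intro mult_left_mono H) auto
        also have "\<dots> = ennreal C3 * on_modulus X f"
          using C1 by (simp add: C3_def ennreal_mult mult.assoc)
        finally show ?thesis .
      qed
      let ?P = "\<lambda>t. epowr (maximal_rearrangement N (\<lambda>y. epowr (ennreal (norm (T f y))) p) t) (1 / p)"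
      let ?S = "\<lambda>t. hardy_mean p r \<phi> t + (inner_tail b r q \<phi> t + outer_tail b r q \<phi>)"
      have "?P t \<le> ennreal L * ?S t" if "0 < t" for t
      proof -
        have "?P t \<le> epowr (ennreal K * ((\<integral>\<^sup>+s\<in>{0<..<t powr r}. epowr (\<phi> s) p \<partial>lborel) / ennreal t
            + epowr (weak_tail q \<phi> (t powr r)) p)) (1 / p)"
          unfolding \<phi>_def using p by (intro epowr_mono K(2) fD that) simp
        also have "\<dots> \<le> ennreal (K powr (1 / p)) * (ennreal (2 powr (1 / p)) *
            (hardy_mean p r \<phi> t + epowr (epowr (weak_tail q \<phi> (t powr r)) p) (1 / p)))"
          unfolding hardy_mean_def using p K(1)
          by (simp add: epowr_mult epowr_ennreal mult_left_mono epowr_add_le)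
        also have "\<dots> = ennreal L * (hardy_mean p r \<phi> t + weak_tail q \<phi> (t powr r))"
          using p by (simp add: epowr_inverse L_def ennreal_mult mult.assoc)
        also have "\<dots> \<le> ennreal L * ?S t"
          using r that by (intro mult_left_mono add_left_mono weak_tail_le_inner_outer) auto
        finally show ?thesis .
      qed
      then have "Y_rep ?P \<le> Y_rep (\<lambda>t. ennreal L * ?S t)"
        by (intro Y.monotone measurable_lborel_Ioo AE_lborel_IooI) auto
      also have "\<dots> = ennreal L * Y_rep ?S"
        using \<open>0 < L\<close> by (intro Y.homogeneous measurable_lborel_Ioo) auto
      also have "Y_rep ?S \<le> Y_rep (hardy_mean p r \<phi>) + Y_rep (\<lambda>t. inner_tail b r q \<phi> t + outer_tail b r q \<phi>)"
        by (intro Y.subadditive measurable_lborel_Ioo) auto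
      also have "Y_rep (\<lambda>t. inner_tail b r q \<phi> t + outer_tail b r q \<phi>)
          \<le> Y_rep (inner_tail b r q \<phi>) + Y_rep (\<lambda>t. outer_tail b r q \<phi>)"
        by (intro Y.subadditive measurable_lborel_Ioo) auto
      also have "Y_rep (hardy_mean p r \<phi>) + (Y_rep (inner_tail b r q \<phi>) + Y_rep (\<lambda>t. outer_tail b r q \<phi>))
          \<le> ennreal C1 * on_modulus X f + (ennreal C3 * on_modulus X f + ennreal C2 * on_modulus X f)"
        using C2(2)[OF f fin] by (intro add_mono H W) (simp add: \<phi>_def)
      also have "\<dots> = ennreal (C1 + (C3 + C2)) * on_modulus X f"
        using C1 C2 \<open>0 < C3\<close> by (simp add: distrib_right)
      finally show "on_modulus (power_maximal_norm N Y_rep p) (T f)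
          \<le> ennreal (L * (C1 + (C3 + C2))) * on_modulus X f"
        unfolding on_modulus_def power_maximal_norm_def
        using \<open>0 < L\<close> \<open>0 < C3\<close> C1 C2
        by (simp add: ennreal_mult mult_left_mono mult.assoc del: ennreal_plus)
    qed
  qed
qed

section \<open>A linear sawyerable operator\<close>

text \<open>The factor \<open>2 / s\<close> normalizes the mean: the window has measure
  \<open>s / 2\<close> as long as \<open>s\<close> does not exceed the total measure; see
  \<open>emeasure_window\<close>.\<close>

definition window_mean :: "'a measure \<Rightarrow> ('a \<Rightarrow> real) \<Rightarrow> ('a \<Rightarrow> 'k::{real_normed_field, euclidean_space}) \<Rightarrow> real \<Rightarrow> 'k" where
  "window_mean M \<sigma> f s = (2 / s) *\<^sub>R (\<integral>x. (if s / 2 \<le> \<sigma> x \<and> \<sigma> x < s then f x else 0) \<partial>M)"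

text \<open>Under the \<open>p\<close>-th power the weight becomes
  \<open>\<tau> y powr (r - 1)\<close>, which the substitution \<open>s = u powr r\<close> absorbs.
  Points with \<open>\<tau> y \<le> 0\<close> are those on which \<open>uniformizes\<close> gives no
  control.\<close>

definition window_op :: "'a measure \<Rightarrow> ('a \<Rightarrow> real) \<Rightarrow> ('b \<Rightarrow> real) \<Rightarrow> real \<Rightarrow> real \<Rightarrow>
    ('a \<Rightarrow> 'k::{real_normed_field, euclidean_space}) \<Rightarrow> 'b \<Rightarrow> 'k" where
  "window_op M \<sigma> \<tau> p r f y =
     (if 0 < \<tau> y then (\<tau> y powr ((r - 1) / p)) *\<^sub>R window_mean M \<sigma> f (\<tau> y powr r) else 0)"

definition window :: "'a measure \<Rightarrow> ('a \<Rightarrow> real) \<Rightarrow> real \<Rightarrow> 'a set" where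
  "window M \<sigma> s = {x \<in> space M. s / 2 \<le> \<sigma> x \<and> \<sigma> x < s}"

section \<open>Windows and the endpoint bounds of \<open>window_op\<close>\<close>

lemma uniformizes_measurable: "uniformizes M \<sigma> \<Longrightarrow> \<sigma> \<in> borel_measurable M"
  by (simp add: uniformizes_def)

lemma uniformizes_emeasure:
  "uniformizes M \<sigma> \<Longrightarrow>
    emeasure M {x \<in> space M. 0 < \<sigma> x \<and> \<sigma> x < s} = min (ennreal s) (emeasure M (space M))"
  by (simp add: uniformizes_def)

lemma window_sets:
  assumes "uniformizes M \<sigma>" shows "window M \<sigma> s \<in> sets M"
  using uniformizes_measurable[OF assms] unfolding window_def by measurable

lemma emeasure_window_le:
  assumes \<sigma>: "uniformizes M \<sigma>" and "0 < s" shows "emeasure M (window M \<sigma> s) \<le> ennreal s"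
proof -
  note uniformizes_measurable[OF \<sigma>, measurable]
  have "emeasure M (window M \<sigma> s) \<le> emeasure M {x \<in> space M. 0 < \<sigma> x \<and> \<sigma> x < s}"
    unfolding window_def using \<open>0 < s\<close> by (intro emeasure_mono) auto
  then show ?thesis by (simp add: uniformizes_emeasure[OF \<sigma>])
qed

lemma emeasure_window:
  assumes \<sigma>: "uniformizes M \<sigma>" and "0 < s" "ennreal s \<le> emeasure M (space M)"
  shows "emeasure M (window M \<sigma> s) = ennreal (s / 2)"
proof -
  note uniformizes_measurable[OF \<sigma>, measurable]
  let ?A = "\<lambda>s. {x \<in> space M. 0 < \<sigma> x \<and> \<sigma> x < s}"
  have "ennreal (s / 2) \<le> ennreal s" using \<open>0 < s\<close> by (intro ennreal_leI) simp
  with assms(3) have A: "emeasure M (?A s) = ennreal s" "emeasure M (?A (s / 2)) = ennreal (s / 2)"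
    using uniformizes_emeasure[OF \<sigma>, of s] uniformizes_emeasure[OF \<sigma>, of "s / 2"]
    by (auto simp: min_def)
  have "window M \<sigma> s = ?A s - ?A (s / 2)" using \<open>0 < s\<close> by (auto simp: window_def)
  also have "emeasure M \<dots> = ennreal s - ennreal (s / 2)"
    using A \<open>0 < s\<close> by (subst emeasure_Diff) auto
  also have "\<dots> = ennreal (s / 2)" using \<open>0 < s\<close> by (simp add: ennreal_minus)
  finally show ?thesis .
qed

text \<open>Either \<open>x \<le> c\<close>, or \<open>x\<close> is the product of its powers to
  \<open>1 - p\<close> and \<open>p\<close>, the first of which is at most
  \<open>c powr (1 - p)\<close>. Optimizing over \<open>c\<close> after integration replaces the
  convexity argument for Jensen's inequality and tolerates infinite values.\<close>

lemma ennreal_le_add_epowr: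
  assumes "0 < c" "1 < p" shows "x \<le> ennreal c + ennreal (c powr (1 - p)) * epowr x p"
proof (cases x)
  case (real z)
  have "z \<le> c + c powr (1 - p) * z powr p"
  proof (cases "z \<le> c")
    case False
    then have "z = z powr (1 - p) * z powr p" using \<open>0 < c\<close> by (simp flip: powr_add)
    also have "\<dots> \<le> c powr (1 - p) * z powr p"
      using assms False by (intro mult_right_mono powr_mono2') auto
    finally show ?thesis using \<open>0 < c\<close> by simp
  qed (simp add: add_increasing2)
  then show ?thesis
    using real \<open>0 < c\<close> by (simp add: epowr_ennreal ennreal_leI flip: ennreal_mult ennreal_plus)
qed (use assms in \<open>simp add: ennreal_mult_top\<close>)

lemma window_jensen:
  assumes \<sigma>: "uniformizes M \<sigma>" and [measurable]: "F \<in> borel_measurable M" and "1 < p" "0 < s"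
  shows "epowr (ennreal (2 / s) * (\<integral>\<^sup>+x\<in>window M \<sigma> s. F x \<partial>M)) p
    \<le> ennreal (4 powr p) * ((\<integral>\<^sup>+x\<in>window M \<sigma> s. epowr (F x) p \<partial>M) / ennreal s)"
proof -
  note [measurable] = window_sets[OF \<sigma>]
  define I where "I = ennreal (2 / s) * (\<integral>\<^sup>+x\<in>window M \<sigma> s. F x \<partial>M)"
  define J where "J = (\<integral>\<^sup>+x\<in>window M \<sigma> s. epowr (F x) p \<partial>M) / ennreal s"
  have le: "I \<le> ennreal (2 * c) + ennreal (2 * c powr (1 - p)) * J" if "0 < c" for c
  proof -
    have "(\<integral>\<^sup>+x\<in>window M \<sigma> s. F x \<partial>M)
        \<le> (\<integral>\<^sup>+x. ennreal c * indicator (window M \<sigma> s) x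
            + ennreal (c powr (1 - p)) * (epowr (F x) p * indicator (window M \<sigma> s) x) \<partial>M)"
      using ennreal_le_add_epowr[OF that \<open>1 < p\<close>]
      by (intro nn_integral_mono) (auto split: split_indicator)
    also have "\<dots> = ennreal c * emeasure M (window M \<sigma> s)
        + ennreal (c powr (1 - p)) * (\<integral>\<^sup>+x\<in>window M \<sigma> s. epowr (F x) p \<partial>M)"
      by (simp add: nn_integral_add nn_integral_cmult nn_integral_cmult_indicator)
    also have "\<dots> \<le> ennreal c * ennreal s + ennreal (c powr (1 - p)) * (\<integral>\<^sup>+x\<in>window M \<sigma> s. epowr (F x) p \<partial>M)"
      using emeasure_window_le[OF \<sigma> \<open>0 < s\<close>] by (intro add_mono mult_left_mono) auto
    finally have "I \<le> ennreal (2 / s) * (ennreal c * ennreal s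
        + ennreal (c powr (1 - p)) * (\<integral>\<^sup>+x\<in>window M \<sigma> s. epowr (F x) p \<partial>M))"
      unfolding I_def by (rule mult_left_mono) simp
    also have "\<dots> = ennreal (2 * c) + ennreal (2 * c powr (1 - p)) * (ennreal (1 / s) * (\<integral>\<^sup>+x\<in>window M \<sigma> s. epowr (F x) p \<partial>M))"
      using \<open>0 < s\<close> that by (simp add: distrib_left mult.commute flip: ennreal_mult mult.assoc)
    also have "ennreal (1 / s) * (\<integral>\<^sup>+x\<in>window M \<sigma> s. epowr (F x) p \<partial>M) = J"
      unfolding J_def using \<open>0 < s\<close>
      by (simp add: divide_ennreal_def mult.commute inverse_ennreal inverse_eq_divide)
    finally show ?thesis .
  qed
  show ?thesis
    unfolding I_def[symmetric] J_def[symmetric]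
  proof (cases J)
    case (real j)
    show "epowr I p \<le> ennreal (4 powr p) * J"
    proof (cases "j = 0")
      case True
      \<comment> \<open>With \<open>J = 0\<close> the second term of \<open>le\<close> vanishes for
        every \<open>c\<close>; \<open>c = e / 2\<close> gives the bound \<open>e\<close>.\<close>
      have "I \<le> 0"
      proof (rule ennreal_le_epsilon)
        fix e :: real assume "0 < e"
        then show "I \<le> 0 + ennreal e" using le[of "e / 2"] True real by simp
      qed
      then show ?thesis by simp
    next
      case False
      with real have "0 < j" by simp
      \<comment> \<open>The choice \<open>c = j powr (1 / p)\<close> balances the two terms of
        \<open>le\<close>: each becomes \<open>2 * j powr (1 / p)\<close>, whence the constant
        \<open>4 powr p\<close>.\<close>
      have "(j powr (1 / p)) powr (1 - p) * j = j powr ((1 - p) / p) * j powr 1"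
        using \<open>0 < j\<close> by (simp add: powr_powr)
      also have "\<dots> = j powr (1 / p)"
        using \<open>1 < p\<close> unfolding powr_add[symmetric] by (simp add: diff_divide_distrib)
      finally have "(j powr (1 / p)) powr (1 - p) * j = j powr (1 / p)" .
      then have "ennreal (2 * (j powr (1 / p)) powr (1 - p)) * J = ennreal (2 * j powr (1 / p))"
        using real by (simp add: mult.assoc flip: ennreal_mult)
      then have "I \<le> ennreal (4 * j powr (1 / p))"
        using le[of "j powr (1 / p)"] \<open>0 < j\<close> by (simp flip: ennreal_plus)
      then have "epowr I p \<le> epowr (ennreal (4 * j powr (1 / p))) p"
        using \<open>1 < p\<close> by (intro epowr_mono) auto
      also have "\<dots> = ennreal (4 powr p) * J"
        using \<open>1 < p\<close> \<open>0 < j\<close> real by (simp add: epowr_ennreal powr_mult powr_powr flip: ennreal_mult)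
      finally show ?thesis .
    qed
  qed (simp add: ennreal_mult_top)
qed

lemma nn_integral_powr_from_0:
  assumes "a > - 1" "0 \<le> s"
  shows "(\<integral>\<^sup>+u\<in>{0<..<s}. ennreal (u powr a) \<partial>lborel) = ennreal (s powr (a + 1) / (a + 1))"
proof -
  have "((\<lambda>u. u powr a) has_integral (s powr (a + 1) / (a + 1))) {0..s}"
    by (rule has_integral_powr_from_0) (use assms in auto)
  moreover have "(\<lambda>u. u powr a * indicator {0..s} u) = (\<lambda>u. if u \<in> {0..s} then u powr a else 0)"
    by (auto split: split_indicator)
  ultimately have "((\<lambda>u. u powr a * indicator {0..s} u) has_integral (s powr (a + 1) / (a + 1))) UNIV"
    by (simp only: has_integral_restrict_UNIV)
  then have "(\<integral>\<^sup>+u. ennreal (u powr a * indicator {0..s} u) \<partial>lborel) = ennreal (s powr (a + 1) / (a + 1))"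
    by (intro nn_integral_has_integral_lborel) auto
  also have "(\<integral>\<^sup>+u. ennreal (u powr a * indicator {0..s} u) \<partial>lborel) = (\<integral>\<^sup>+u\<in>{0<..<s}. ennreal (u powr a) \<partial>lborel)"
  proof (rule nn_integral_cong_AE)
    have "AE u in lborel. u \<noteq> 0 \<and> u \<noteq> s" using AE_lborel_singleton[of 0] AE_lborel_singleton[of s] by auto
    then show "AE u in lborel. ennreal (u powr a * indicator {0..s} u) = ennreal (u powr a) * indicator {0<..<s} u"
      by eventually_elim (auto split: split_indicator)
  qed
  finally show ?thesis .
qed

text \<open>By Hardy--Littlewood the integral is largest for the rearrangement on
  \<open>(0, s)\<close>, which is at most a multiple of \<open>u powr (- 1 / q)\<close>; this is
  integrable at 0 because \<open>q > 1\<close>.\<close>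

lemma window_weak_bound:
  assumes M: "sigma_finite_measure M" and \<sigma>: "uniformizes M \<sigma>"
    and [measurable]: "F \<in> borel_measurable M" and "1 < q" "0 < s"
  shows "(\<integral>\<^sup>+x\<in>window M \<sigma> s. F x \<partial>M) \<le> ennreal (s powr (1 - 1 / q) / (1 - 1 / q)) * weak_Lq_norm M q F"
proof -
  have "(\<integral>\<^sup>+x\<in>window M \<sigma> s. F x \<partial>M) \<le> (\<integral>\<^sup>+u\<in>{0<..<s}. rearrangement M F u \<partial>lborel)"
    using \<open>0 < s\<close> by (intro set_nn_integral_le_rearrangement M window_sets[OF \<sigma>] emeasure_window_le[OF \<sigma>]) auto
  also have "\<dots> \<le> (\<integral>\<^sup>+u. (ennreal (u powr (- 1 / q)) * indicator {0<..<s} u) * weak_Lq_norm M q F \<partial>lborel)"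
  proof (intro nn_integral_mono)
    fix u
    have "rearrangement M F u \<le> ennreal (u powr (- 1 / q)) * weak_Lq_norm M q F" if "0 < u"
    proof -
      have "rearrangement M F u = ennreal (u powr (- 1 / q)) * (ennreal (u powr (1 / q)) * rearrangement M F u)"
        using that by (simp flip: mult.assoc ennreal_mult powr_add)
      also have "\<dots> \<le> ennreal (u powr (- 1 / q)) * weak_Lq_norm M q F"
        unfolding weak_Lq_norm_def using that by (intro mult_left_mono SUP_upper) auto
      finally show ?thesis .
    qed
    then show "rearrangement M F u * indicator {0<..<s} u
        \<le> (ennreal (u powr (- 1 / q)) * indicator {0<..<s} u) * weak_Lq_norm M q F"
      by (auto split: split_indicator)
  qed
  also have "\<dots> = (\<integral>\<^sup>+u\<in>{0<..<s}. ennreal (u powr (- 1 / q)) \<partial>lborel) * weak_Lq_norm M q F"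
    by (rule nn_integral_multc) measurable
  also have "(\<integral>\<^sup>+u\<in>{0<..<s}. ennreal (u powr (- 1 / q)) \<partial>lborel) = ennreal (s powr (1 - 1 / q) / (1 - 1 / q))"
    using \<open>1 < q\<close> \<open>0 < s\<close> by (subst nn_integral_powr_from_0) (auto simp: field_simps)
  finally show ?thesis .
qed

lemma norm_window_mean_le:
  assumes "0 < s"
  shows "ennreal (norm (window_mean M \<sigma> f s)) \<le> ennreal (2 / s) * (\<integral>\<^sup>+x\<in>window M \<sigma> s. ennreal (norm (f x)) \<partial>M)"
proof -
  let ?g = "\<lambda>x. if s / 2 \<le> \<sigma> x \<and> \<sigma> x < s then f x else 0"
  \<comment> \<open>A nonintegrable function has Bochner integral 0, so the bound extends to
    it.\<close>
  have "ennreal (norm (\<integral>x. ?g x \<partial>M)) \<le> (\<integral>\<^sup>+x. ennreal (norm (?g x)) \<partial>M)"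
    by (cases "integrable M ?g") (auto intro: integral_norm_bound_ennreal simp: not_integrable_integral_eq)
  also have "\<dots> = (\<integral>\<^sup>+x\<in>window M \<sigma> s. ennreal (norm (f x)) \<partial>M)"
    by (intro nn_integral_cong) (auto simp: window_def split: split_indicator)
  finally show ?thesis
    using \<open>0 < s\<close> unfolding window_mean_def norm_scaleR by (subst ennreal_mult) (auto intro: mult_left_mono)
qed

lemma window_op_measurable:
  assumes "sigma_finite_measure M" and \<sigma>: "uniformizes M \<sigma>" and \<tau>: "uniformizes N \<tau>"
    and [measurable]: "f \<in> borel_measurable M"
  shows "window_op M \<sigma> \<tau> p r f \<in> borel_measurable N"
proof -
  interpret sigma_finite_measure M by fact
  note uniformizes_measurable[OF \<sigma>, measurable] uniformizes_measurable[OF \<tau>, measurable]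
  show ?thesis unfolding window_op_def[abs_def] window_mean_def by measurable
qed

text \<open>Jensen's inequality on the window; the weight \<open>\<tau> y powr (r - 1)\<close> and
  the normalization by \<open>\<tau> y powr r\<close> leave the factor \<open>1 / \<tau> y\<close>.
  The result is a kernel applied to the \<open>p\<close>-th power of the modulus of
  \<open>f\<close>, ready for Tonelli's theorem.\<close>

lemma epowr_norm_window_op_le:
  assumes \<sigma>: "uniformizes M \<sigma>" and [measurable]: "f \<in> borel_measurable M" and "1 < p" and \<tau>: "0 < \<tau> y"
  shows "epowr (ennreal (norm (window_op M \<sigma> \<tau> p r f y))) p
    \<le> ennreal (4 powr p) * (\<integral>\<^sup>+x. ennreal (1 / \<tau> y) * epowr (ennreal (norm (f x))) p
        * indicator (window M \<sigma> (\<tau> y powr r)) x \<partial>M)"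
proof -
  note [measurable] = window_sets[OF \<sigma>]
  let ?s = "\<tau> y powr r"
  let ?J = "\<integral>\<^sup>+x\<in>window M \<sigma> ?s. epowr (ennreal (norm (f x))) p \<partial>M"
  have "0 < ?s" using \<tau> by simp
  have "epowr (ennreal (norm (window_op M \<sigma> \<tau> p r f y))) p
      = ennreal (\<tau> y powr (r - 1)) * epowr (ennreal (norm (window_mean M \<sigma> f ?s))) p"
    using \<tau> \<open>1 < p\<close> by (simp add: window_op_def ennreal_mult epowr_mult epowr_ennreal powr_powr)
  also have "\<dots> \<le> ennreal (\<tau> y powr (r - 1)) * (ennreal (4 powr p) * (?J / ennreal ?s))"
  proof (rule mult_left_mono)
    have "epowr (ennreal (norm (window_mean M \<sigma> f ?s))) p
        \<le> epowr (ennreal (2 / ?s) * (\<integral>\<^sup>+x\<in>window M \<sigma> ?s. ennreal (norm (f x)) \<partial>M)) p"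
      using \<open>1 < p\<close> norm_window_mean_le[OF \<open>0 < ?s\<close>] by (intro epowr_mono) auto
    also have "\<dots> \<le> ennreal (4 powr p) * (?J / ennreal ?s)"
      using \<open>1 < p\<close> \<open>0 < ?s\<close> by (intro window_jensen[OF \<sigma>]) auto
    finally show "epowr (ennreal (norm (window_mean M \<sigma> f ?s))) p \<le> ennreal (4 powr p) * (?J / ennreal ?s)" .
  qed simp
  also have "\<dots> = ennreal (4 powr p) * (ennreal (\<tau> y powr (r - 1)) * ennreal (1 / ?s) * ?J)"
    using \<open>0 < ?s\<close> by (simp add: divide_ennreal_def inverse_ennreal inverse_eq_divide mult_ac)
  also have "ennreal (\<tau> y powr (r - 1)) * ennreal (1 / ?s) = ennreal (1 / \<tau> y)"
    using \<tau> by (simp add: powr_diff flip: ennreal_mult)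
  also have "ennreal (1 / \<tau> y) * ?J = (\<integral>\<^sup>+x. ennreal (1 / \<tau> y) * epowr (ennreal (norm (f x))) p
        * indicator (window M \<sigma> ?s) x \<partial>M)"
    by (simp add: nn_integral_cmult mult.assoc)
  finally show ?thesis .
qed

text \<open>After an exchange of integrals, only the integral of the kernel \<open>k\<close> in
  \<open>y\<close> has to be bounded. For fixed \<open>x\<close>, the points \<open>y\<close> whose
  window contains \<open>x\<close> have \<open>\<tau> y\<close> comparable to
  \<open>\<sigma> x powr (1 / r)\<close>, and there \<open>k\<close> is comparable to the inverse of
  that number.\<close>

lemma window_op_Lp_bound:
  assumes M: "sigma_finite_measure M" and N: "sigma_finite_measure N"
    and \<sigma>: "uniformizes M \<sigma>" and \<tau>: "uniformizes N \<tau>"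
    and [measurable]: "f \<in> borel_measurable M" and "1 < p" "0 < r"
  shows "(\<integral>\<^sup>+y. epowr (ennreal (norm (window_op M \<sigma> \<tau> p r f y))) p \<partial>N)
    \<le> ennreal (4 powr p * 3 powr (1 / r)) * (\<integral>\<^sup>+x. epowr (ennreal (norm (f x))) p \<partial>M)"
proof -
  interpret M: sigma_finite_measure M by fact
  interpret N: sigma_finite_measure N by fact
  interpret pair_sigma_finite N M ..
  note uniformizes_measurable[OF \<sigma>, measurable] uniformizes_measurable[OF \<tau>, measurable]
  define k where "k y x = (if 0 < \<tau> y \<and> \<tau> y powr r / 2 \<le> \<sigma> x \<and> \<sigma> x < \<tau> y powr r
      then ennreal (1 / \<tau> y) else 0)" for y x
  have [measurable]: "case_prod k \<in> borel_measurable (N \<Otimes>\<^sub>M M)"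
    unfolding k_def[abs_def] by measurable
  have inner: "(\<integral>\<^sup>+y. k y x \<partial>N) \<le> ennreal (3 powr (1 / r))" for x
  proof (cases "0 < \<sigma> x")
    case True
    \<comment> \<open>A window that contains \<open>x\<close> has
      \<open>\<tau> y powr r \<le> 2 * \<sigma> x\<close>; the 3 makes the inequality strict, the
      form in which \<open>uniformizes\<close> gives measures.\<close>
    let ?A = "{y \<in> space N. 0 < \<tau> y \<and> \<tau> y < (3 * \<sigma> x) powr (1 / r)}"
    have "(\<integral>\<^sup>+y. k y x \<partial>N) \<le> (\<integral>\<^sup>+y. ennreal (1 / \<sigma> x powr (1 / r)) * indicator ?A y \<partial>N)"
    proof (rule nn_integral_mono)
      fix y assume "y \<in> space N"
      show "k y x \<le> ennreal (1 / \<sigma> x powr (1 / r)) * indicator ?A y"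
      proof (cases "0 < \<tau> y \<and> \<tau> y powr r / 2 \<le> \<sigma> x \<and> \<sigma> x < \<tau> y powr r")
        case y: True
        have "\<sigma> x powr (1 / r) \<le> (\<tau> y powr r) powr (1 / r)"
          using y True \<open>0 < r\<close> by (intro powr_mono2) auto
        then have lo: "\<sigma> x powr (1 / r) \<le> \<tau> y" using y \<open>0 < r\<close> by (simp add: powr_powr)
        have "(\<tau> y powr r) powr (1 / r) < (3 * \<sigma> x) powr (1 / r)"
          using y True \<open>0 < r\<close> by (intro powr_less_mono2) auto
        then have "\<tau> y < (3 * \<sigma> x) powr (1 / r)" using y \<open>0 < r\<close> by (simp add: powr_powr)
        then show ?thesis
          using y \<open>y \<in> space N\<close> lo True by (auto simp: k_def intro!: ennreal_leI divide_left_mono)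
      qed (auto simp: k_def)
    qed
    also have "\<dots> = ennreal (1 / \<sigma> x powr (1 / r)) * emeasure N ?A"
      by (intro nn_integral_cmult_indicator) measurable
    also have "\<dots> \<le> ennreal (1 / \<sigma> x powr (1 / r)) * ennreal ((3 * \<sigma> x) powr (1 / r))"
      by (intro mult_left_mono) (simp_all add: uniformizes_emeasure[OF \<tau>])
    also have "\<dots> = ennreal (3 powr (1 / r))"
      using True by (simp add: powr_mult flip: ennreal_mult)
    finally show ?thesis .
  next
    case False
    have "k y x = 0" for y
    proof (cases "0 < \<tau> y")
      case True
      then have "0 < \<tau> y powr r" by simp
      with False show ?thesis by (auto simp: k_def)
    qed (simp add: k_def)
    then show ?thesis by simp
  qed
  have "(\<integral>\<^sup>+y. epowr (ennreal (norm (window_op M \<sigma> \<tau> p r f y))) p \<partial>N)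
      \<le> (\<integral>\<^sup>+y. ennreal (4 powr p) * (\<integral>\<^sup>+x. k y x * epowr (ennreal (norm (f x))) p \<partial>M) \<partial>N)"
  proof (rule nn_integral_mono)
    fix y
    show "epowr (ennreal (norm (window_op M \<sigma> \<tau> p r f y))) p
        \<le> ennreal (4 powr p) * (\<integral>\<^sup>+x. k y x * epowr (ennreal (norm (f x))) p \<partial>M)"
    proof (cases "0 < \<tau> y")
      case True
      have "(\<integral>\<^sup>+x. ennreal (1 / \<tau> y) * epowr (ennreal (norm (f x))) p
          * indicator (window M \<sigma> (\<tau> y powr r)) x \<partial>M) = (\<integral>\<^sup>+x. k y x * epowr (ennreal (norm (f x))) p \<partial>M)"
        using True by (intro nn_integral_cong) (auto simp: k_def window_def split: split_indicator)
      then show ?thesis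
        using epowr_norm_window_op_le[where \<tau> = \<tau> and y = y and f = f and r = r, OF \<sigma> _ \<open>1 < p\<close> True]
        by simp
    qed (simp add: window_op_def)
  qed
  also have "\<dots> = ennreal (4 powr p) * (\<integral>\<^sup>+y. \<integral>\<^sup>+x. k y x * epowr (ennreal (norm (f x))) p \<partial>M \<partial>N)"
    by (intro nn_integral_cmult) measurable
  also have "(\<integral>\<^sup>+y. \<integral>\<^sup>+x. k y x * epowr (ennreal (norm (f x))) p \<partial>M \<partial>N)
      = (\<integral>\<^sup>+x. \<integral>\<^sup>+y. k y x * epowr (ennreal (norm (f x))) p \<partial>N \<partial>M)"
    by (rule Fubini'[symmetric]) measurable
  also have "\<dots> = (\<integral>\<^sup>+x. (\<integral>\<^sup>+y. k y x \<partial>N) * epowr (ennreal (norm (f x))) p \<partial>M)"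
    by (intro nn_integral_cong nn_integral_multc) measurable
  also have "\<dots> \<le> (\<integral>\<^sup>+x. ennreal (3 powr (1 / r)) * epowr (ennreal (norm (f x))) p \<partial>M)"
    by (intro nn_integral_mono mult_right_mono inner) simp
  also have "\<dots> = ennreal (3 powr (1 / r)) * (\<integral>\<^sup>+x. epowr (ennreal (norm (f x))) p \<partial>M)"
    by (intro nn_integral_cmult) measurable
  finally show ?thesis
    by (simp add: ennreal_mult mult.assoc mult_left_mono)
qed

text \<open>The exponents of \<open>\<tau> y\<close> are \<open>r / q\<close> from the weight,
  \<open>- r\<close> from the normalization and \<open>r * (1 - 1 / q)\<close> from
  \<open>window_weak_bound\<close>; they add up to 0.\<close>

lemma window_op_weak_bound:
  assumes M: "sigma_finite_measure M" and \<sigma>: "uniformizes M \<sigma>"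
    and [measurable]: "f \<in> borel_measurable M" and "1 < q" and r: "(r - 1) / p = r / q"
  shows "ennreal (norm (window_op M \<sigma> \<tau> p r f y))
    \<le> ennreal (2 / (1 - 1 / q)) * weak_Lq_norm M q (\<lambda>x. ennreal (norm (f x)))"
proof (cases "0 < \<tau> y")
  case True
  let ?s = "\<tau> y powr r"
  let ?W = "weak_Lq_norm M q (\<lambda>x. ennreal (norm (f x)))"
  have "0 < ?s" using True by simp
  have "ennreal (norm (window_op M \<sigma> \<tau> p r f y)) = ennreal (\<tau> y powr (r / q)) * ennreal (norm (window_mean M \<sigma> f ?s))"
    using True by (simp add: window_op_def r ennreal_mult)
  also have "\<dots> \<le> ennreal (\<tau> y powr (r / q)) * (ennreal (2 / ?s) *
      (ennreal (?s powr (1 - 1 / q) / (1 - 1 / q)) * ?W))"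
    using window_weak_bound[OF M \<sigma> _ \<open>1 < q\<close> \<open>0 < ?s\<close>, of "\<lambda>x. ennreal (norm (f x))"]
    by (intro mult_left_mono order_trans[OF norm_window_mean_le[OF \<open>0 < ?s\<close>]]) auto
  also have "\<dots> = ennreal (\<tau> y powr (r / q) * (2 / ?s) * (?s powr (1 - 1 / q) / (1 - 1 / q))) * ?W"
  proof -
    have "ennreal x * (ennreal y * (ennreal z * w)) = ennreal (x * y * z) * w"
      if "0 \<le> x" "0 \<le> y" "0 \<le> z" for x y z w
      using that by (simp add: ennreal_mult mult.assoc)
    then show ?thesis using \<open>1 < q\<close> by simp
  qed
  also have "\<tau> y powr (r / q) * (2 / ?s) * (?s powr (1 - 1 / q) / (1 - 1 / q)) = 2 / (1 - 1 / q)"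
  proof -
    have "\<tau> y powr (r / q) * (?s powr (1 - 1 / q)) = \<tau> y powr (r / q + r * (1 - 1 / q))"
      by (simp add: powr_powr powr_add)
    also have "r / q + r * (1 - 1 / q) = r" by (simp add: algebra_simps)
    finally have eq: "\<tau> y powr (r / q) * (?s powr (1 - 1 / q)) = ?s" .
    have "\<tau> y powr (r / q) * (2 / ?s) * (?s powr (1 - 1 / q) / (1 - 1 / q))
        = 2 * (\<tau> y powr (r / q) * (?s powr (1 - 1 / q))) / (?s * (1 - 1 / q))" by simp
    also have "\<dots> = 2 / (1 - 1 / q)" unfolding eq using True by simp
    finally show ?thesis .
  qed
  finally show ?thesis .
qed (simp add: window_op_def)

text \<open>The L^p part is integrable on the window by \<open>window_jensen\<close>, the weak L^q
  part by \<open>window_weak_bound\<close>. Without integrability the default value 0 of the Bochner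
  integral could break linearity.\<close>

lemma window_integrable:
  fixes f :: "'a \<Rightarrow> 'k::{real_normed_field, euclidean_space}"
  assumes M: "sigma_finite_measure M" and \<sigma>: "uniformizes M \<sigma>" and "1 < p" "1 < q" "0 < s"
    and f: "f \<in> Lp_plus_weak_Lq M p q"
  shows "integrable M (\<lambda>x. if s / 2 \<le> \<sigma> x \<and> \<sigma> x < s then f x else 0)"
proof -
  note uniformizes_measurable[OF \<sigma>, measurable] window_sets[OF \<sigma>, measurable]
  have [measurable]: "f \<in> borel_measurable M" and "sum_norm M (Lp_norm M p) (weak_Lq_norm M q) f < \<infinity>"
    using f by (auto simp: Lp_plus_weak_Lq_def)
  then obtain g h :: "'a \<Rightarrow> 'k" where [measurable]: "g \<in> borel_measurable M" "h \<in> borel_measurable M"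
    and fgh: "f = (\<lambda>x. g x + h x)"
    and fin: "on_modulus (Lp_norm M p) g + on_modulus (weak_Lq_norm M q) h < \<infinity>"
    unfolding sum_norm_def by (auto simp: Inf_less_iff)
  let ?G = "\<integral>\<^sup>+x\<in>window M \<sigma> s. ennreal (norm (g x)) \<partial>M"
  let ?H = "\<integral>\<^sup>+x\<in>window M \<sigma> s. ennreal (norm (h x)) \<partial>M"
  have "?H \<le> ennreal (s powr (1 - 1 / q) / (1 - 1 / q)) * on_modulus (weak_Lq_norm M q) h"
    unfolding on_modulus_def by (intro window_weak_bound M \<sigma> assms) measurable
  also have "\<dots> < \<infinity>" using fin by (simp add: ennreal_mult_less_top)
  finally have H: "?H < \<infinity>" .
  have "epowr (ennreal (2 / s) * ?G) p
      \<le> ennreal (4 powr p) * ((\<integral>\<^sup>+x\<in>window M \<sigma> s. epowr (ennreal (norm (g x))) p \<partial>M) / ennreal s)"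
    by (intro window_jensen \<sigma> assms) measurable
  also have "\<dots> < \<infinity>"
  proof -
    have "(\<integral>\<^sup>+x\<in>window M \<sigma> s. epowr (ennreal (norm (g x))) p \<partial>M) \<le> (\<integral>\<^sup>+x. epowr (ennreal (norm (g x))) p \<partial>M)"
      by (intro nn_integral_mono) (auto split: split_indicator)
    also have "\<dots> = epowr (on_modulus (Lp_norm M p) g) p"
      using \<open>1 < p\<close> by (simp add: on_modulus_def epowr_Lp_norm)
    also have "\<dots> < \<infinity>" using fin by (auto simp: epowr_def)
    finally show ?thesis
      using \<open>0 < s\<close> by (auto simp: ennreal_mult_less_top divide_ennreal_def inverse_ennreal)
  qed
  finally have "ennreal (2 / s) * ?G \<noteq> \<infinity>" by (auto simp: epowr_def)
  then have G: "?G < \<infinity>" using \<open>0 < s\<close> by (auto simp: ennreal_mult_eq_top_iff top.not_eq_extremum)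
  show ?thesis
  proof (rule integrableI_bounded)
    have "(\<integral>\<^sup>+x. ennreal (norm (if s / 2 \<le> \<sigma> x \<and> \<sigma> x < s then f x else 0)) \<partial>M)
        \<le> (\<integral>\<^sup>+x. ennreal (norm (g x)) * indicator (window M \<sigma> s) x
            + ennreal (norm (h x)) * indicator (window M \<sigma> s) x \<partial>M)"
      by (intro nn_integral_mono)
        (auto simp: window_def fgh norm_triangle_ineq ennreal_leI simp flip: ennreal_plus split: split_indicator)
    also have "\<dots> = ?G + ?H" by (intro nn_integral_add) measurable
    also have "\<dots> < \<infinity>" using G H by simp
    finally show "(\<integral>\<^sup>+x. ennreal (norm (if s / 2 \<le> \<sigma> x \<and> \<sigma> x < s then f x else 0)) \<partial>M) < \<infinity>" .
  qed measurable
qed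

lemma linear_window_op:
  assumes M: "sigma_finite_measure M" and \<sigma>: "uniformizes M \<sigma>" and "1 < p" "1 < q"
  shows "linear_operator_on N (Lp_plus_weak_Lq M p q) (window_op M \<sigma> \<tau> p r)"
proof -
  have "window_op M \<sigma> \<tau> p r (\<lambda>x. f x + g x) y = window_op M \<sigma> \<tau> p r f y + window_op M \<sigma> \<tau> p r g y"
    if "f \<in> Lp_plus_weak_Lq M p q" "g \<in> Lp_plus_weak_Lq M p q" for f g :: "'a \<Rightarrow> 'c" and y
  proof (cases "0 < \<tau> y")
    case True
    let ?s = "\<tau> y powr r"
    let ?w = "\<lambda>f :: 'a \<Rightarrow> 'c. \<lambda>x. if ?s / 2 \<le> \<sigma> x \<and> \<sigma> x < ?s then f x else 0"
    have "integral\<^sup>L M (?w (\<lambda>x. f x + g x)) = (\<integral>x. ?w f x + ?w g x \<partial>M)"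
      by (intro Bochner_Integration.integral_cong) auto
    also have "\<dots> = integral\<^sup>L M (?w f) + integral\<^sup>L M (?w g)"
      using True by (intro Bochner_Integration.integral_add window_integrable[OF M \<sigma> assms(3,4)] that) auto
    finally show ?thesis using True by (simp add: window_op_def window_mean_def scaleR_add_right)
  qed (simp add: window_op_def)
  moreover have "window_op M \<sigma> \<tau> p r (\<lambda>x. \<alpha> * f x) y = \<alpha> * window_op M \<sigma> \<tau> p r f y"
    if "f \<in> Lp_plus_weak_Lq M p q" for f :: "'a \<Rightarrow> 'c" and \<alpha> y
  proof (cases "0 < \<tau> y")
    case True
    let ?s = "\<tau> y powr r"
    let ?w = "\<lambda>f :: 'a \<Rightarrow> 'c. \<lambda>x. if ?s / 2 \<le> \<sigma> x \<and> \<sigma> x < ?s then f x else 0"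
    have "integral\<^sup>L M (?w (\<lambda>x. \<alpha> * f x)) = (\<integral>x. \<alpha> * ?w f x \<partial>M)"
      by (intro Bochner_Integration.integral_cong) auto
    also have "\<dots> = \<alpha> * integral\<^sup>L M (?w f)"
      using True by (intro Bochner_Integration.integral_mult_right window_integrable[OF M \<sigma> assms(3,4)] that) auto
    finally show ?thesis using True by (simp add: window_op_def window_mean_def)
  qed (simp add: window_op_def)
  ultimately show ?thesis unfolding linear_operator_on_def by auto
qed

lemma sawyerable_window_op:
  assumes M: "sigma_finite_measure M" and N: "sigma_finite_measure N"
    and \<sigma>: "uniformizes M \<sigma>" and \<tau>: "uniformizes N \<tau>"
    and p: "1 < p" and q: "1 < q" and "0 < r" and r: "(r - 1) / p = r / q"
  shows "sawyerable M N p q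
    (window_op M \<sigma> \<tau> p r :: ('a \<Rightarrow> 'k::{real_normed_field, euclidean_space}) \<Rightarrow> 'b \<Rightarrow> 'k)"
proof -
  let ?T = "window_op M \<sigma> \<tau> p r :: ('a \<Rightarrow> 'k) \<Rightarrow> 'b \<Rightarrow> 'k"
  let ?D = "Lp_plus_weak_Lq M p q :: ('a \<Rightarrow> 'k) set"
  note window_op_measurable[OF M \<sigma> \<tau>, measurable]
  note uniformizes_measurable[OF \<sigma>, measurable]
  have D: "f \<in> borel_measurable M" if "f \<in> ?D" for f using that by (simp add: Lp_plus_weak_Lq_def)
  have "operator_on M N ?D ?T"
    unfolding operator_on_def
  proof (intro conjI ballI impI)
    fix f assume "f \<in> ?D"
    then show "?T f \<in> borel_measurable N" by (intro window_op_measurable M \<sigma> \<tau> D)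
  next
    fix f g assume "f \<in> ?D" "g \<in> ?D" and eq: "AE x in M. f x = g x"
    then have [measurable]: "f \<in> borel_measurable M" "g \<in> borel_measurable M" using D by auto
    have "window_mean M \<sigma> f s = window_mean M \<sigma> g s" for s
      unfolding window_mean_def using eq by (intro arg_cong[where f = "\<lambda>x. _ *\<^sub>R x"] integral_cong_AE) auto
    then show "AE y in N. ?T f y = ?T g y" by (simp add: window_op_def)
  qed
  moreover have "quasi_linear_operator_on N ?D ?T"
  proof -
    have lin: "linear_operator_on N ?D ?T" by (rule linear_window_op[OF M \<sigma> p q])
    show ?thesis
      unfolding quasi_linear_operator_on_def
    proof (intro conjI exI[of _ 1] ballI allI)
      fix f g assume "f \<in> ?D" "g \<in> ?D"
      then have "AE y in N. ?T (\<lambda>x. f x + g x) y = ?T f y + ?T g y"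
        using lin by (simp add: linear_operator_on_def)
      then show "AE y in N. norm (?T (\<lambda>x. f x + g x) y) \<le> 1 * (norm (?T f y) + norm (?T g y))"
        by eventually_elim (simp add: norm_triangle_ineq)
    next
      fix f \<alpha> assume "f \<in> ?D"
      then have "AE y in N. ?T (\<lambda>x. \<alpha> * f x) y = \<alpha> * ?T f y"
        using lin by (simp add: linear_operator_on_def)
      then show "AE y in N. norm (?T (\<lambda>x. \<alpha> * f x) y) = norm \<alpha> * norm (?T f y)"
        by eventually_elim (simp add: norm_mult)
    qed simp
  qed
  moreover have "bounded_from_to (borel_measurable M)
       (on_modulus (Lp_norm M p)) (on_modulus (Lp_norm N p)) ?T"
    unfolding bounded_from_to_def
  proof (intro exI[of _ "(4 powr p * 3 powr (1 / r)) powr (1 / p)"] conjI ballI impI)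
    fix f :: "'a \<Rightarrow> 'k" assume "f \<in> borel_measurable M"
    then have "on_modulus (Lp_norm N p) (?T f)
        \<le> epowr (ennreal (4 powr p * 3 powr (1 / r)) * (\<integral>\<^sup>+x. epowr (ennreal (norm (f x))) p \<partial>M)) (1 / p)"
      unfolding on_modulus_def Lp_norm_def using p \<open>0 < r\<close>
      by (intro epowr_mono window_op_Lp_bound M N \<sigma> \<tau>) auto
    also have "\<dots> = ennreal ((4 powr p * 3 powr (1 / r)) powr (1 / p)) * on_modulus (Lp_norm M p) f"
      using p by (simp add: on_modulus_def Lp_norm_def epowr_mult epowr_ennreal)
    finally show "on_modulus (Lp_norm N p) (?T f)
        \<le> ennreal ((4 powr p * 3 powr (1 / r)) powr (1 / p)) * on_modulus (Lp_norm M p) f" .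
  qed simp
  moreover have "bounded_from_to (borel_measurable M)
       (on_modulus (weak_Lq_norm M q)) (on_modulus (esssup N)) ?T"
    unfolding bounded_from_to_def
  proof (intro exI[of _ "2 / (1 - 1 / q)"] conjI ballI impI)
    fix f :: "'a \<Rightarrow> 'k" assume f [measurable]: "f \<in> borel_measurable M"
    show "on_modulus (esssup N) (?T f) \<le> ennreal (2 / (1 - 1 / q)) * on_modulus (weak_Lq_norm M q) f"
      unfolding on_modulus_def
    proof (rule esssup_I)
      show "(\<lambda>y. ennreal (norm (?T f y))) \<in> borel_measurable N"
        using window_op_measurable[OF M \<sigma> \<tau> f, of p r] by measurable
    qed (intro AE_I2 window_op_weak_bound[OF M \<sigma> f q r])
  qed (use q in auto)
  ultimately show ?thesis unfolding sawyerable_def by blast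
qed

section \<open>From the linear operator to the boundedness of \<open>R\<close>\<close>

lemma uniformizes_emeasure_le:
  assumes \<tau>: "uniformizes N \<tau>" and "0 \<le> x" "ennreal x \<le> emeasure N (space N)"
  shows "emeasure N {y \<in> space N. 0 < \<tau> y \<and> \<tau> y \<le> x} = ennreal x"
proof (rule antisym)
  note uniformizes_measurable[OF \<tau>, measurable]
  show "emeasure N {y \<in> space N. 0 < \<tau> y \<and> \<tau> y \<le> x} \<le> ennreal x"
  proof (rule ennreal_le_epsilon)
    fix e :: real assume "0 < e"
    then have "emeasure N {y \<in> space N. 0 < \<tau> y \<and> \<tau> y \<le> x}
        \<le> emeasure N {y \<in> space N. 0 < \<tau> y \<and> \<tau> y < x + e}"
      by (intro emeasure_mono) auto
    also have "\<dots> \<le> ennreal x + ennreal e"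
      using \<open>0 < e\<close> \<open>0 \<le> x\<close> by (simp add: uniformizes_emeasure[OF \<tau>])
    finally show "emeasure N {y \<in> space N. 0 < \<tau> y \<and> \<tau> y \<le> x} \<le> ennreal x + ennreal e" .
  qed
  have "ennreal x = emeasure N {y \<in> space N. 0 < \<tau> y \<and> \<tau> y < x}"
    using assms(3) by (simp add: uniformizes_emeasure[OF \<tau>] min_def)
  also have "\<dots> \<le> emeasure N {y \<in> space N. 0 < \<tau> y \<and> \<tau> y \<le> x}"
    by (intro emeasure_mono) auto
  finally show "ennreal x \<le> emeasure N {y \<in> space N. 0 < \<tau> y \<and> \<tau> y \<le> x}" .
qed

text \<open>On \<open>(0, t)\<close> the image of \<open>N\<close> under \<open>\<tau>\<close> is
  Lebesgue measure. Both measures are cut to this interval by a density, since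
  \<open>{\<tau> \<le> 0}\<close> may have infinite measure and the uniqueness theorem compares
  half-lines of finite measure.\<close>

lemma uniformizes_nn_integral:
  assumes \<tau>: "uniformizes N \<tau>" and "0 < t" "ennreal t \<le> emeasure N (space N)"
    and [measurable]: "h \<in> borel_measurable borel"
  shows "(\<integral>\<^sup>+y. h (\<tau> y) * indicator {0<..<t} (\<tau> y) \<partial>N) = (\<integral>\<^sup>+u\<in>{0<..<t}. h u \<partial>lborel)"
proof -
  note uniformizes_measurable[OF \<tau>, measurable]
  let ?M1 = "density (distr N borel \<tau>) (indicator {0<..<t})"
  let ?M2 = "density lborel (indicator {0<..<t})"
  have M1: "emeasure ?M1 A = emeasure N {y \<in> space N. 0 < \<tau> y \<and> \<tau> y < t \<and> \<tau> y \<in> A}"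
    if [measurable]: "A \<in> sets borel" for A
  proof -
    have "emeasure ?M1 A = (\<integral>\<^sup>+y. indicator {0<..<t} (\<tau> y) * indicator A (\<tau> y) \<partial>N)"
      by (simp add: emeasure_density nn_integral_distr)
    also have "\<dots> = (\<integral>\<^sup>+y. indicator {y \<in> space N. 0 < \<tau> y \<and> \<tau> y < t \<and> \<tau> y \<in> A} y \<partial>N)"
      by (intro nn_integral_cong) (auto split: split_indicator)
    also have "\<dots> = emeasure N {y \<in> space N. 0 < \<tau> y \<and> \<tau> y < t \<and> \<tau> y \<in> A}"
      by (intro nn_integral_indicator) measurable
    finally show ?thesis .
  qed
  have M2: "emeasure ?M2 A = emeasure lborel ({0<..<t} \<inter> A)" if [measurable]: "A \<in> sets borel" for A
    by (simp add: emeasure_density flip: indicator_inter_arith)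
  have total: "emeasure N {y \<in> space N. 0 < \<tau> y \<and> \<tau> y < t} = ennreal t"
    using assms(3) by (simp add: uniformizes_emeasure[OF \<tau>] min_def)
  have "?M1 = ?M2"
  proof (rule measure_eqI_lessThan)
    fix x :: real
    have "emeasure ?M1 {x<..} \<le> emeasure N {y \<in> space N. 0 < \<tau> y \<and> \<tau> y < t}"
      by (subst M1) (auto intro!: emeasure_mono)
    then show "emeasure ?M1 {x<..} < \<infinity>" using total by (auto intro: le_less_trans)
    consider "x < 0" | "0 \<le> x" "x < t" | "t \<le> x" by linarith
    then show "emeasure ?M1 {x<..} = emeasure ?M2 {x<..}"
    proof cases
      case 1
      then have "{y \<in> space N. 0 < \<tau> y \<and> \<tau> y < t \<and> \<tau> y \<in> {x<..}} = {y \<in> space N. 0 < \<tau> y \<and> \<tau> y < t}"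
        "{0<..<t} \<inter> {x<..} = {0<..<t}" by auto
      then show ?thesis using total \<open>0 < t\<close> by (simp add: M1 M2 del: greaterThan_iff)
    next
      case 2
      have x: "ennreal x \<le> emeasure N (space N)"
        by (rule order_trans[OF ennreal_leI assms(3)]) (use 2 in simp)
      have "{y \<in> space N. 0 < \<tau> y \<and> \<tau> y < t \<and> \<tau> y \<in> {x<..}}
          = {y \<in> space N. 0 < \<tau> y \<and> \<tau> y < t} - {y \<in> space N. 0 < \<tau> y \<and> \<tau> y \<le> x}" by auto
      also have "emeasure N \<dots> = ennreal t - ennreal x"
        using uniformizes_emeasure_le[OF \<tau> 2(1) x] 2 by (subst emeasure_Diff) (auto simp: total)
      also have "\<dots> = emeasure lborel ({0<..<t} \<inter> {x<..})"
      proof -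
        have "{0<..<t} \<inter> {x<..} = {x<..<t}" using 2 by auto
        then show ?thesis using 2 by (simp add: ennreal_minus)
      qed
      finally show ?thesis by (simp only: M1 M2 greaterThan_borel)
    next
      case 3
      then have "{y \<in> space N. 0 < \<tau> y \<and> \<tau> y < t \<and> \<tau> y \<in> {x<..}} = {}"
        "{0<..<t} \<inter> {x<..} = {}" by auto
      then show ?thesis by (simp only: M1 M2 greaterThan_borel emeasure_empty)
    qed
  qed simp_all
  then have "(\<integral>\<^sup>+u. h u \<partial>?M1) = (\<integral>\<^sup>+u. h u \<partial>?M2)" by simp
  then show ?thesis
    by (simp add: nn_integral_density nn_integral_distr mult.commute)
qed

lemma nn_integral_powr_substitution:
  assumes "1 < r" "0 < t" and [measurable]: "h \<in> borel_measurable borel"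
  shows "(\<integral>\<^sup>+s\<in>{0<..<t powr r}. h s \<partial>lborel)
    = ennreal r * (\<integral>\<^sup>+u\<in>{0<..<t}. ennreal (u powr (r - 1)) * h (u powr r) \<partial>lborel)"
proof -
  \<comment> \<open>The substitution rule asks for a two-sided derivative at the end point 0;
    continued by 0 to the left, the power has derivative 0 there because
    \<open>r > 1\<close>.\<close>
  define g where "g u = (if u \<le> 0 then 0 else u powr r)" for u :: real
  have deriv: "(g has_real_derivative r * u powr (r - 1)) (at u)" if "u \<in> {0..t}" for u
  proof (cases "u = 0")
    case True
    have "((\<lambda>h. \<bar>h\<bar> powr (r - 1)) \<longlongrightarrow> 0) (at (0::real))"
    proof -
      have "((\<lambda>h. \<bar>h\<bar> powr (r - 1)) \<longlongrightarrow> \<bar>0\<bar> powr (r - 1)) (at (0::real))"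
        using \<open>1 < r\<close> by (intro tendsto_powr' tendsto_intros) auto
      then show ?thesis by simp
    qed
    then have "((\<lambda>h. g h / h) \<longlongrightarrow> 0) (at 0)"
    proof (rule Lim_null_comparison[rotated])
      show "\<forall>\<^sub>F h in at 0. norm (g h / h) \<le> \<bar>h\<bar> powr (r - 1)"
      proof (intro always_eventually allI)
        show "norm (g h / h) \<le> \<bar>h\<bar> powr (r - 1)" for h
          by (cases "h \<le> 0") (simp_all add: g_def, simp add: powr_diff)
      qed
    qed
    then show ?thesis using True by (simp add: has_field_derivative_iff g_def)
  next
    case False
    with that have "0 < u" by simp
    then have "((\<lambda>u. u powr r) has_real_derivative r * u powr (r - 1)) (at u)"
      by (rule has_real_derivative_powr)
    then show ?thesis
      by (rule has_field_derivative_transform_within_open[of _ _ _ "{0<..}"]) (use \<open>0 < u\<close> in \<open>auto simp: g_def\<close>)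
  qed
  have "(\<integral>\<^sup>+s\<in>{0<..<t powr r}. h s \<partial>lborel) = (\<integral>\<^sup>+s. h s * indicator {g 0..g t} s \<partial>lborel)"
  proof (rule nn_integral_cong_AE)
    have "AE s in lborel. s \<noteq> 0 \<and> s \<noteq> t powr r"
      using AE_lborel_singleton[of 0] AE_lborel_singleton[of "t powr r"] by auto
    then show "AE s in lborel. h s * indicator {0<..<t powr r} s = h s * indicator {g 0..g t} s"
      by eventually_elim (use \<open>0 < t\<close> in \<open>auto simp: g_def split: split_indicator\<close>)
  qed
  also have "\<dots> = (\<integral>\<^sup>+u. h (g u) * ennreal (r * u powr (r - 1)) * indicator {0..t} u \<partial>lborel)"
    using \<open>1 < r\<close> \<open>0 < t\<close>
    by (intro nn_integral_substitution_aux deriv continuous_on_mult_left continuous_on_powr' continuous_on_id continuous_on_const) auto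
  also have "\<dots> = (\<integral>\<^sup>+u. ennreal r * (ennreal (u powr (r - 1)) * h (u powr r) * indicator {0<..<t} u) \<partial>lborel)"
  proof (rule nn_integral_cong_AE)
    have "AE u in lborel. u \<noteq> 0 \<and> u \<noteq> t"
      using AE_lborel_singleton[of 0] AE_lborel_singleton[of t] by auto
    then show "AE u in lborel. h (g u) * ennreal (r * u powr (r - 1)) * indicator {0..t} u
        = ennreal r * (ennreal (u powr (r - 1)) * h (u powr r) * indicator {0<..<t} u)"
      by eventually_elim
        (use \<open>1 < r\<close> in \<open>auto simp: g_def ennreal_mult mult_ac split: split_indicator\<close>)
  qed
  also have "\<dots> = ennreal r * (\<integral>\<^sup>+u\<in>{0<..<t}. ennreal (u powr (r - 1)) * h (u powr r) \<partial>lborel)"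
    by (intro nn_integral_cmult) measurable
  finally show ?thesis .
qed

text \<open>Transplants \<open>g\<close> to the space of \<open>M\<close>: the level sets of its
  rearrangement are intervals \<open>(0, d)\<close>, whose preimages under \<open>\<sigma>\<close>
  have measure \<open>d\<close>.\<close>

lemma distribution_comp_uniformizes:
  assumes \<sigma>: "uniformizes M \<sigma>" and g: "g \<in> borel_measurable (lborel_Ioo (emeasure M (space M)))" and "0 \<le> l"
  shows "distribution_fun M (\<lambda>x. if 0 < \<sigma> x then rearrangement (lborel_Ioo (emeasure M (space M))) g (\<sigma> x) else 0) l
    = distribution_fun (lborel_Ioo (emeasure M (space M))) g l"
proof -
  note uniformizes_measurable[OF \<sigma>, measurable]
  define d where "d = distribution_fun (lborel_Ioo (emeasure M (space M))) g l"
  have d: "d \<le> emeasure M (space M)"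
    unfolding d_def using distribution_fun_le_space[of "lborel_Ioo (emeasure M (space M))" g l] by simp
  have "{x \<in> space M. ennreal l < (if 0 < \<sigma> x then rearrangement (lborel_Ioo (emeasure M (space M))) g (\<sigma> x) else 0)}
      = {x \<in> space M. 0 < \<sigma> x \<and> ennreal (\<sigma> x) < d}"
    using \<open>0 \<le> l\<close> by (auto simp: less_rearrangement_iff[OF g] d_def)
  moreover have "emeasure M {x \<in> space M. 0 < \<sigma> x \<and> ennreal (\<sigma> x) < d} = d"
  proof (cases d)
    case (real z)
    then have "{x \<in> space M. 0 < \<sigma> x \<and> ennreal (\<sigma> x) < d} = {x \<in> space M. 0 < \<sigma> x \<and> \<sigma> x < z}"
      by (auto simp: ennreal_less_iff)
    then show ?thesis using d real by (simp add: uniformizes_emeasure[OF \<sigma>] min_def)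
  next
    case top
    then have "emeasure M (space M) = top" using d by (simp add: top_unique)
    have "top \<le> emeasure M {x \<in> space M. 0 < \<sigma> x \<and> ennreal (\<sigma> x) < d}"
    proof (rule ennreal_le_if_reals_below)
      fix z :: real
      have "ennreal z = emeasure M {x \<in> space M. 0 < \<sigma> x \<and> \<sigma> x < z}"
        using \<open>emeasure M (space M) = top\<close> by (simp add: uniformizes_emeasure[OF \<sigma>])
      also have "\<dots> \<le> emeasure M {x \<in> space M. 0 < \<sigma> x \<and> ennreal (\<sigma> x) < d}"
        using top by (intro emeasure_mono) auto
      finally show "ennreal z \<le> emeasure M {x \<in> space M. 0 < \<sigma> x \<and> ennreal (\<sigma> x) < d}" .
    qed
    then show ?thesis using top by (simp add: top_unique)
  qed
  ultimately show ?thesis unfolding distribution_fun_def[of M] d_def by simp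
qed

text \<open>The window lies to the left of \<open>s\<close>, where \<open>v\<close> is at least
  \<open>v s\<close>, and has measure exactly \<open>s / 2\<close>. The bound \<open>B\<close>
  provides integrability.\<close>

lemma window_mean_ge:
  assumes \<sigma>: "uniformizes M \<sigma>" and v: "antimono v" "\<And>u. 0 \<le> v u" "\<And>u. v u \<le> B"
    and "0 < s" "ennreal s \<le> emeasure M (space M)"
  shows "v s \<le> norm (window_mean M \<sigma> (\<lambda>x. of_real (if 0 < \<sigma> x then v (\<sigma> x) else 0)
    :: 'k::{real_normed_field, euclidean_space}) s)"
proof -
  note uniformizes_measurable[OF \<sigma>, measurable] window_sets[OF \<sigma>, measurable]
  have "(\<lambda>u. - v u) \<in> borel_measurable borel"
    using v(1) by (intro borel_measurable_mono) (auto simp: mono_def antimono_def)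
  then have "(\<lambda>u. - (- v u)) \<in> borel_measurable borel" by (rule borel_measurable_uminus)
  then have [measurable]: "v \<in> borel_measurable borel" by simp
  define w where "w x = (if s / 2 \<le> \<sigma> x \<and> \<sigma> x < s then v (\<sigma> x) else 0)" for x
  have [measurable]: "w \<in> borel_measurable M" unfolding w_def[abs_def] by measurable
  have W: "emeasure M (window M \<sigma> s) = ennreal (s / 2)"
    using assms by (intro emeasure_window) auto
  have w: "integrable M w"
    using W v by (intro integrableI_bounded_set[where A = "window M \<sigma> s" and B = B])
      (auto simp: w_def window_def)
  have "v s * (s / 2) = (\<integral>x. indicator (window M \<sigma> s) x *\<^sub>R v s \<partial>M)"
    using W \<open>0 < s\<close> by (simp add: measure_def)
  also have "\<dots> \<le> (\<integral>x. w x \<partial>M)"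
  proof (rule integral_mono)
    show "integrable M (\<lambda>x. indicator (window M \<sigma> s) x *\<^sub>R v s)" using W by simp
    show "indicator (window M \<sigma> s) x *\<^sub>R v s \<le> w x" if "x \<in> space M" for x
      using v by (auto simp: w_def window_def split: split_indicator intro: antimonoD)
  qed (rule w)
  finally have "v s \<le> (2 / s) * (\<integral>x. w x \<partial>M)" using \<open>0 < s\<close> by (simp add: field_simps)
  \<comment> \<open>The integral of a nonnegative real function times the unit of \<open>'k\<close>;
    its norm is the real integral, so no cancellation occurs in the scalar field.\<close>
  also have "\<dots> = norm ((2 / s) *\<^sub>R (\<integral>x. w x *\<^sub>R (1 :: 'k) \<partial>M))"
    using v \<open>0 < s\<close> by (subst integral_scaleR_left) (auto simp: w w_def intro!: Bochner_Integration.integral_nonneg)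
  also have "(\<integral>x. w x *\<^sub>R (1 :: 'k) \<partial>M) = (\<integral>x. (if s / 2 \<le> \<sigma> x \<and> \<sigma> x < s
      then of_real (if 0 < \<sigma> x then v (\<sigma> x) else 0) else 0) \<partial>M)"
    using \<open>0 < s\<close> by (intro Bochner_Integration.integral_cong) (auto simp: w_def of_real_def)
  finally show ?thesis unfolding window_mean_def .
qed

text \<open>Truncation turns a possibly infinite \<open>\<phi>\<close> into bounded functions from
  which test functions for the operator can be built; these two facts supply the monotone limit for
  the Fatou property.\<close>

lemma hardy_mean_SUP:
  assumes "0 < p" "antimono \<phi>"
  shows "hardy_mean p r \<phi> t = (SUP n. hardy_mean p r (\<lambda>u. min (\<phi> u) (of_nat n)) t)"
    "incseq (\<lambda>n. hardy_mean p r (\<lambda>u. min (\<phi> u) (of_nat n)) t)"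
proof -
  have [measurable]: "\<phi> \<in> borel_measurable borel" by (rule borel_measurable_antimono) fact
  have min_SUP: "z = (SUP n. min z (of_nat n))" for z :: ennreal
  proof (cases z)
    case (real x)
    obtain n :: nat where "x \<le> n" using real_arch_simple by blast
    then have "z \<le> of_nat n" using real by (simp add: ennreal_of_nat_eq_real_of_nat ennreal_leI)
    then have "z \<le> (SUP n. min z (of_nat n))" by (intro SUP_upper2[of n]) auto
    then show ?thesis by (intro antisym SUP_least) auto
  qed (simp add: ennreal_SUP_of_nat_eq_top)
  have min_mono: "min z (of_nat m) \<le> min z (of_nat n)" if "m \<le> n" for m n and z :: ennreal
    using that by (simp add: min.coboundedI2)
  have mono: "epowr (min (\<phi> u) (of_nat m)) p * indicator A u \<le> epowr (min (\<phi> u) (of_nat n)) p * indicator A u"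
    if "m \<le> n" for m n u A
    using that \<open>0 < p\<close> by (intro mult_right_mono epowr_mono min_mono) auto
  have "(\<integral>\<^sup>+s\<in>{0<..<t powr r}. epowr (\<phi> s) p \<partial>lborel)
      = (\<integral>\<^sup>+s. (SUP n. epowr (min (\<phi> s) (of_nat n)) p * indicator {0<..<t powr r} s) \<partial>lborel)"
    by (subst min_SUP) (simp add: epowr_SUP \<open>0 < p\<close> SUP_mult_right_ennreal)
  also have "\<dots> = (SUP n. \<integral>\<^sup>+s\<in>{0<..<t powr r}. epowr (min (\<phi> s) (of_nat n)) p \<partial>lborel)"
    by (intro nn_integral_monotone_convergence_SUP) (auto simp: incseq_def le_fun_def mono)
  finally show "hardy_mean p r \<phi> t = (SUP n. hardy_mean p r (\<lambda>u. min (\<phi> u) (of_nat n)) t)"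
    unfolding hardy_mean_def using \<open>0 < p\<close> by (simp add: SUP_divide_ennreal epowr_SUP)
  show "incseq (\<lambda>n. hardy_mean p r (\<lambda>u. min (\<phi> u) (of_nat n)) t)"
    unfolding hardy_mean_def incseq_def using \<open>0 < p\<close>
    by (intro allI impI epowr_mono divide_right_mono_ennreal nn_integral_mono mono) auto
qed

lemma R_op_bounded_if_window_op_bounded:
  fixes M :: "'a measure" and N :: "'b measure"
  assumes N: "sigma_finite_measure N" and M: "sigma_finite_measure M"
    and \<sigma>: "uniformizes M \<sigma>" and \<tau>: "uniformizes N \<tau>"
    and p: "1 < p" and pq: "p < q"
    and "ri_function_norm M X"
    and X: "representation_norm M X X_rep" and Y: "representation_norm N Y Y_rep"
    and T: "bounded_from_to (borel_measurable M) (on_modulus X) (on_modulus (power_maximal_norm N Y_rep p))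
      (window_op M \<sigma> \<tau> p (q / (q - p)) :: ('a \<Rightarrow> 'k::{real_normed_field, euclidean_space}) \<Rightarrow> 'b \<Rightarrow> 'k)"
  shows "bounded_from_to (borel_measurable (lborel_Ioo (emeasure M (space M)))) X_rep Y_rep
      (\<lambda>g. R_op p q (zero_extension (emeasure M (space M)) g))"
proof -
  note uniformizes_measurable[OF \<sigma>, measurable] uniformizes_measurable[OF \<tau>, measurable]
  define a where "a = emeasure M (space M)"
  define b where "b = emeasure N (space N)"
  define r where "r = q / (q - p)"
  have r: "1 < r" using p pq by (simp add: r_def)
  interpret X: ri_function_norm M X by fact
  have riX: "ri_function_norm (lborel_Ioo a) X_rep"
    using X by (simp add: representation_norm_def a_def)
  have riY: "ri_function_norm (lborel_Ioo b) Y_rep"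
    using Y by (simp add: representation_norm_def b_def)
  interpret Y: ri_function_norm "lborel_Ioo b" Y_rep by fact
  let ?T = "window_op M \<sigma> \<tau> p r :: ('a \<Rightarrow> 'k) \<Rightarrow> 'b \<Rightarrow> 'k"
  obtain C where C: "0 < C" "\<And>f :: 'a \<Rightarrow> 'k. f \<in> borel_measurable M \<Longrightarrow> on_modulus X f < \<infinity> \<Longrightarrow>
      on_modulus (power_maximal_norm N Y_rep p) (?T f) \<le> ennreal C * on_modulus X f"
    using T unfolding bounded_from_to_def r_def by blast
  show ?thesis
    unfolding bounded_from_to_def a_def[symmetric]
  \<comment> \<open>The factor \<open>r\<close> of \<open>nn_integral_powr_substitution\<close>,
    under the power \<open>1 / p\<close>.\<close>
  proof (intro exI[of _ "r powr (1 / p) * C"] conjI ballI impI)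
    show "0 < r powr (1 / p) * C" using C r by simp
    fix g assume g: "g \<in> borel_measurable (lborel_Ioo a)" and fin: "X_rep g < \<infinity>"
    define \<phi> where "\<phi> = rearrangement (lborel_Ioo a) g"
    have \<phi>: "antimono \<phi>" unfolding \<phi>_def by (rule rearrangement_antimono)
    have [measurable]: "\<phi> \<in> borel_measurable borel" unfolding \<phi>_def by measurable
    define F where "F x = (if 0 < \<sigma> x then \<phi> (\<sigma> x) else 0)" for x
    have [measurable]: "F \<in> borel_measurable M" unfolding F_def[abs_def] by measurable
    have XF: "X F = X_rep g"
    proof -
      have "rearrangement M F = \<phi>"
        unfolding F_def[abs_def] \<phi>_def a_def
        by (intro rearrangement_cong distribution_comp_uniformizes[OF \<sigma>]) (use g in \<open>simp_all add: a_def\<close>)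
      moreover have "X F = X_rep (rearrangement M F)"
        using X by (simp add: representation_norm_def)
      ultimately show ?thesis
        using ri_norm_rearrangement[OF riX g] by (simp add: \<phi>_def)
    qed
    have bound: "Y_rep (hardy_mean p r (\<lambda>u. min (\<phi> u) (of_nat n))) \<le> ennreal (r powr (1 / p) * C) * X_rep g" for n
    proof -
      define v where "v u = enn2real (min (\<phi> u) (of_nat n))" for u
      have ennreal_v: "ennreal (v u) = min (\<phi> u) (of_nat n)" for u
        unfolding v_def by (intro ennreal_enn2real) (simp add: min_less_iff_disj ennreal_of_nat_eq_real_of_nat)
      have v: "antimono v" "\<And>u. 0 \<le> v u" "\<And>u. v u \<le> n"
      proof -
        show "antimono v"
          unfolding v_def using \<phi>
          by (intro antimonoI enn2real_mono min.mono) (auto dest: antimonoD simp: min_less_iff_disj ennreal_of_nat_eq_real_of_nat)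
        have "ennreal (v u) \<le> ennreal n" for u by (simp add: ennreal_v ennreal_of_nat_eq_real_of_nat)
        then show "v u \<le> n" for u by (simp add: ennreal_le_iff)
      qed (simp add: v_def)
      define f :: "'a \<Rightarrow> 'k" where "f x = of_real (if 0 < \<sigma> x then v (\<sigma> x) else 0)" for x
      have [measurable]: "v \<in> borel_measurable borel" unfolding v_def[abs_def] by measurable
      have [measurable]: "f \<in> borel_measurable M" unfolding f_def[abs_def] by measurable
      have norm_f: "ennreal (norm (f x)) = (if 0 < \<sigma> x then min (\<phi> (\<sigma> x)) (of_nat n) else 0)" for x
        using v(2) by (simp add: f_def ennreal_v)
      have Xf: "on_modulus X f \<le> X_rep g"
        unfolding XF[symmetric] on_modulus_def
        by (intro X.monotone AE_I2) (auto simp: norm_f F_def)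
      have low: "ennreal (\<tau> y powr (r - 1)) * epowr (min (\<phi> (\<tau> y powr r)) (of_nat n)) p
          \<le> epowr (ennreal (norm (?T f y))) p" if "0 < \<tau> y" for y
      proof -
        let ?s = "\<tau> y powr r"
        have "0 < ?s" using that by simp
        have vs: "v ?s \<le> norm (window_mean M \<sigma> f ?s)"
        proof (cases "ennreal ?s \<le> a")
          case True
          then show ?thesis
            unfolding f_def[abs_def] using \<open>0 < ?s\<close> by (intro window_mean_ge[OF \<sigma> v]) (auto simp: a_def)
        next
          \<comment> \<open>Beyond the total measure \<open>a\<close> the window may be too small
            for \<open>window_mean_ge\<close>, but there \<open>\<phi>\<close> vanishes.\<close>
          case False
          then have "\<not> ennreal 0 < \<phi> ?s"
            unfolding \<phi>_def using distribution_fun_le_space[of "lborel_Ioo a" g 0]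
            by (subst less_rearrangement_iff[OF g]) auto
          then have "v ?s = 0" by (simp add: v_def)
          then show ?thesis by simp
        qed
        have "ennreal (\<tau> y powr (r - 1)) * epowr (min (\<phi> ?s) (of_nat n)) p
            = epowr (ennreal (\<tau> y powr ((r - 1) / p) * v ?s)) p"
          using p v(2) by (simp add: ennreal_mult epowr_mult ennreal_v epowr_ennreal powr_powr)
        also have "\<dots> \<le> epowr (ennreal (norm (?T f y))) p"
          using p vs that by (intro epowr_mono ennreal_leI) (auto simp: window_op_def mult_left_mono)
        finally show ?thesis .
      qed
      \<comment> \<open>Only \<open>t < b\<close> count for \<open>Y_rep\<close>. For these the set
        \<open>{0 < \<tau> < t}\<close> has measure \<open>t\<close>: integrals of functions of
        \<open>\<tau>\<close> over it become Lebesgue integrals over \<open>(0, t)\<close>, and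
        Hardy--Littlewood bounds the integral of the image of \<open>f\<close> over it by that of
        the rearrangement.\<close>
      have point: "hardy_mean p r (\<lambda>u. min (\<phi> u) (of_nat n)) t
          \<le> ennreal (r powr (1 / p)) * epowr (maximal_rearrangement N (\<lambda>y. epowr (ennreal (norm (?T f y))) p) t) (1 / p)"
        if t: "0 < t" "ennreal t < b" for t
      proof -
        have [measurable]: "?T f \<in> borel_measurable N" by (intro window_op_measurable M \<sigma> \<tau>) measurable
        let ?h = "\<lambda>u. epowr (min (\<phi> u) (of_nat n)) p"
        let ?E = "{y \<in> space N. 0 < \<tau> y \<and> \<tau> y < t}"
        have "(\<integral>\<^sup>+u\<in>{0<..<t}. ennreal (u powr (r - 1)) * ?h (u powr r) \<partial>lborel)
            = (\<integral>\<^sup>+y. (ennreal (\<tau> y powr (r - 1)) * ?h (\<tau> y powr r)) * indicator {0<..<t} (\<tau> y) \<partial>N)"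
          using t unfolding b_def by (intro uniformizes_nn_integral[OF \<tau>, symmetric]) auto
        also have "\<dots> \<le> (\<integral>\<^sup>+y\<in>?E. epowr (ennreal (norm (?T f y))) p \<partial>N)"
          using low by (intro nn_integral_mono) (auto split: split_indicator)
        also have "\<dots> \<le> (\<integral>\<^sup>+s\<in>{0<..<t}. rearrangement N (\<lambda>y. epowr (ennreal (norm (?T f y))) p) s \<partial>lborel)"
          using t by (intro set_nn_integral_le_rearrangement N) (auto simp: uniformizes_emeasure[OF \<tau>])
        finally have "(\<integral>\<^sup>+s\<in>{0<..<t powr r}. ?h s \<partial>lborel)
            \<le> ennreal r * (\<integral>\<^sup>+s\<in>{0<..<t}. rearrangement N (\<lambda>y. epowr (ennreal (norm (?T f y))) p) s \<partial>lborel)"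
          using r t by (subst nn_integral_powr_substitution) (auto intro: mult_left_mono)
        then have "(\<integral>\<^sup>+s\<in>{0<..<t powr r}. ?h s \<partial>lborel) / ennreal t
            \<le> ennreal r * maximal_rearrangement N (\<lambda>y. epowr (ennreal (norm (?T f y))) p) t"
          unfolding maximal_rearrangement_def ennreal_times_divide by (rule divide_right_mono_ennreal)
        then have "hardy_mean p r (\<lambda>u. min (\<phi> u) (of_nat n)) t
            \<le> epowr (ennreal r * maximal_rearrangement N (\<lambda>y. epowr (ennreal (norm (?T f y))) p) t) (1 / p)"
          unfolding hardy_mean_def using p by (intro epowr_mono) auto
        then show ?thesis using p r by (simp add: epowr_mult epowr_ennreal)
      qed
      have "Y_rep (hardy_mean p r (\<lambda>u. min (\<phi> u) (of_nat n)))
          \<le> Y_rep (\<lambda>t. ennreal (r powr (1 / p)) *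
              epowr (maximal_rearrangement N (\<lambda>y. epowr (ennreal (norm (?T f y))) p) t) (1 / p))"
        by (intro Y.monotone AE_lborel_IooI measurable_lborel_Ioo point) measurable
      also have "\<dots> = ennreal (r powr (1 / p)) * on_modulus (power_maximal_norm N Y_rep p) (?T f)"
        unfolding on_modulus_def power_maximal_norm_def
        by (intro Y.homogeneous measurable_lborel_Ioo) auto
      also have "\<dots> \<le> ennreal (r powr (1 / p)) * (ennreal C * on_modulus X f)"
        using le_less_trans[OF Xf fin] by (intro mult_left_mono C(2)) auto
      also have "\<dots> \<le> ennreal (r powr (1 / p)) * (ennreal C * X_rep g)"
        by (intro mult_left_mono Xf) auto
      finally show ?thesis using C(1) by (simp add: ennreal_mult mult.assoc)
    qed
    have "(\<lambda>n. Y_rep (hardy_mean p r (\<lambda>u. min (\<phi> u) (of_nat n)))) \<longlonglongrightarrow> Y_rep (hardy_mean p r \<phi>)"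
    proof (rule Y.fatou[THEN conjunct2])
      show "AE t in lborel_Ioo b. incseq (\<lambda>n. hardy_mean p r (\<lambda>u. min (\<phi> u) (of_nat n)) t) \<and>
          (\<lambda>n. hardy_mean p r (\<lambda>u. min (\<phi> u) (of_nat n)) t) \<longlonglongrightarrow> hardy_mean p r \<phi> t"
      proof (intro AE_I2 conjI)
        fix t
        show inc: "incseq (\<lambda>n. hardy_mean p r (\<lambda>u. min (\<phi> u) (of_nat n)) t)"
          using p by (intro hardy_mean_SUP(2) \<phi>) simp
        show "(\<lambda>n. hardy_mean p r (\<lambda>u. min (\<phi> u) (of_nat n)) t) \<longlonglongrightarrow> hardy_mean p r \<phi> t"
          using p LIMSEQ_SUP[OF inc] by (subst hardy_mean_SUP(1)) (auto intro: \<phi>)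
      qed
    qed (intro measurable_lborel_Ioo hardy_mean_measurable)+
    then have "Y_rep (hardy_mean p r \<phi>) \<le> ennreal (r powr (1 / p) * C) * X_rep g"
      by (rule LIMSEQ_le_const2) (use bound in auto)
    then show "Y_rep (R_op p q (zero_extension a g)) \<le> ennreal (r powr (1 / p) * C) * X_rep g"
      unfolding R_op_eq_hardy_mean rearrangement_zero_extension r_def[symmetric] \<phi>_def .
  qed
qed

theorem theorem1p4:
  fixes M :: "'a measure" and N :: "'b measure"
    and p q :: real
    and X :: "('a \<Rightarrow> ennreal) \<Rightarrow> ennreal" and Y :: "('b \<Rightarrow> ennreal) \<Rightarrow> ennreal"
    and X_rep Y_rep :: "(real \<Rightarrow> ennreal) \<Rightarrow> ennreal"
  assumes "sigma_finite_measure M" and "nonatomic M"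
    and "sigma_finite_measure N" and "nonatomic N"
    and "1 < p" and "p < q"
    and "ri_function_norm M X" and "ri_function_norm N Y"
    and "representation_norm M X X_rep" and "representation_norm N Y Y_rep"
    and "included_in (borel_measurable M :: ('a \<Rightarrow> 'k::{real_normed_field, euclidean_space}) set)
           (on_modulus X) (sum_norm M (Lp_norm M p) (weak_Lq_norm M q))"
  defines "i \<equiv> \<forall>T :: ('a \<Rightarrow> 'k) \<Rightarrow> 'b \<Rightarrow> 'k.
      sawyerable M N p q T \<and> linear_operator_on N (Lp_plus_weak_Lq M p q) T \<longrightarrow>
      bounded_from_to (borel_measurable M)
        (on_modulus X) (on_modulus (power_maximal_norm N Y_rep p)) T"
    and "ii \<equiv> \<forall>T :: ('a \<Rightarrow> 'k) \<Rightarrow> 'b \<Rightarrow> 'k.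
      sawyerable M N p q T \<longrightarrow>
      bounded_from_to (borel_measurable M)
        (on_modulus X) (on_modulus (power_maximal_norm N Y_rep p)) T"
    and "iii \<equiv> bounded_from_to (borel_measurable (lborel_Ioo (emeasure M (space M)))) X_rep Y_rep
      (\<lambda>g. R_op p q (zero_extension (emeasure M (space M)) g))"
  shows "(i \<longleftrightarrow> ii) \<and> (ii \<longleftrightarrow> iii)"
proof -
  have "iii \<Longrightarrow> ii"
    unfolding ii_def iii_def
    using bounded_if_R_op_bounded[OF assms(1,3,5,6,9,10,11)] by blast
  moreover have "ii \<Longrightarrow> i" unfolding i_def ii_def by blast
  moreover have iii if i
  proof -
    obtain \<sigma> where \<sigma>: "uniformizes M \<sigma>" using nonatomic_uniformization[OF assms(2)] .
    obtain \<tau> where \<tau>: "uniformizes N \<tau>" using nonatomic_uniformization[OF assms(4)] .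
    let ?T = "window_op M \<sigma> \<tau> p (q / (q - p)) :: ('a \<Rightarrow> 'k) \<Rightarrow> 'b \<Rightarrow> 'k"
    have r: "0 < q / (q - p)" "(q / (q - p) - 1) / p = q / (q - p) / q" and q: "1 < q"
      using assms(5,6) by (auto simp: field_simps)
    have "sawyerable M N p q ?T"
      by (rule sawyerable_window_op[OF assms(1,3) \<sigma> \<tau> assms(5) q r])
    moreover have "linear_operator_on N (Lp_plus_weak_Lq M p q) ?T"
      by (rule linear_window_op[OF assms(1) \<sigma> assms(5) q])
    ultimately have "bounded_from_to (borel_measurable M) (on_modulus X)
        (on_modulus (power_maximal_norm N Y_rep p)) ?T"
      using that unfolding i_def by blast
    then show iii
      unfolding iii_def
      by (rule R_op_bounded_if_window_op_bounded[OF assms(3,1) \<sigma> \<tau> assms(5,6,7,9,10)])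
  qed
  ultimately show ?thesis by blast
qed

end
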